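(* Let $\mathcal B$ be an ungraded unital $C^*$-algebra equipped with a continuous normalized trace $\mathcal T_{\mathcal B}$, let $\mathcal H_{\mathcal B}$ be the standard Hilbert $\mathcal B$-module, and let $T\in\mathbb B(\mathcal H_{\mathcal B})$ with $\|T\|\le 1$. If there exists a natural number $n\geq 1$ such that $$(1-T^*T)^n,\ (1-TT^* )^n\in \mathbb S_1(\mathcal H_{\mathcal B})\cap\mathbb K(\mathcal H_{\mathcal B}),$$ then $T$ is a generalized Fredholm operator on $\mathcal H_{\mathcal B}$, and the trace of its generalized Fredholm index is $$\mathrm{Tr}\big(\mathrm{Ind}(T)\big)=\mathrm{Tr}\big((1-T^*T)^n\big)-\mathrm{Tr}\big((1-TT^* )^n\big).$$
   Context: Hilbert modules are right Hilbert $C^*$-modules with $\mathcal B$-valued inner product linear in the second variable. For a Hilbert $\mathcal B$-module $E$, $\mathbb B(E)$ is the $C^*$-algebra of adjointable operators, $\Theta_{\psi,\psi'}(\phi)=\psi\langle\psi',\phi\rangle$ are the rank-one operators and $\mathbb K(E)$ (the compact operators) is the norm closure of their linear span. $\mathcal H_{\mathcal B}=\{(b_n)_{n\in\mathbb N}: b_n\in\mathcal B,\ \sum_n b_n^*b_n \text{ converges in norm}\}$ with $\langle (b_n),(b'_n)\rangle=\sum_n b_n^*b_n'$. A continuous normalized trace on $\mathcal B$ is a tracial state $\mathcal T_{\mathcal B}$. It induces, for positive $T\in\mathbb B(E)$, $$\mathrm{Tr}(T)=\sup\Big\{\sum_{\psi\in I}\mathcal T_{\mathcal B}(\langle\psi,T\psi\rangle):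 I\subset E \text{ finite},\ \sum_{\psi\in I}\Theta_{\psi,\psi}\le 1\Big\}\in[0,\infty].$$ $\mathbb S_1(E)$ is the linear span of the positive $T\in\mathbb B(E)$ with $\mathrm{Tr}(T)<\infty$; $\mathrm{Tr}$ extends to a positive linear functional on the two-sided ideal $\mathbb S_1(E)$, with $\mathrm{Tr}(\Theta_{\psi,\psi'})=\mathcal T_{\mathcal B}(\langle\psi',\psi\rangle)$ and $\mathrm{Tr}(ST)=\mathrm{Tr}(TS)$ for $S\in\mathbb B(E)$, $T\in\mathbb S_1(E)$. Elements of $K_0(\mathcal B)$ are written $[P]_0-[Q]_0$ with projections $P,Q\in\mathbb K(\mathcal H_{\mathcal B})$ (which are automatically finite rank), and $\mathrm{Tr}:K_0(\mathcal B)\to\mathbb R$ is $\mathrm{Tr}([P]_0-[Q]_0)=\mathrm{Tr}(P)-\mathrm{Tr}(Q)$. $T\in\mathbb B(E)$ is a generalized Fredholm operator if it is invertible modulo $\mathbb K(E)$. For a generalized Fredholm $T\in \mathbb B(\mathcal H_{\mathcal B})$ there is a compact perturbation $G\in T+\mathbb K(\mathcal H_{\mathcal B})$ with a polar decomposition $G=W|G|$, $W$ a partial isometry that is generalized Fredholm and satisfies $W^*W|G|=|G|=|G|W^*W$; then $\mathrm{Ind}(T)=[1-W^*W]_0-[1-WW^*]_0\in K_0(\mathcal B)$, which does not depend on the choice of $G$ (it is the image of the class of $T$ under the $K$-theoretic index map $K_1(\mathbb B(\mathcal H_{\mathcal B})/\mathbb K(\mathcal H_{\mathcal B}))\to K_0(\mathbb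 K(\mathcal H_{\mathcal B}))\cong K_0(\mathcal B)$). *)

theory Defs
  imports "HOL-Analysis.Analysis" "HOL-Library.Function_Algebras"
begin

section \<open>Unital C*-algebras and tracial states\<close>

text \<open>
  Since \<open>real_normed_algebra_1\<close> contains \<open>norm 1 = 1\<close>, the algebra is nonzero; this excludes
  nothing below, because the zero algebra has no tracial state.
\<close>

class unital_cstar_algebra = real_normed_algebra_1 + banach +
  fixes scaleC :: "complex \<Rightarrow> 'a \<Rightarrow> 'a"
    and star :: "'a \<Rightarrow> 'a"
  assumes scaleC_of_real: "scaleC (complex_of_real r) a = r *\<^sub>R a"
    and scaleC_add_right: "scaleC c (a + b) = scaleC c a + scaleC c b"
    and scaleC_add_left: "scaleC (c + d) a = scaleC c a + scaleC d a"
    and scaleC_scaleC: "scaleC c (scaleC d a) = scaleC (c * d) a"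
    and scaleC_mult_left: "scaleC c a * b = scaleC c (a * b)"
    and scaleC_mult_right: "a * scaleC c b = scaleC c (a * b)"
    and norm_scaleC: "norm (scaleC c a) = cmod c * norm a"
    and star_add: "star (a + b) = star a + star b"
    and star_scaleC: "star (scaleC c a) = scaleC (cnj c) (star a)"
    and star_mult: "star (a * b) = star b * star a"
    and star_star: "star (star a) = a"
    and cstar_identity: "norm (star a * a) = (norm a)\<^sup>2"

definition tracial_state :: "('b::unital_cstar_algebra \<Rightarrow> complex) \<Rightarrow> bool" where
  "tracial_state \<tau> \<longleftrightarrow>
     bounded_linear \<tau> \<and>
     (\<forall>c a. \<tau> (scaleC c a) = c * \<tau> a) \<and>
     (\<forall>a. \<tau> (star a * a) \<in> \<real> \<and> 0 \<le> Re (\<tau> (star a * a))) \<and>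
     \<tau> 1 = 1 \<and>
     (\<forall>a b. \<tau> (a * b) = \<tau> (b * a))"


section \<open>The standard Hilbert module\<close>

definition hilb :: "(nat \<Rightarrow> 'b::unital_cstar_algebra) set" where
  "hilb = {x. summable (\<lambda>k. star (x k) * x k)}"

definition ip :: "(nat \<Rightarrow> 'b::unital_cstar_algebra) \<Rightarrow> (nat \<Rightarrow> 'b) \<Rightarrow> 'b" where
  "ip x y = (\<Sum>k. star (x k) * y k)"

definition hnorm :: "(nat \<Rightarrow> 'b::unital_cstar_algebra) \<Rightarrow> real" where
  "hnorm x = sqrt (norm (ip x x))"


section \<open>Adjointable operators\<close>

text \<open>
  An operator on the module is represented by a function on all sequences that vanishes outside
  \<open>hilb\<close>, so that operators are equal iff they agree on \<open>hilb\<close>.  Sums and differences of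
  operators are the pointwise ones, the product is \<open>\<circ>\<close> (not the pointwise \<open>*\<close>), and the unit is
  \<open>idop\<close> (neither \<open>id\<close> nor \<open>1\<close>).  Note that \<open>-\<close> binds more
  tightly than \<open>\<circ>\<close>.
\<close>

type_synonym 'b oper = "(nat \<Rightarrow> 'b) \<Rightarrow> (nat \<Rightarrow> 'b)"

definition hilb_maps :: "'b::unital_cstar_algebra oper set" where
  "hilb_maps = {T. (\<forall>x\<in>hilb. T x \<in> hilb) \<and> (\<forall>x. x \<notin> hilb \<longrightarrow> T x = 0)}"

definition is_adjoint :: "'b::unital_cstar_algebra oper \<Rightarrow> 'b oper \<Rightarrow> bool" where
  "is_adjoint T S \<longleftrightarrow> S \<in> hilb_maps \<and> (\<forall>x\<in>hilb. \<forall>y\<in>hilb. ip x (T y) = ip (S x) y)"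

text \<open>As usual, linearity and boundedness follow from the existence of an adjoint.\<close>

definition adjointable :: "'b::unital_cstar_algebra oper set" where
  "adjointable = {T \<in> hilb_maps. \<exists>S. is_adjoint T S}"

definition adj :: "'b::unital_cstar_algebra oper \<Rightarrow> 'b oper" where
  "adj T = (THE S. is_adjoint T S)"

definition idop :: "'b::unital_cstar_algebra oper" where
  "idop x = (if x \<in> hilb then x else 0)"

definition opscale :: "complex \<Rightarrow> 'b::unital_cstar_algebra oper \<Rightarrow> 'b oper" where
  "opscale c T = (\<lambda>x k. scaleC c (T x k))"

definition opnorm :: "'b::unital_cstar_algebra oper \<Rightarrow> real" where
  "opnorm T = (SUP x\<in>{x \<in> hilb. hnorm x \<le> 1}. hnorm (T x))"

definition op_positive :: "'b::unital_cstar_algebra oper \<Rightarrow> bool" where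
  "op_positive T \<longleftrightarrow> (\<exists>S\<in>adjointable. T = adj S \<circ> S)"

definition op_le :: "'b::unital_cstar_algebra oper \<Rightarrow> 'b oper \<Rightarrow> bool" where
  "op_le S T \<longleftrightarrow> op_positive (T - S)"

interpretation oper: vector_space "opscale :: complex \<Rightarrow> 'b::unital_cstar_algebra oper \<Rightarrow> 'b oper"
proof
  have one: "scaleC 1 a = a" for a :: 'b
    using scaleC_of_real[of 1 a] by simp
  show "opscale a (x + y) = opscale a x + opscale a y" for a and x y :: "'b oper"
    by (simp add: opscale_def fun_eq_iff scaleC_add_right)
  show "opscale (a + b) x = opscale a x + opscale b x" for a b and x :: "'b oper"
    by (simp add: opscale_def fun_eq_iff scaleC_add_left)
  show "opscale a (opscale b x) = opscale (a * b) x" for a b and x :: "'b oper"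
    by (simp add: opscale_def scaleC_scaleC)
  show "opscale 1 x = x" for x :: "'b oper"
    by (simp add: opscale_def one)
qed


section \<open>Compact and generalized Fredholm operators\<close>

definition rank_one :: "(nat \<Rightarrow> 'b::unital_cstar_algebra) \<Rightarrow> (nat \<Rightarrow> 'b) \<Rightarrow> 'b oper" where
  "rank_one x y = (\<lambda>z. if z \<in> hilb then (\<lambda>k. x k * ip y z) else 0)"

definition finite_rank :: "'b::unital_cstar_algebra oper set" where
  "finite_rank = oper.span {rank_one x y | x y. x \<in> hilb \<and> y \<in> hilb}"

definition compact_ops :: "'b::unital_cstar_algebra oper set" where
  "compact_ops = {T \<in> adjointable. \<forall>\<epsilon>>0. \<exists>F\<in>finite_rank. opnorm (T - F) < \<epsilon>}"

definition gen_fredholm :: "'b::unital_cstar_algebra oper \<Rightarrow> bool" where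
  "gen_fredholm T \<longleftrightarrow> T \<in> adjointable \<and>
     (\<exists>S\<in>adjointable. (S \<circ> T) - idop \<in> compact_ops \<and> (T \<circ> S) - idop \<in> compact_ops)"


section \<open>The trace induced on operators\<close>

text \<open>
  On positive operators the trace takes values in \<open>[0,\<infinity>]\<close>; there each \<open>\<tau> (ip x (T x))\<close> is a
  nonnegative real, so neither \<open>Re\<close> nor \<open>ennreal\<close> loses information.
\<close>

definition pos_trace :: "('b::unital_cstar_algebra \<Rightarrow> complex) \<Rightarrow> 'b oper \<Rightarrow> ennreal" where
  "pos_trace \<tau> T =
     (SUP I\<in>{I. finite I \<and> I \<subseteq> hilb \<and> op_le (\<Sum>x\<in>I. rank_one x x) idop}.
        ennreal (\<Sum>x\<in>I. Re (\<tau> (ip x (T x)))))"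

definition pos_trace_class :: "('b::unital_cstar_algebra \<Rightarrow> complex) \<Rightarrow> 'b oper set" where
  "pos_trace_class \<tau> = {T. op_positive T \<and> pos_trace \<tau> T < \<infinity>}"

definition trace_class :: "('b::unital_cstar_algebra \<Rightarrow> complex) \<Rightarrow> 'b oper set" where
  "trace_class \<tau> = oper.span (pos_trace_class \<tau>)"

text \<open>The linear extension of the trace from \<open>pos_trace_class\<close> to its span \<open>trace_class\<close>.\<close>

definition op_trace :: "('b::unital_cstar_algebra \<Rightarrow> complex) \<Rightarrow> 'b oper \<Rightarrow> complex" where
  "op_trace \<tau> T =
     (THE t. \<exists>F c. finite F \<and> F \<subseteq> pos_trace_class \<tau> \<and>
        T = (\<Sum>A\<in>F. opscale (c A) A) \<and>
        t = (\<Sum>A\<in>F. c A * complex_of_real (enn2real (pos_trace \<tau> A))))"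


section \<open>The group \<open>K\<^sub>0\<close> of the coefficient algebra\<close>

definition projection :: "'b::unital_cstar_algebra oper \<Rightarrow> bool" where
  "projection P \<longleftrightarrow> P \<in> adjointable \<and> P \<circ> P = P \<and> adj P = P"

definition compact_projections :: "'b::unital_cstar_algebra oper set" where
  "compact_projections = {P \<in> compact_ops. projection P}"

text \<open>
  Murray--von Neumann classes of projections in the compact operators form an abelian semigroup
  under orthogonal sums; \<open>K\<^sub>0\<close> is its Grothendieck group.  An element of \<open>K\<^sub>0\<close> is represented as
  the equivalence class (a set) of the pairs of projections having the given formal difference.
\<close>

definition mvn_class :: "'b::unital_cstar_algebra oper \<Rightarrow> 'b oper set" where
  "mvn_class P =
     {Q \<in> compact_projections. \<exists>V\<in>compact_ops. adj V \<circ> V = P \<and> V \<circ> adj V = Q}"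

definition mvn_add :: "'b::unital_cstar_algebra oper set \<Rightarrow> 'b oper set \<Rightarrow> 'b oper set" where
  "mvn_add X Y = (\<Union>P\<in>X. \<Union>Q\<in>{Q \<in> Y. P \<circ> Q = 0}. mvn_class (P + Q))"

definition K0_diff :: "'b::unital_cstar_algebra oper \<Rightarrow> 'b oper \<Rightarrow> ('b oper \<times> 'b oper) set" where
  "K0_diff P Q =
     {(P', Q'). P' \<in> compact_projections \<and> Q' \<in> compact_projections \<and>
        (\<exists>R\<in>compact_projections.
           mvn_add (mvn_add (mvn_class P) (mvn_class Q')) (mvn_class R) =
           mvn_add (mvn_add (mvn_class P') (mvn_class Q)) (mvn_class R))}"

definition K0_trace ::
  "('b::unital_cstar_algebra \<Rightarrow> complex) \<Rightarrow> ('b oper \<times> 'b oper) set \<Rightarrow> real" where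
  "K0_trace \<tau> \<xi> =
     (THE t. \<exists>P\<in>compact_projections. \<exists>Q\<in>compact_projections.
        \<xi> = K0_diff P Q \<and> t = Re (op_trace \<tau> P) - Re (op_trace \<tau> Q))"


section \<open>The generalized Fredholm index\<close>

definition partial_isometry :: "'b::unital_cstar_algebra oper \<Rightarrow> bool" where
  "partial_isometry W \<longleftrightarrow> W \<in> adjointable \<and> projection (adj W \<circ> W)"

definition op_abs :: "'b::unital_cstar_algebra oper \<Rightarrow> 'b oper" where
  "op_abs G = (THE A. op_positive A \<and> A \<circ> A = adj G \<circ> G)"

definition fredholm_polar_decomposition ::
  "'b::unital_cstar_algebra oper \<Rightarrow> 'b oper \<Rightarrow> bool" where
  "fredholm_polar_decomposition G W \<longleftrightarrow>
     G \<in> adjointable \<and> partial_isometry W \<and> gen_fredholm W \<and>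
     G = W \<circ> op_abs G \<and>
     adj W \<circ> W \<circ> op_abs G = op_abs G \<and>
     op_abs G \<circ> adj W \<circ> W = op_abs G"

text \<open>For generalized Fredholm \<open>T\<close> the class below exists and does not depend on \<open>G\<close> and \<open>W\<close>.\<close>

definition fredholm_index :: "'b::unital_cstar_algebra oper \<Rightarrow> ('b oper \<times> 'b oper) set" where
  "fredholm_index T =
     (SOME \<xi>. \<exists>G W. G - T \<in> compact_ops \<and> fredholm_polar_decomposition G W \<and>
        \<xi> = K0_diff (idop - (adj W \<circ> W)) (idop - (W \<circ> adj W)))"

end

theory Submission
  imports Defs
begin

text \<open>
  Put \<open>S = T\<^sup>* (1 + b + \<dots> + b\<^bsup>n-1\<^esup>)\<close> with \<open>b = 1 - T T\<^sup>*\<close>.  Then \<open>1 - S T = (1 - T\<^sup>*T)\<^sup>n\<close> and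
  \<open>1 - T S = (1 - T T\<^sup>*)\<^sup>n\<close>, so \<open>S\<close> inverts \<open>T\<close> up to trace class remainders.  The number
  \<open>Tr (1 - S T) - Tr (1 - T S)\<close> does not depend on the choice of such an \<open>S\<close>, and it does not change
  when \<open>T\<close> is perturbed by a compact operator, because a compact operator is the sum of a finite rank
  (hence trace class) operator and one of small norm, and both kinds of perturbation can be
  computed explicitly.  If \<open>G = W |G|\<close> is a compact perturbation of \<open>T\<close>, then \<open>|G|\<close> is \<open>1\<close> modulo compact
  operators, so \<open>W\<close> is a compact perturbation of \<open>T\<close> as well; evaluating the number at \<open>W\<close> with
  the inverse \<open>W\<^sup>*\<close> gives the trace of the index.

  The adjointable operators form a C*-algebra themselves, so the elementary theory of positive
  elements applies both to them and to the coefficient algebra.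
\<close>

section \<open>Positive elements of C*-algebras\<close>

text \<open>The two ideals in the hypotheses do different work. Compact \<open>n\<close>-th powers
  give the Fredholm property, since a self-adjoint operator with a compact power is itself compact;
  the trace class condition makes the remainders traceable. A compact perturbation need not be trace
  class, hence the approximation in the perturbation step; the remainders of \<open>W\<close> have a
  trace because they are compact projections.

  Three encodings dictate most of the preparation. Positivity is stated as
  \<open>adj S \<circ> S\<close>, so even sums of positive operators rest on the order positivity of
  \<open>star x * x\<close>, obtained here from an iterated square root instead of spectral theory.
  The trace of a positive operator is a supremum over dominated families, which is not visibly
  additive; it is identified with the diagonal sum in the standard basis. The index is an
  unspecified choice, so both the existence of a polar decomposition and the value for an arbitrary
  one are needed, and equality in \<open>K0\<close> carries a stabilising summand whose trace has to
  cancel.\<close>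

lemma scaleC_one [simp]: "scaleC 1 a = (a::'a::unital_cstar_algebra)"
  using scaleC_of_real[of 1 a] by simp

lemma scaleC_zero_left [simp]: "scaleC 0 a = (0::'a::unital_cstar_algebra)"
  using scaleC_of_real[of 0 a] by simp

lemma scaleC_zero_right [simp]: "scaleC c 0 = (0::'a::unital_cstar_algebra)"
  using scaleC_add_right[of c "0::'a" 0] by simp

lemma scaleC_minus_right: "scaleC c (- a) = - scaleC c (a::'a::unital_cstar_algebra)"
  by (metis add.inverse_unique add.right_inverse scaleC_add_right scaleC_zero_right)

lemma scaleC_minus_left: "scaleC (- c) a = - scaleC c (a::'a::unital_cstar_algebra)"
  by (metis add.inverse_unique add.right_inverse scaleC_add_left scaleC_zero_left)

lemma scaleC_diff_right: "scaleC c (a - b) = scaleC c a - scaleC c (b::'a::unital_cstar_algebra)"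
  using scaleC_add_right[of c a "- b"] by (simp add: scaleC_minus_right)

lemma star_zero [simp]: "star 0 = (0::'a::unital_cstar_algebra)"
  using star_add[of "0::'a" 0] by simp

lemma star_one [simp]: "star 1 = (1::'a::unital_cstar_algebra)"
  by (metis mult.right_neutral mult_1 star_mult star_star)

lemma star_minus: "star (- a) = - star (a::'a::unital_cstar_algebra)"
  by (metis add.inverse_unique add.right_inverse star_add star_zero)

lemma star_diff: "star (a - b) = star a - star (b::'a::unital_cstar_algebra)"
  using star_add[of a "- b"] by (simp add: star_minus)

lemma star_scaleR: "star (r *\<^sub>R a) = r *\<^sub>R star (a::'a::unital_cstar_algebra)"
  by (metis complex_cnj_complex_of_real scaleC_of_real star_scaleC)

lemma star_of_real [simp]: "star (of_real r) = (of_real r::'a::unital_cstar_algebra)"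
  by (simp add: of_real_def star_scaleR)

lemma star_sum: "star (\<Sum>i\<in>I. f i) = (\<Sum>i\<in>I. star (f i :: 'a::unital_cstar_algebra))"
  by (induction I rule: infinite_finite_induct) (auto simp: star_add)

lemma star_power: "star (a ^ n) = star (a::'a::unital_cstar_algebra) ^ n"
  by (induction n) (auto simp: star_mult power_commutes)

lemma norm_star [simp]: "norm (star a) = norm (a::'a::unital_cstar_algebra)"
proof -
  have le: "norm b \<le> norm (star b)" for b :: 'a
  proof (cases "b = 0")
    case False
    have "(norm b)\<^sup>2 \<le> norm (star b) * norm b"
      using cstar_identity[of b] norm_mult_ineq[of "star b" b] by simp
    then show ?thesis using False by (simp add: power2_eq_square)
  qed simp
  show ?thesis using le[of a] le[of "star a"] by (simp add: star_star)
qed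

lemma bounded_linear_star: "bounded_linear (star :: 'a::unital_cstar_algebra \<Rightarrow> 'a)"
  by (rule bounded_linear_intro[of _ 1]) (auto simp: star_add star_scaleR)

lemma norm_self_adjoint_square:
  "star a = a \<Longrightarrow> norm (a * a) = (norm (a::'a::unital_cstar_algebra))\<^sup>2"
  using cstar_identity[of a] by simp

lemma self_adjoint_square_eq_0:
  "star a = a \<Longrightarrow> a * a = 0 \<Longrightarrow> (a::'a::unital_cstar_algebra) = 0"
  using norm_self_adjoint_square[of a] by simp

lemma star_mult_self_eq_0: "star a * a = 0 \<Longrightarrow> (a::'a::unital_cstar_algebra) = 0"
  using cstar_identity[of a] by simp

text \<open>The iteration \<open>q \<mapsto> (y + q\<^sup>2) / 2\<close> converges to \<open>1 - sqrt (1 - y)\<close>.  Its increments are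
  dominated by those of the scalar iteration at \<open>y = 1\<close>, which is increasing and bounded.\<close>

lemma square_root_one_minus:
  fixes y :: "'a::unital_cstar_algebra"
  assumes y: "norm y \<le> 1"
  obtains q where "norm q \<le> 1" "(1 - q) * (1 - q) = 1 - y"
    "star y = y \<Longrightarrow> star q = q" "\<And>z. z * y = y * z \<Longrightarrow> z * q = q * z"
proof -
  define x :: "nat \<Rightarrow> real" where "x = rec_nat 0 (\<lambda>_ t. (1 + t\<^sup>2) / 2)"
  define b :: "nat \<Rightarrow> 'a" where "b = rec_nat 0 (\<lambda>_ t. (1/2) *\<^sub>R (y + t * t))"
  have x0: "x 0 = 0" and xS: "x (Suc n) = (1 + (x n)\<^sup>2) / 2" for n by (auto simp: x_def)
  have b0: "b 0 = 0" and bS: "b (Suc n) = (1/2) *\<^sub>R (y + b n * b n)" for n by (auto simp: b_def)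
  have x01: "0 \<le> x n \<and> x n \<le> 1" for n
    by (induction n) (auto simp: x0 xS power_le_one)
  have xinc: "x n \<le> x (Suc n)" for n
    using sum_power2_ge_zero[of "x n - 1" 0] by (simp add: xS power2_eq_square algebra_simps)
  have bx: "norm (b n) \<le> x n" for n
  proof (induction n)
    case (Suc n)
    have "norm (b n * b n) \<le> (x n)\<^sup>2"
      using norm_mult_ineq[of "b n" "b n"] mult_mono[OF Suc Suc] x01[of n]
      by (simp add: power2_eq_square)
    then have "norm (y + b n * b n) \<le> 1 + (x n)\<^sup>2"
      using norm_triangle_ineq[of y "b n * b n"] y by linarith
    then show ?case by (simp add: bS xS)
  qed (simp add: b0 x0)
  have bd: "norm (b (Suc n) - b n) \<le> x (Suc n) - x n" for n
  proof (induction n)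
    case 0
    show ?case using y by (simp add: b0 x0 bS xS)
  next
    case (Suc n)
    \<comment> \<open>The difference of two squares is split as
      \<open>c * (c - d) + (c - d) * d\<close>, which holds without commutativity; the scalar
      increments factor in the same way.\<close>
    have e: "b (Suc (Suc n)) - b (Suc n)
        = (1/2) *\<^sub>R (b (Suc n) * (b (Suc n) - b n) + (b (Suc n) - b n) * b n)"
    proof -
      have "b (Suc (Suc n)) - b (Suc n)
          = (1/2) *\<^sub>R (y + b (Suc n) * b (Suc n)) - (1/2) *\<^sub>R (y + b n * b n)"
        by (metis bS)
      also have "\<dots> = (1/2) *\<^sub>R (b (Suc n) * (b (Suc n) - b n) + (b (Suc n) - b n) * b n)"
        by (simp add: algebra_simps)
      finally show ?thesis .
    qed
    have "norm (b (Suc n) * (b (Suc n) - b n)) \<le> x (Suc n) * (x (Suc n) - x n)"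
      by (rule order_trans[OF norm_mult_ineq], rule mult_mono) (use bx Suc x01 in auto)
    moreover have "norm ((b (Suc n) - b n) * b n) \<le> (x (Suc n) - x n) * x n"
      by (rule order_trans[OF norm_mult_ineq], rule mult_mono)
        (use bx Suc x01 xinc[of n] in auto)
    ultimately have "norm (b (Suc (Suc n)) - b (Suc n))
        \<le> (1/2) * (x (Suc n) * (x (Suc n) - x n) + (x (Suc n) - x n) * x n)"
      unfolding e by (simp add: norm_triangle_le)
    also have "\<dots> = x (Suc (Suc n)) - x (Suc n)"
    proof -
      have "x (Suc (Suc n)) - x (Suc n) = (1 + (x (Suc n))\<^sup>2) / 2 - (1 + (x n)\<^sup>2) / 2"
        by (metis xS)
      then show ?thesis by (simp add: power2_eq_square field_simps)
    qed
    finally show ?case .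
  qed
  have "Bseq x" by (rule BseqI'[of _ 1]) (use x01 in auto)
  moreover have "incseq x" using xinc by (rule incseq_SucI)
  ultimately have "convergent x" using Bseq_mono_convergent[of x] by (auto simp: incseq_def)
  then have "summable (\<lambda>n. x (Suc n) - x n)"
    using telescope_summable by (auto simp: convergent_def)
  then have "summable (\<lambda>n. b (Suc n) - b n)"
    by (rule summable_comparison_test'[where N=0]) (use bd in auto)
  then have "convergent (\<lambda>n. \<Sum>i<n. b (Suc i) - b i)" by (simp add: summable_iff_convergent)
  then have "convergent b" by (simp add: sum_lessThan_telescope b0)
  then obtain q where q: "b \<longlonglongrightarrow> q" by (auto simp: convergent_def)
  have "(\<lambda>n. b (Suc n)) \<longlonglongrightarrow> (1/2) *\<^sub>R (y + q * q)"
    unfolding bS by (intro tendsto_intros q)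
  with q have qeq: "q = (1/2) *\<^sub>R (y + q * q)"
    by (metis LIMSEQ_Suc LIMSEQ_unique)
  show thesis
  proof (rule that[of q])
    have "norm (b n) \<le> 1" for n using bx[of n] x01[of n] by linarith
    then show "norm q \<le> 1"
      by (intro tendsto_upperbound[OF tendsto_norm[OF q]]) auto
    have "2 *\<^sub>R q = 2 *\<^sub>R ((1/2) *\<^sub>R (y + q * q))" using qeq by (rule arg_cong)
    then have "q + q = y + q * q" by (simp add: scaleR_2)
    then show "(1 - q) * (1 - q) = 1 - y"
      by (simp add: algebra_simps)
  next
    assume s: "star y = y"
    have "star (b n) = b n" for n
      by (induction n) (auto simp: b0 bS star_scaleR star_add star_mult s)
    then have "b \<longlonglongrightarrow> star q" using bounded_linear.tendsto[OF bounded_linear_star q] by simp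
    then show "star q = q" using q by (rule LIMSEQ_unique)
  next
    fix z assume z: "z * y = y * z"
    have "z * b n = b n * z" for n
    proof (induction n)
      case (Suc n)
      have "z * (b n * b n) = b n * b n * z" by (metis Suc mult.assoc)
      then show ?case using z by (simp add: bS distrib_left distrib_right)
    qed (simp add: b0)
    then have "(\<lambda>n. z * b n) \<longlonglongrightarrow> q * z" using tendsto_mult_right[OF q, of z] by simp
    then show "z * q = q * z" by (rule LIMSEQ_unique[OF tendsto_mult_left[OF q]])
  qed
qed

text \<open>For self-adjoint \<open>a\<close> the norm condition says that the spectrum lies in
  \<open>[0, 2 * t]\<close>, so this is the usual positive cone without mention of the spectrum. In
  this form closure under sums is the triangle inequality.\<close>

definition norm_positive :: "'a::unital_cstar_algebra \<Rightarrow> bool" where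
  "norm_positive a \<longleftrightarrow> star a = a \<and> (\<exists>t. norm (of_real t - a) \<le> t)"

text \<open>Scaling by \<open>1 / t\<close> writes \<open>a\<close> as \<open>1 - y\<close> with
  \<open>norm y \<le> 1\<close>, where the iteration applies. The bound
  \<open>norm q \<le> 1\<close> makes \<open>sqrt t\<close> a witness for the positivity of the
  root. The clause on commuting elements replaces functional calculus in what follows.\<close>

lemma norm_positive_sqrt:
  fixes a :: "'a::unital_cstar_algebra"
  assumes "norm_positive a"
  obtains b where "norm_positive b" "b * b = a" "\<And>z. z * a = a * z \<Longrightarrow> z * b = b * z"
proof -
  obtain t where sa: "star a = a" and t: "norm (of_real t - a) \<le> t"
    using assms by (auto simp: norm_positive_def)
  have t0: "t \<ge> 0" using t norm_ge_zero order_trans by blast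
  show thesis
  proof (cases "t = 0")
    case True
    with t have "a = 0" by simp
    then show thesis by (intro that[of 0]) (auto simp: norm_positive_def intro: exI[of _ 0])
  next
    case False
    with t0 have tp: "t > 0" by simp
    let ?y = "1 - (1/t) *\<^sub>R a"
    have "?y = (1/t) *\<^sub>R (of_real t - a)"
      using tp by (simp add: of_real_def scaleR_diff_right)
    then have "norm ?y \<le> 1" using t tp by simp
    then obtain q where q: "norm q \<le> 1" "(1 - q) * (1 - q) = 1 - ?y"
      "star ?y = ?y \<Longrightarrow> star q = q" "\<And>z. z * ?y = ?y * z \<Longrightarrow> z * q = q * z"
      by (rule square_root_one_minus) blast
    have sy: "star ?y = ?y" using sa by (simp add: star_diff star_scaleR)
    let ?b = "sqrt t *\<^sub>R (1 - q)"
    show thesis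
    proof (rule that[of ?b])
      have "of_real (sqrt t) - ?b = sqrt t *\<^sub>R q"
        by (simp add: of_real_def scaleR_diff_right)
      then have "norm (of_real (sqrt t) - ?b) \<le> sqrt t"
        using q(1) t0 by (simp add: mult_left_le)
      then show "norm_positive ?b"
        using q(3)[OF sy] by (auto simp: norm_positive_def star_scaleR star_diff)
      have "?b * ?b = t *\<^sub>R ((1 - q) * (1 - q))" using t0 by simp
      also have "\<dots> = a" using q(2) tp by simp
      finally show "?b * ?b = a" .
      fix z assume "z * a = a * z"
      then have "z * ?y = ?y * z" by (simp add: algebra_simps)
      from q(4)[OF this] show "z * ?b = ?b * z" by (simp add: algebra_simps)
    qed
  qed
qed

text \<open>The element \<open>h + scaleC \<i> s\<close> is unitary because \<open>h\<close> and
  \<open>s\<close> commute, and \<open>h\<close> is its real part, hence the mean of two elements of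
  norm one.\<close>

lemma norm_le_one_of_squares_sum:
  fixes h s :: "'a::unital_cstar_algebra"
  assumes h: "star h = h" and s: "star s = s" and c: "h * s = s * h" and e: "h * h + s * s = 1"
  shows "norm h \<le> 1"
proof -
  define u where "u = h + scaleC \<i> s"
  have su: "star u = h - scaleC \<i> s"
    by (simp add: u_def star_add star_scaleC h s scaleC_minus_left)
  have "star u * u = 1"
    unfolding su unfolding u_def
    by (simp add: algebra_simps scaleC_mult_left scaleC_mult_right scaleC_scaleC scaleC_minus_left scaleC_diff_right c e)
  then have "(norm u)\<^sup>2 = 1" using cstar_identity[of u] by simp
  then have "norm u = 1" by (simp add: power2_eq_1_iff) (use norm_ge_zero[of u] in linarith)
  moreover have "2 *\<^sub>R h = u + star u"
    unfolding su unfolding u_def by (simp add: scaleR_2)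
  then have "2 * norm h = norm (u + star u)" by (metis abs_numeral norm_scaleR)
  ultimately show ?thesis using norm_triangle_ineq[of u "star u"] by simp
qed

text \<open>With \<open>s\<close> the square root of \<open>1 - h * h\<close>, the squares of
  \<open>s\<close> and \<open>h\<close> sum to \<open>1\<close>; so \<open>norm s \<le> 1\<close>,
  and \<open>1 - h * h\<close> is the square of \<open>s\<close>.\<close>

lemma norm_one_minus_square_le:
  fixes h :: "'a::unital_cstar_algebra"
  assumes h: "star h = h" and n: "norm h \<le> 1"
  shows "norm (1 - h * h) \<le> 1"
proof -
  have "norm (h * h) \<le> 1"
    using norm_self_adjoint_square[OF h] n by (simp add: power_le_one)
  then obtain q where q: "(1 - q) * (1 - q) = 1 - h * h"
    "star (h * h) = h * h \<Longrightarrow> star q = q" "\<And>z. z * (h * h) = h * h * z \<Longrightarrow> z * q = q * z"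
    by (rule square_root_one_minus) blast
  let ?s = "1 - q"
  have s: "star ?s = ?s" using q(2) h by (simp add: star_mult star_diff)
  have c: "?s * h = h * ?s" using q(3)[of h] by (simp add: algebra_simps)
  have "norm ?s \<le> 1"
    by (rule norm_le_one_of_squares_sum[OF s h c]) (simp add: q(1))
  then show ?thesis
    using norm_self_adjoint_square[OF s] by (simp add: q(1) power_le_one)
qed

lemma norm_of_real_minus_square_le:
  fixes h :: "'a::unital_cstar_algebra"
  assumes h: "star h = h" and n: "(norm h)\<^sup>2 \<le> t"
  shows "norm (of_real t - h * h) \<le> t"
proof (cases "t = 0")
  case False
  have "t > 0" using n False zero_le_power2[of "norm h"] by linarith
  let ?k = "(1 / sqrt t) *\<^sub>R h"
  have "norm ?k \<le> 1" using n \<open>t > 0\<close> by (simp add: real_le_rsqrt)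
  then have "norm (1 - ?k * ?k) \<le> 1"
    by (intro norm_one_minus_square_le) (simp add: star_scaleR h)
  moreover have "of_real t - h * h = t *\<^sub>R (1 - ?k * ?k)"
    using \<open>t > 0\<close> by (simp add: of_real_def scaleR_diff_right)
  ultimately show ?thesis using \<open>t > 0\<close> by (simp add: mult_left_le)
qed (use n in auto)

lemma norm_positive_square:
  "star h = h \<Longrightarrow> norm_positive (h * h)" for h :: "'a::unital_cstar_algebra"
  using norm_of_real_minus_square_le[of h "(norm h)\<^sup>2"] by (auto simp: norm_positive_def star_mult intro: exI[of _ "(norm h)\<^sup>2"])

lemma norm_positive_add:
  fixes a b :: "'a::unital_cstar_algebra"
  assumes "norm_positive a" "norm_positive b"
  shows "norm_positive (a + b)"
proof -
  obtain t s where "norm (of_real t - a) \<le> t" "norm (of_real s - b) \<le> s"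
    using assms by (auto simp: norm_positive_def)
  then have "norm (of_real (t + s) - (a + b)) \<le> t + s"
    using norm_triangle_ineq[of "of_real t - a" "of_real s - b"] by (simp add: algebra_simps)
  then show ?thesis
    using assms unfolding norm_positive_def star_add by (intro conjI exI[of _ "t + s"]) auto
qed

lemma norm_positive_self_adjoint: "norm_positive a \<Longrightarrow> star a = a"
  by (simp add: norm_positive_def)

lemma norm_positive_scaleR:
  fixes a :: "'a::unital_cstar_algebra"
  assumes "norm_positive a" "r \<ge> 0"
  shows "norm_positive (r *\<^sub>R a)"
proof -
  obtain b where b: "norm_positive b" "b * b = a" using norm_positive_sqrt[OF assms(1)] by metis
  have "norm_positive ((sqrt r *\<^sub>R b) * (sqrt r *\<^sub>R b))"
    by (rule norm_positive_square) (simp add: star_scaleR norm_positive_self_adjoint b)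
  then show ?thesis using assms b by simp
qed

text \<open>The square roots of \<open>a\<close> and \<open>b\<close> commute, since each root
  commutes with whatever commutes with its square. Hence \<open>a * b\<close> is the square of the
  self-adjoint product of the roots.\<close>

lemma norm_positive_mult:
  fixes a b :: "'a::unital_cstar_algebra"
  assumes "norm_positive a" "norm_positive b" "a * b = b * a"
  shows "norm_positive (a * b)"
proof -
  obtain c where c: "norm_positive c" "c * c = a" "\<And>z. z * a = a * z \<Longrightarrow> z * c = c * z"
    using norm_positive_sqrt[OF assms(1)] by metis
  obtain d where d: "norm_positive d" "d * d = b" "\<And>z. z * b = b * z \<Longrightarrow> z * d = d * z"
    using norm_positive_sqrt[OF assms(2)] by metis
  have "b * c = c * b" using c(3)[of b] assms(3) by simp
  then have cd: "c * d = d * c" using d(3)[of c] by simp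
  have "star (c * d) = c * d"
    using cd c(1) d(1) by (simp add: star_mult norm_positive_self_adjoint)
  then have "norm_positive ((c * d) * (c * d))" by (rule norm_positive_square)
  moreover have "(c * d) * (c * d) = a * b"
    by (metis c(2) d(2) cd mult.assoc)
  ultimately show ?thesis by simp
qed

lemma norm_positive_of_real: "t \<ge> 0 \<Longrightarrow> norm_positive (of_real t)"
  unfolding norm_positive_def by (auto intro!: exI[of _ t])

lemma norm_positive_norm_minus:
  fixes a :: "'a::unital_cstar_algebra"
  assumes "star a = a"
  shows "norm_positive (of_real (norm a) - a)"
  unfolding norm_positive_def by (auto simp: star_diff assms intro!: exI[of _ "norm a"])

text \<open>If \<open>0 \<le> a \<le> M\<close>, then \<open>k = a - M/2\<close> satisfies \<open>k\<^sup>2 \<le> M\<^sup>2/4\<close>; completing \<open>k\<close> to a unitary bounds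
  its norm.\<close>

lemma norm_le_of_norm_positive:
  fixes a :: "'a::unital_cstar_algebra"
  assumes a: "norm_positive a" and M: "norm_positive (of_real M - a)" and "M > 0"
  shows "norm a \<le> M"
proof -
  have comm: "a * (of_real M - a) = (of_real M - a) * a"
    by (simp add: algebra_simps of_real_def)
  have p: "norm_positive ((4/M\<^sup>2) *\<^sub>R (a * (of_real M - a)))"
    by (intro norm_positive_scaleR norm_positive_mult a M comm) simp
  let ?k = "(2/M) *\<^sub>R a - 1"
  have sa: "star a = a" using a by (rule norm_positive_self_adjoint)
  have sk: "star ?k = ?k" by (simp add: star_diff star_scaleR sa)
  have ke: "(4/M\<^sup>2) *\<^sub>R (a * (of_real M - a)) = 1 - ?k * ?k"
    using \<open>M > 0\<close> by (simp add: algebra_simps of_real_def power2_eq_square flip: scaleR_add_left)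
  obtain s where s: "norm_positive s" "s * s = 1 - ?k * ?k"
      "\<And>z. z * (1 - ?k * ?k) = (1 - ?k * ?k) * z \<Longrightarrow> z * s = s * z"
    using norm_positive_sqrt[OF p] unfolding ke by metis
  have "?k * s = s * ?k" by (rule s(3)) (simp add: algebra_simps)
  then have k1: "norm ?k \<le> 1"
    by (rule norm_le_one_of_squares_sum[OF sk norm_positive_self_adjoint[OF s(1)]]) (simp add: s(2))
  have "a = (M/2) *\<^sub>R (1 + ?k)" using \<open>M > 0\<close> by simp
  then have "norm a = (M/2) * norm (1 + ?k)"
    using \<open>M > 0\<close> by (metis abs_of_nonneg half_gt_zero less_imp_le norm_scaleR)
  also have "\<dots> \<le> (M/2) * 2"
    using \<open>M > 0\<close> k1 norm_triangle_ineq[of 1 ?k] by (intro mult_left_mono) auto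
  finally show ?thesis by simp
qed

text \<open>The scalar \<open>norm b\<close> dominates \<open>b\<close> and therefore
  \<open>a\<close>, so \<open>norm_le_of_norm_positive\<close> applies. The slack \<open>e\<close>
  keeps that scalar strictly positive when \<open>b = 0\<close>.\<close>

lemma norm_positive_norm_mono:
  fixes a b :: "'a::unital_cstar_algebra"
  assumes a: "norm_positive a" and b: "norm_positive (b - a)"
  shows "norm a \<le> norm b"
proof -
  have sb: "star b = b"
    using norm_positive_self_adjoint[OF a] norm_positive_self_adjoint[OF b] by (simp add: star_diff)
  have "norm a \<le> norm b + e" if "e > 0" for e
  proof (rule norm_le_of_norm_positive[OF a])
    have "norm_positive ((of_real (norm b) - b) + ((b - a) + of_real e))"
      using that by (intro norm_positive_add norm_positive_norm_minus norm_positive_of_real b sb) auto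
    then show "norm_positive (of_real (norm b + e) - a)" by (simp add: algebra_simps)
    show "norm b + e > 0" using that by (simp add: add_nonneg_pos)
  qed
  then show ?thesis by (rule field_le_epsilon)
qed

lemma norm_positive_power:
  fixes a :: "'a::unital_cstar_algebra"
  assumes "norm_positive a"
  shows "norm_positive (a ^ n)"
proof (induction n)
  case 0
  show ?case using norm_positive_of_real[of 1] by simp
next
  case (Suc n)
  then show ?case using assms by (simp add: norm_positive_mult power_commutes)
qed

text \<open>Intertwining by \<open>y\<close> turns the bounded powers of \<open>1 - s y y\<^sup>*\<close> into powers of \<open>1 + s e\<^sup>2\<close>, which
  grow at least linearly unless \<open>e = 0\<close>.\<close>

lemma star_mult_self_negative_eq_0:
  fixes y e d :: "'a::unital_cstar_algebra"
  assumes e: "star e = e" and d: "star d = d"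
    and ye: "star y * y = - (e * e)" and yd: "y * star y = d * d"
  shows "y = 0"
proof -
  define f where "f = e * e"
  have f: "norm_positive f" unfolding f_def by (rule norm_positive_square[OF e])
  \<comment> \<open>Small enough that scaling \<open>d\<close> by \<open>sqrt s\<close> gives norm
    at most one; the summand \<open>1\<close> avoids dividing by zero.\<close>
  define s where "s = 1 / (1 + (norm d)\<^sup>2)"
  have s: "s > 0" unfolding s_def by (simp add: add_pos_nonneg)
  define w where "w = 1 + s *\<^sub>R f"
  define v where "v = 1 - s *\<^sub>R (d * d)"
  have w: "norm_positive w"
    unfolding w_def using s norm_positive_of_real[of 1] norm_positive_scaleR[OF f, of s]
    by (intro norm_positive_add) auto
  have "norm (1 - (sqrt s *\<^sub>R d) * (sqrt s *\<^sub>R d)) \<le> 1"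
  proof (rule norm_one_minus_square_le)
    have "(norm (sqrt s *\<^sub>R d))\<^sup>2 = s * (norm d)\<^sup>2" using s by (simp add: power_mult_distrib)
    also have "\<dots> \<le> 1"
      using add_pos_nonneg[of 1 "(norm d)\<^sup>2"] by (simp add: s_def divide_simps)
    finally show "norm (sqrt s *\<^sub>R d) \<le> 1" by (simp add: power_le_one_iff abs_square_le_1)
  qed (simp add: star_scaleR d)
  then have v1: "norm v \<le> 1" using s by (simp add: v_def)
  have vn: "norm (v ^ m) \<le> 1" for m
    using v1 norm_power_ineq[of v m] power_le_one[of "norm v" m] by (meson norm_ge_zero order_trans)
  have "d * d * y = - (y * f)" by (metis yd ye f_def mult.assoc mult_minus_right)
  then have vy: "v * y = y * w" by (simp add: v_def w_def algebra_simps)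
  have vym: "v ^ m * y = y * w ^ m" for m
  proof (induction m)
    case (Suc m)
    have "v ^ Suc m * y = v ^ m * (v * y)" by (simp add: power_Suc2 mult.assoc del: power_Suc)
    also have "\<dots> = (v ^ m * y) * w" by (simp add: vy mult.assoc)
    also have "\<dots> = y * w ^ Suc m" by (simp add: Suc power_commutes mult.assoc)
    finally show ?case .
  qed simp
  have fw: "f * w = w * f" by (simp add: w_def algebra_simps)
  have fwm: "f * w ^ m = w ^ m * f" for m
    using fw by (metis power_commuting_commutes)
  have bound: "norm (f * w ^ m) \<le> (norm y)\<^sup>2" for m
  proof -
    have "f * w ^ m = - (star y * (v ^ m * y))"
      unfolding vym by (metis add.inverse_inverse f_def minus_mult_left mult.assoc ye)
    then have "norm (f * w ^ m) = norm (star y * (v ^ m * y))" by simp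
    also have "\<dots> \<le> norm (star y) * (norm (v ^ m) * norm y)"
      by (rule order_trans[OF norm_mult_ineq mult_left_mono[OF norm_mult_ineq]]) simp
    also have "\<dots> \<le> norm y * (1 * norm y)" using vn[of m] by (simp add: mult_left_le_one_le mult_left_mono)
    finally show ?thesis by (simp add: power2_eq_square)
  qed
  have f2: "norm_positive (f * f)" by (rule norm_positive_mult[OF f f refl])
  have f3: "norm_positive (f * f * f)" by (rule norm_positive_mult[OF f2 f]) (rule mult.assoc)
  have ff: "norm_positive (f * f * f * w ^ m)" for m
    by (rule norm_positive_mult[OF f3 norm_positive_power[OF w]]) (metis fwm mult.assoc)
  have p1: "norm_positive (f * f * w ^ m - f * f)" for m
  proof (induction m)
    case (Suc m)
    have eq: "f * f * w ^ Suc m - f * f = (f * f * w ^ m - f * f) + s *\<^sub>R (f * f * f * w ^ m)"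
    proof -
      have "f * f * (w * w ^ m) = f * f * w ^ m + s *\<^sub>R (f * f * f * w ^ m)"
        by (simp add: w_def algebra_simps)
      then show ?thesis by simp
    qed
    show ?case unfolding eq using Suc ff s by (intro norm_positive_add norm_positive_scaleR) auto
  qed (use norm_positive_of_real[of 0] in auto)
  \<comment> \<open>Linear growth of the powers of \<open>w\<close>: by \<open>p1\<close> each
    further factor adds at least \<open>s *\<^sub>R (f * f)\<close> in the order, while
    \<open>bound\<close> caps the norm uniformly in \<open>m\<close>.\<close>
  have p2: "norm_positive (f * w ^ m - (real m * s) *\<^sub>R (f * f))" for m
  proof (induction m)
    case (Suc m)
    have "f * w ^ Suc m = f * w ^ m + s *\<^sub>R (f * f * w ^ m)"
      by (simp add: w_def algebra_simps)
    then have eq: "f * w ^ Suc m - (real (Suc m) * s) *\<^sub>R (f * f)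
        = (f * w ^ m - (real m * s) *\<^sub>R (f * f)) + s *\<^sub>R (f * f * w ^ m - f * f)"
      by (simp add: algebra_simps)
    show ?case unfolding eq using Suc p1 s by (intro norm_positive_add norm_positive_scaleR) auto
  qed (use f in auto)
  have "real m * (s * norm (f * f)) \<le> (norm y)\<^sup>2" for m
  proof -
    have "norm ((real m * s) *\<^sub>R (f * f)) \<le> norm (f * w ^ m)"
      by (rule norm_positive_norm_mono[OF _ p2]) (use f2 s in \<open>simp add: norm_positive_scaleR\<close>)
    then show ?thesis using bound[of m] s by (simp add: mult.assoc)
  qed
  then have "s * norm (f * f) \<le> 0" by (meson not_le reals_Archimedean3)
  then have "f * f = 0" using s by (simp add: mult_le_0_iff)
  then have "f = 0" by (rule self_adjoint_square_eq_0[OF norm_positive_self_adjoint[OF f]])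
  then have "star y * y = 0" using ye by (simp add: f_def)
  then show "y = 0" by (rule star_mult_self_eq_0)
qed

text \<open>Cartesian decomposition \<open>y = h + scaleC \<i> k\<close> with \<open>h\<close> and
  \<open>k\<close> self-adjoint: the mixed terms cancel in the symmetric sum, and twice the sum of
  the two squares remains.\<close>

lemma norm_positive_star_mult_add:
  fixes y :: "'a::unital_cstar_algebra"
  shows "norm_positive (star y * y + y * star y)"
proof -
  define h where "h = (1/2) *\<^sub>R (y + star y)"
  define k where "k = scaleC (- \<i> / 2) (y - star y)"
  have h: "star h = h" by (simp add: h_def star_scaleR star_add star_star add.commute)
  have k: "star k = k"
    by (simp add: k_def star_scaleC star_diff star_star)
      (metis minus_diff_eq minus_divide_left scaleC_minus_left scaleC_minus_right)
  have kk: "k * k = - ((1/4) *\<^sub>R ((y - star y) * (y - star y)))"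
    using scaleC_of_real[of "1/4" "(y - star y) * (y - star y)"]
    by (simp add: k_def scaleC_mult_left scaleC_mult_right scaleC_scaleC scaleC_minus_left scaleC_minus_right)
  have "star y * y + y * star y = 2 *\<^sub>R (h * h) + 2 *\<^sub>R (k * k)"
    unfolding kk h_def by (simp add: algebra_simps flip: scaleR_add_left)
  also have "norm_positive \<dots>"
    by (intro norm_positive_add norm_positive_scaleR norm_positive_square h k) auto
  finally show ?thesis .
qed

text \<open>Kaplansky's argument. With \<open>p\<close> the absolute value of \<open>a\<close>, the
  difference \<open>q = p - a\<close> is twice the negative part, and \<open>y = x * q\<close> has
  \<open>star y * y\<close> equal to the negative of a square. The symmetric sum makes
  \<open>y * star y\<close> positive, so \<open>star_mult_self_negative_eq_0\<close> gives
  \<open>y = 0\<close>, and then \<open>q = 0\<close>.\<close>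

lemma norm_positive_star_mult:
  fixes x :: "'a::unital_cstar_algebra"
  shows "norm_positive (star x * x)"
proof -
  define a where "a = star x * x"
  have a: "star a = a" by (simp add: a_def star_mult star_star)
  obtain p where p: "norm_positive p" "p * p = a * a"
      "\<And>z. z * (a * a) = (a * a) * z \<Longrightarrow> z * p = p * z"
    using norm_positive_sqrt[OF norm_positive_square[OF a]] by metis
  have pa: "a * p = p * a" using p(3)[of a] by (simp add: mult.assoc)
  have sp: "star p = p" by (rule norm_positive_self_adjoint[OF p(1)])
  obtain w where w: "norm_positive w" "w * w = p" "\<And>z. z * p = p * z \<Longrightarrow> z * w = w * z"
    using norm_positive_sqrt[OF p(1)] by metis
  define q where "q = p - a"
  have sq: "star q = q" by (simp add: q_def star_diff sp a)
  have qp: "q * p = p * q" by (simp add: q_def algebra_simps pa)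
  have qw: "q * w = w * q" using w(3)[OF qp] .
  have swq: "star (w * q) = w * q"
    by (simp add: star_mult sq norm_positive_self_adjoint[OF w(1)] qw)
  \<comment> \<open>Equivalent to \<open>q * (p + a) = 0\<close>, the orthogonality of the negative
    and the positive part.\<close>
  have qq: "q * q = 2 *\<^sub>R (p * q)"
    using p(2) by (simp add: q_def algebra_simps pa scaleR_2)
  have aq: "a = p - q" by (simp add: q_def)
  have wq: "(w * q) * (w * q) = p * (q * q)" by (metis qw w(2) mult.assoc)
  have qaq: "q * (a * q) = - ((w * q) * (w * q))"
  proof -
    have "q * (a * q) = q * (p * q) - q * (q * q)" unfolding aq by (simp add: algebra_simps)
    also have "q * (p * q) = p * (q * q)" by (metis qp mult.assoc)
    also have "q * (q * q) = 2 *\<^sub>R (q * (p * q))" by (simp add: qq)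
    also have "q * (p * q) = p * (q * q)" by (metis qp mult.assoc)
    finally show ?thesis by (simp add: wq scaleR_2)
  qed
  define y where "y = x * q"
  have ye: "star y * y = - ((w * q) * (w * q))"
    unfolding qaq[symmetric] by (simp add: y_def star_mult sq a_def mult.assoc)
  \<comment> \<open>Adding the square cancels \<open>star y * y\<close> and isolates
    \<open>y * star y\<close>.\<close>
  have "norm_positive ((star y * y + y * star y) + (w * q) * (w * q))"
    by (intro norm_positive_add norm_positive_star_mult_add norm_positive_square swq)
  then have "norm_positive (y * star y)" using ye by simp
  then obtain d where d: "norm_positive d" "d * d = y * star y" using norm_positive_sqrt by metis
  have "y = 0"
    by (rule star_mult_self_negative_eq_0[OF swq norm_positive_self_adjoint[OF d(1)] ye d(2)[symmetric]])
  then have "(w * q) * (w * q) = 0" using ye by simp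
  then have "w * q = 0" by (rule self_adjoint_square_eq_0[OF swq])
  then have "p * q = 0" by (metis w(2) mult.assoc mult_zero_right)
  then have "q * q = 0" using qq by simp
  then have "q = 0" by (rule self_adjoint_square_eq_0[OF sq])
  then have "a = p" by (simp add: q_def)
  then show ?thesis using p(1) by (simp add: a_def)
qed

section \<open>Order, square roots and limits for elements of the form
  \<open>star x * x\<close>\<close>

definition cpos :: "'a::unital_cstar_algebra \<Rightarrow> bool" where
  "cpos a \<longleftrightarrow> (\<exists>x. a = star x * x)"

text \<open>\<open>cpos\<close> has the shape of \<open>op_positive\<close>, while
  \<open>norm_positive\<close> is the form in which sums and limits are tractable; the equivalence
  lets each property be proved on the convenient side.\<close>

lemma cpos_iff_norm_positive: "cpos a \<longleftrightarrow> norm_positive a"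
  unfolding cpos_def using norm_positive_star_mult
  by (metis norm_positive_sqrt norm_positive_self_adjoint)

lemma cpos_star_mult [simp, intro]: "cpos (star x * x)"
  by (auto simp: cpos_def)

lemma cpos_mult_star [simp, intro]: "cpos (x * star x)"
  using cpos_star_mult[of "star x"] by (simp add: star_star)

lemma cpos_self_adjoint: "cpos a \<Longrightarrow> star a = a"
  by (simp add: cpos_iff_norm_positive norm_positive_self_adjoint)

lemma cpos_0 [simp, intro]: "cpos 0"
  using cpos_star_mult[of 0] by simp

lemma cpos_1 [simp, intro]: "cpos 1"
  using cpos_star_mult[of 1] by simp

lemma cpos_add: "cpos a \<Longrightarrow> cpos b \<Longrightarrow> cpos (a + b)"
  by (simp add: cpos_iff_norm_positive norm_positive_add)

lemma cpos_sum: "(\<And>i. i \<in> I \<Longrightarrow> cpos (f i)) \<Longrightarrow> cpos (\<Sum>i\<in>I. f i)"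
  by (induction I rule: infinite_finite_induct) (auto intro: cpos_add)

lemma cpos_scaleR: "cpos a \<Longrightarrow> r \<ge> 0 \<Longrightarrow> cpos (r *\<^sub>R a)"
  by (simp add: cpos_iff_norm_positive norm_positive_scaleR)

lemma cpos_conjugate: "cpos a \<Longrightarrow> cpos (star x * a * x)"
  unfolding cpos_def by (metis mult.assoc star_mult)

lemma cpos_norm_mono: "cpos a \<Longrightarrow> cpos (b - a) \<Longrightarrow> norm a \<le> norm b"
  by (simp add: cpos_iff_norm_positive norm_positive_norm_mono)

lemma cpos_norm_minus: "star a = a \<Longrightarrow> cpos (of_real (norm a) - a)"
  by (simp add: cpos_iff_norm_positive norm_positive_norm_minus)

lemma cpos_add_eq_0:
  assumes "cpos a" "cpos b" "a + b = 0"
  shows "a = 0"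
  using cpos_norm_mono[of a 0] assms by (simp add: add_eq_0_iff2)

lemma cpos_sqrt:
  assumes "cpos a"
  obtains b where "cpos b" "b * b = a" "\<And>z. z * a = a * z \<Longrightarrow> z * b = b * z"
  using norm_positive_sqrt[of a] assms unfolding cpos_iff_norm_positive by metis

text \<open>Both roots are compared with the root \<open>d\<close> from \<open>cpos_sqrt\<close>,
  which commutes with everything that commutes with the square. For \<open>z = x - d\<close> the
  positive elements \<open>z * x * z\<close> and \<open>z * d * z\<close> sum to \<open>0\<close>,
  so both vanish, and their difference is \<open>z * z * z\<close>.\<close>

lemma cpos_sqrt_unique:
  assumes b: "cpos b" and c: "cpos c" and bc: "b * b = c * c"
  shows "b = c"
proof -
  have "cpos (b * b)" using b by (metis cpos_star_mult cpos_self_adjoint)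
  then obtain d where d: "cpos d" "d * d = b * b" "\<And>z. z * (b * b) = (b * b) * z \<Longrightarrow> z * d = d * z"
    by (rule cpos_sqrt) blast
  have *: "x = d" if x: "cpos x" and xx: "x * x = b * b" for x
  proof -
    have xd: "x * d = d * x" using d(3)[of x] by (metis xx mult.assoc)
    define z where "z = x - d"
    have sz: "star z = z" using x d(1) by (simp add: z_def star_diff cpos_self_adjoint)
    have z0: "z * (x + d) = 0" using xx d(2) by (simp add: z_def algebra_simps xd)
    have "z * x * z + z * d * z = z * (x + d) * z" by (simp add: algebra_simps)
    then have s: "z * x * z + z * d * z = 0" using z0 by simp
    have px: "cpos (z * x * z)" and pd: "cpos (z * d * z)"
      using cpos_conjugate[OF x, of z] cpos_conjugate[OF d(1), of z] sz by auto
    have zx: "z * x * z = 0" and zd: "z * d * z = 0"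
      using cpos_add_eq_0[OF px pd s] s by auto
    have "z * z * z = z * x * z - z * d * z" by (simp add: z_def algebra_simps)
    then have "z * z * z = 0" using zx zd by simp
    then have "(z * z) * (z * z) = 0" by (metis mult.assoc mult_zero_right)
    then have "z * z = 0" by (intro self_adjoint_square_eq_0[of "z * z"]) (simp add: star_mult sz)
    then have "z = 0" by (rule self_adjoint_square_eq_0[OF sz])
    then show "x = d" by (simp add: z_def)
  qed
  show ?thesis using *[OF b] *[OF c] bc by simp
qed

text \<open>A convergent sequence is bounded, so one \<open>t\<close> serves in the norm condition
  for all terms and survives in the limit.\<close>

lemma cpos_LIMSEQ:
  fixes X :: "nat \<Rightarrow> 'a::unital_cstar_algebra"
  assumes X: "\<And>n. cpos (X n)" and l: "X \<longlonglongrightarrow> a"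
  shows "cpos a"
proof -
  have "X \<longlonglongrightarrow> star a"
    using bounded_linear.tendsto[OF bounded_linear_star l] by (simp add: cpos_self_adjoint[OF X])
  then have sa: "star a = a" using l by (rule LIMSEQ_unique)
  obtain t where t: "\<And>n. norm (X n) \<le> t" "t > 0"
    using convergent_imp_Bseq[of X] l by (auto simp: convergent_def Bseq_def)
  have "norm (of_real t - X n) \<le> t" for n
  proof -
    obtain b where b: "cpos b" "b * b = X n" using cpos_sqrt[OF X] by metis
    then have sb: "star b = b" by (simp add: cpos_self_adjoint)
    have "(norm b)\<^sup>2 \<le> t" using norm_self_adjoint_square[OF sb] t(1)[of n] b by simp
    then show ?thesis using norm_of_real_minus_square_le[OF sb, of t] b by simp
  qed
  moreover have "(\<lambda>n. norm (of_real t - X n)) \<longlonglongrightarrow> norm (of_real t - a)"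
    by (intro tendsto_intros l)
  ultimately have "norm (of_real t - a) \<le> t"
    by (intro tendsto_upperbound[where F=sequentially]) auto
  then show ?thesis using sa by (auto simp: cpos_iff_norm_positive norm_positive_def)
qed

section \<open>Geometric sums and Neumann series\<close>

lemma one_minus_mult_geometric_sum:
  "(1 - y) * (\<Sum>i<n. y ^ i) = 1 - (y::'a::ring_1) ^ n"
proof (induction n)
  case (Suc n)
  show ?case unfolding sum.lessThan_Suc distrib_left Suc by (simp add: left_diff_distrib)
qed simp

lemma one_minus_invertible:
  fixes y :: "'a::unital_cstar_algebra"
  assumes "norm y < 1"
  obtains z where "z * (1 - y) = 1" "(1 - y) * z = 1" "\<And>x. x * y = y * x \<Longrightarrow> x * z = z * x"
proof -
  have s: "summable (\<lambda>n. y ^ n)" by (rule complete_algebra_summable_geometric) (rule assms)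
  define z where "z = (\<Sum>n. y ^ n)"
  have l: "(\<lambda>n. \<Sum>i<n. y ^ i) \<longlonglongrightarrow> z" using summable_LIMSEQ[OF s] by (simp add: z_def)
  have y0: "(\<lambda>n. 1 - y ^ n) \<longlonglongrightarrow> 1 - 0"
    by (intro tendsto_intros LIMSEQ_power_zero assms)
  note e = one_minus_mult_geometric_sum[of y]
  have e': "(\<Sum>i<n. y ^ i) * (1 - y) = 1 - y ^ n" for n
  proof (induction n)
    case (Suc n)
    show ?case
      unfolding sum.lessThan_Suc distrib_right Suc by (simp add: right_diff_distrib power_commutes)
  qed simp
  show thesis
  proof (rule that[of z])
    show "(1 - y) * z = 1"
      using LIMSEQ_unique[OF y0 tendsto_mult_left[OF l, of "1 - y", unfolded e]] by simp
    show "z * (1 - y) = 1"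
      using LIMSEQ_unique[OF y0 tendsto_mult_right[OF l, of "1 - y", unfolded e']] by simp
    fix x assume "x * y = y * x"
    then have "x * y ^ i = y ^ i * x" for i by (metis power_commuting_commutes)
    then have "x * (\<Sum>i<n. y ^ i) = (\<Sum>i<n. y ^ i) * x" for n
      by (simp add: sum_distrib_left sum_distrib_right)
    then have "(\<lambda>n. x * (\<Sum>i<n. y ^ i)) \<longlonglongrightarrow> z * x"
      using tendsto_mult_right[OF l, of x] by simp
    then show "x * z = z * x" by (rule LIMSEQ_unique[OF tendsto_mult_left[OF l]])
  qed
qed

section \<open>The standard Hilbert module as a Banach space\<close>

text \<open>Sections of the inner product over an index set. Cauchy-Schwarz has to be available for
  finite sections first, because the convergence of the series in \<open>ip x y\<close> rests on
  it.\<close>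

definition fip :: "nat set \<Rightarrow> (nat \<Rightarrow> 'b::unital_cstar_algebra) \<Rightarrow> (nat \<Rightarrow> 'b) \<Rightarrow> 'b" where
  "fip F x y = (\<Sum>k\<in>F. star (x k) * y k)"

definition fnorm :: "nat set \<Rightarrow> (nat \<Rightarrow> 'b::unital_cstar_algebra) \<Rightarrow> real" where
  "fnorm F x = sqrt (norm (fip F x x))"

lemma cpos_fip [simp]: "cpos (fip F x x)"
  unfolding fip_def by (intro cpos_sum) auto

lemma star_fip: "star (fip F x y) = fip F y x"
  by (simp add: fip_def star_sum star_mult star_star)

text \<open>Positivity of the square of \<open>z = x a - m y\<close>, with \<open>a\<close> the
  inner product of \<open>x\<close> and \<open>y\<close>. As \<open>m\<close> exceeds
  \<open>norm ?X\<close>, the element \<open>?X\<close> may be replaced by \<open>m\<close>, which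
  puts \<open>star a * a\<close> below \<open>m *\<^sub>R ?Y\<close>; then \<open>m\<close> tends to
  \<open>norm ?X\<close>.\<close>

lemma norm_fip_le:
  fixes x y :: "nat \<Rightarrow> 'b::unital_cstar_algebra"
  shows "norm (fip F x y) \<le> fnorm F x * fnorm F y"
proof -
  let ?X = "fip F x x" and ?Y = "fip F y y"
  define a where "a = fip F x y"
  have "(norm a)\<^sup>2 \<le> m * norm ?Y" if m: "m > norm ?X" for m
  proof -
    have m0: "m > 0" using m norm_ge_zero[of ?X] by linarith
    define z where "z = (\<lambda>k. x k * a - m *\<^sub>R y k)"
    have "fip F z z = star a * ?X * a - m *\<^sub>R (star a * fip F x y) - m *\<^sub>R (fip F y x * a) + m\<^sup>2 *\<^sub>R ?Y"
      unfolding fip_def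
      by (simp add: z_def star_diff star_scaleR star_mult algebra_simps sum.distrib sum_subtractf
          sum_distrib_left sum_distrib_right scaleR_sum_right power2_eq_square)
    also have "fip F y x = star a" by (simp add: a_def star_fip)
    also have "fip F x y = a" by (simp add: a_def)
    finally have zz: "fip F z z = star a * ?X * a - m *\<^sub>R (star a * a) - m *\<^sub>R (star a * a) + m\<^sup>2 *\<^sub>R ?Y" .
    have "cpos (of_real m - ?X)"
    proof -
      have "cpos ((of_real (norm ?X) - ?X) + (m - norm ?X) *\<^sub>R 1)"
        by (intro cpos_add cpos_norm_minus cpos_scaleR) (use m in \<open>auto simp: star_fip\<close>)
      then show ?thesis by (simp add: of_real_def scaleR_diff_left)
    qed
    from cpos_conjugate[OF this, of a]
    have "cpos (m *\<^sub>R (star a * a) - star a * ?X * a)"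
      by (simp add: algebra_simps of_real_def)
    then have "cpos (fip F z z + (m *\<^sub>R (star a * a) - star a * ?X * a))"
      by (intro cpos_add) auto
    then have "cpos ((1/m) *\<^sub>R (m\<^sup>2 *\<^sub>R ?Y - m *\<^sub>R (star a * a)))"
      unfolding zz using m0 by (intro cpos_scaleR) auto
    then have "cpos (m *\<^sub>R ?Y - star a * a)"
      using m0 by (simp add: scaleR_diff_right power2_eq_square)
    then have "norm (star a * a) \<le> norm (m *\<^sub>R ?Y)"
      by (intro cpos_norm_mono) auto
    then show ?thesis using m0 by (simp add: cstar_identity)
  qed
  then have "(norm a)\<^sup>2 \<le> norm ?X * norm ?Y + e" if "e > 0" for e
  proof -
    \<comment> \<open>The excess over \<open>norm ?X\<close>, multiplied by \<open>norm ?Y\<close>,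
      contributes at most \<open>e\<close>; the summand \<open>1\<close> covers
      \<open>?Y = 0\<close>.\<close>
    let ?m = "norm ?X + e / (norm ?Y + 1)"
    have "(norm a)\<^sup>2 \<le> ?m * norm ?Y"
      using \<open>\<And>m. norm ?X < m \<Longrightarrow> (norm a)\<^sup>2 \<le> m * norm ?Y\<close> that by (simp add: add_nonneg_pos)
    also have "\<dots> = norm ?X * norm ?Y + e * (norm ?Y / (norm ?Y + 1))" by (simp add: algebra_simps)
    also have "\<dots> \<le> norm ?X * norm ?Y + e * 1"
      using that by (intro add_left_mono mult_left_mono) (auto simp: divide_le_eq_1 add_nonneg_pos)
    finally show ?thesis by simp
  qed
  then have "(norm a)\<^sup>2 \<le> norm ?X * norm ?Y" by (rule field_le_epsilon)
  then show ?thesis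
    by (simp add: a_def fnorm_def real_le_rsqrt flip: real_sqrt_mult)
qed

lemma fnorm_triangle: "fnorm F (x + y) \<le> fnorm F x + fnorm F y"
proof -
  have "fip F (x + y) (x + y) = fip F x x + fip F x y + (fip F y x + fip F y y)"
    by (simp add: fip_def star_add algebra_simps sum.distrib)
  then have "norm (fip F (x + y) (x + y))
      \<le> norm (fip F x x) + norm (fip F x y) + (norm (fip F y x) + norm (fip F y y))"
    by (metis (no_types, lifting) add_mono norm_triangle_le norm_triangle_ineq)
  also have "\<dots> \<le> (fnorm F x)\<^sup>2 + fnorm F x * fnorm F y + (fnorm F y * fnorm F x + (fnorm F y)\<^sup>2)"
    using norm_fip_le[of F x y] norm_fip_le[of F y x] by (intro add_mono) (auto simp: fnorm_def)
  also have "\<dots> = (fnorm F x + fnorm F y)\<^sup>2" by (simp add: power2_eq_square algebra_simps)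
  finally have "sqrt (norm (fip F (x + y) (x + y))) \<le> sqrt ((fnorm F x + fnorm F y)\<^sup>2)"
    by (rule real_sqrt_le_mono)
  then show ?thesis by (simp add: fnorm_def)
qed

lemma summable_cpos_comparison:
  fixes f g :: "nat \<Rightarrow> 'b::unital_cstar_algebra"
  assumes "summable g" "\<And>k. cpos (f k)" "\<And>k. cpos (g k - f k)"
  shows "summable f"
  unfolding summable_Cauchy
proof (intro allI impI)
  fix e :: real assume "e > 0"
  then obtain N where N: "\<And>m n. m \<ge> N \<Longrightarrow> norm (sum g {m..<n}) < e"
    using assms(1) unfolding summable_Cauchy by blast
  have "norm (sum f {m..<n}) \<le> norm (sum g {m..<n})" for m n
    by (rule cpos_norm_mono) (auto intro!: cpos_sum assms simp flip: sum_subtractf)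
  then show "\<exists>N. \<forall>m\<ge>N. \<forall>n. norm (sum f {m..<n}) < e"
    using N by (meson le_less_trans)
qed

lemma hilb_summable_ip:
  fixes x y :: "nat \<Rightarrow> 'b::unital_cstar_algebra"
  assumes "x \<in> hilb" "y \<in> hilb"
  shows "summable (\<lambda>k. star (x k) * y k)"
  unfolding summable_Cauchy
proof (intro allI impI)
  fix e :: real assume "e > 0"
  have tail: "\<exists>M. \<forall>m\<ge>M. \<forall>n. norm (fip {m..<n} z z) < e" if "z \<in> hilb" for z :: "nat \<Rightarrow> 'b"
    using that \<open>e > 0\<close> by (simp add: hilb_def summable_Cauchy fip_def)
  obtain M where M: "\<And>m n. m \<ge> M \<Longrightarrow> norm (fip {m..<n} x x) < e"
    using tail[OF assms(1)] by blast
  obtain N where N: "\<And>m n. m \<ge> N \<Longrightarrow> norm (fip {m..<n} y y) < e"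
    using tail[OF assms(2)] by blast
  show "\<exists>N. \<forall>m\<ge>N. \<forall>n. norm (\<Sum>k=m..<n. star (x k) * y k) < e"
  proof (intro exI allI impI)
    fix m n assume m: "m \<ge> max M N"
    have "norm (fip {m..<n} x y) \<le> sqrt (norm (fip {m..<n} x x) * norm (fip {m..<n} y y))"
      using norm_fip_le by (simp add: fnorm_def real_sqrt_mult)
    also have "\<dots> < sqrt (e * e)"
      using m M[of m n] N[of m n] by (intro real_sqrt_less_mono mult_strict_mono') auto
    finally show "norm (\<Sum>k=m..<n. star (x k) * y k) < e" using \<open>e > 0\<close> by (simp add: fip_def)
  qed
qed

lemma hilb_sums_ip:
  "x \<in> hilb \<Longrightarrow> y \<in> hilb \<Longrightarrow> (\<lambda>k. star (x k) * y k) sums ip x y"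
  by (simp add: ip_def hilb_summable_ip summable_sums)

lemma hilb_fip_LIMSEQ:
  "x \<in> hilb \<Longrightarrow> y \<in> hilb \<Longrightarrow> (\<lambda>n. fip {..<n} x y) \<longlonglongrightarrow> ip x y"
  using hilb_sums_ip[of x y] by (simp add: sums_def fip_def)

lemma hilb_zero [simp]: "0 \<in> hilb"
  by (simp add: hilb_def)

lemma hilb_add: "x \<in> hilb \<Longrightarrow> y \<in> hilb \<Longrightarrow> x + y \<in> hilb"
  using hilb_summable_ip[of x y] hilb_summable_ip[of y x]
    hilb_summable_ip[of x x] hilb_summable_ip[of y y]
  by (simp add: hilb_def star_add distrib_left distrib_right summable_add)

lemma hilb_mult_right:
  assumes "x \<in> hilb"
  shows "(\<lambda>k. x k * b) \<in> hilb"
proof -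
  have "summable (\<lambda>k. star b * (star (x k) * x k * b))"
    using assms by (intro summable_mult summable_mult2) (simp add: hilb_def)
  then show ?thesis by (simp add: hilb_def star_mult mult.assoc)
qed

lemma hilb_scaleR: "x \<in> hilb \<Longrightarrow> (\<lambda>k. r *\<^sub>R x k) \<in> hilb"
  using hilb_mult_right[of x "of_real r"] by (simp add: of_real_def)

lemma hilb_uminus: "x \<in> hilb \<Longrightarrow> - x \<in> hilb"
  using hilb_scaleR[of x "-1"] by (simp add: fun_Compl_def)

lemma hilb_diff: "x \<in> hilb \<Longrightarrow> y \<in> hilb \<Longrightarrow> x - y \<in> hilb"
  using hilb_add[OF _ hilb_uminus, of x y] by simp

lemma hilb_finite_support:
  assumes "finite F" "\<And>k. k \<notin> F \<Longrightarrow> x k = 0"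
  shows "x \<in> hilb"
  unfolding hilb_def using assms by (auto intro!: summable_finite[of F])

lemma cpos_ip_minus_fip:
  assumes "x \<in> hilb" "finite F"
  shows "cpos (ip x x - fip F x x)"
proof -
  obtain M where M: "F \<subseteq> {..<M}" using assms(2) finite_nat_iff_bounded by auto
  have "cpos (fip {..<n + M} x x - fip F x x)" for n
  proof -
    have "fip {..<n + M} x x - fip F x x = fip ({..<n + M} - F) x x"
      unfolding fip_def using M by (intro sum_diff[symmetric]) auto
    then show ?thesis by simp
  qed
  moreover have "(\<lambda>n. fip {..<n + M} x x - fip F x x) \<longlonglongrightarrow> ip x x - fip F x x"
    by (intro tendsto_diff tendsto_const LIMSEQ_ignore_initial_segment hilb_fip_LIMSEQ assms)
  ultimately show ?thesis by (rule cpos_LIMSEQ)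
qed

lemma cpos_ip: "x \<in> hilb \<Longrightarrow> cpos (ip x x)"
  using cpos_ip_minus_fip[of x "{}"] by (simp add: fip_def)

lemma fnorm_le_hnorm: "x \<in> hilb \<Longrightarrow> finite F \<Longrightarrow> fnorm F x \<le> hnorm x"
  using cpos_norm_mono[of "fip F x x" "ip x x"] cpos_ip_minus_fip[of x F]
  by (simp add: fnorm_def hnorm_def)

lemma fnorm_LIMSEQ: "x \<in> hilb \<Longrightarrow> (\<lambda>n. fnorm {..<n} x) \<longlonglongrightarrow> hnorm x"
  unfolding fnorm_def hnorm_def by (intro tendsto_intros hilb_fip_LIMSEQ)

lemma hnorm_triangle:
  assumes "x \<in> hilb" "y \<in> hilb"
  shows "hnorm (x + y) \<le> hnorm x + hnorm y"
  by (rule LIMSEQ_le[OF fnorm_LIMSEQ tendsto_add[OF fnorm_LIMSEQ fnorm_LIMSEQ]])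
    (use assms fnorm_triangle in \<open>auto intro: hilb_add\<close>)

lemma norm_ip_le:
  assumes "x \<in> hilb" "y \<in> hilb"
  shows "norm (ip x y) \<le> hnorm x * hnorm y"
  by (rule LIMSEQ_le[OF tendsto_norm[OF hilb_fip_LIMSEQ] tendsto_mult[OF fnorm_LIMSEQ fnorm_LIMSEQ]])
    (use assms norm_fip_le in auto)

lemma norm_component_le:
  assumes "x \<in> hilb"
  shows "norm (x k) \<le> hnorm x"
proof -
  have "fnorm {k} x = norm (x k)" by (simp add: fnorm_def fip_def cstar_identity)
  then show ?thesis using fnorm_le_hnorm[OF assms, of "{k}"] by simp
qed

text \<open>As a type of its own the module can carry the Banach space classes, so that Baire's
  theorem and the facts on bounded linear maps apply.\<close>

typedef (overloaded) 'b hm = "hilb :: (nat \<Rightarrow> 'b::unital_cstar_algebra) set"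
  morphisms coord hm_of
  by (rule exI[of _ 0]) simp

setup_lifting type_definition_hm

lemma hm_of_coord [simp]: "hm_of (coord x) = x"
  by (rule coord_inverse)

lemma coord_hm_of [simp]: "x \<in> hilb \<Longrightarrow> coord (hm_of x) = x"
  by (rule hm_of_inverse)

lemma coord_hilb [simp, intro]: "coord x \<in> hilb"
  by (rule coord)

instantiation hm :: (unital_cstar_algebra) real_normed_vector
begin

lift_definition zero_hm :: "'a hm" is 0 by simp
lift_definition plus_hm :: "'a hm \<Rightarrow> 'a hm \<Rightarrow> 'a hm" is "(+)" by (rule hilb_add)
lift_definition minus_hm :: "'a hm \<Rightarrow> 'a hm \<Rightarrow> 'a hm" is "(-)" by (rule hilb_diff)
lift_definition uminus_hm :: "'a hm \<Rightarrow> 'a hm" is uminus by (rule hilb_uminus)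
lift_definition scaleR_hm :: "real \<Rightarrow> 'a hm \<Rightarrow> 'a hm" is "\<lambda>r x k. r *\<^sub>R x k" by (rule hilb_scaleR)
lift_definition norm_hm :: "'a hm \<Rightarrow> real" is hnorm .

definition dist_hm :: "'a hm \<Rightarrow> 'a hm \<Rightarrow> real" where "dist_hm x y = norm (x - y)"
definition sgn_hm :: "'a hm \<Rightarrow> 'a hm" where "sgn_hm x = scaleR (inverse (norm x)) x"
definition uniformity_hm :: "('a hm \<times> 'a hm) filter" where
  "uniformity_hm = (INF e\<in>{0<..}. principal {(x, y). dist x y < e})"
definition open_hm :: "'a hm set \<Rightarrow> bool" where
  "open_hm U \<longleftrightarrow> (\<forall>x\<in>U. eventually (\<lambda>(x', y). x' = x \<longrightarrow> y \<in> U) uniformity)"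

instance
proof
  fix x y z :: "'a hm" and a b :: real
  show "x + y + z = x + (y + z)" by transfer (simp add: add.assoc)
  show "x + y = y + x" by transfer (simp add: add.commute)
  show "0 + x = x" by transfer simp
  show "- x + x = 0" by transfer simp
  show "x - y = x + - y" by transfer simp
  show "a *\<^sub>R (x + y) = a *\<^sub>R x + a *\<^sub>R y" by transfer (simp add: fun_eq_iff scaleR_add_right)
  show "(a + b) *\<^sub>R x = a *\<^sub>R x + b *\<^sub>R x" by transfer (simp add: fun_eq_iff scaleR_add_left)
  show "a *\<^sub>R b *\<^sub>R x = (a * b) *\<^sub>R x" by transfer simp
  show "1 *\<^sub>R x = x" by transfer simp
  show "dist x y = norm (x - y)" by (rule dist_hm_def)
  show "sgn x = inverse (norm x) *\<^sub>R x" by (rule sgn_hm_def)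
  show "uniformity = (INF e\<in>{0<..}. principal {(x::'a hm, y). dist x y < e})" by (rule uniformity_hm_def)
  show "open U \<longleftrightarrow> (\<forall>x\<in>U. \<forall>\<^sub>F (x', y) in uniformity. x' = x \<longrightarrow> y \<in> U)" for U :: "'a hm set"
    by (rule open_hm_def)
  show "norm x = 0 \<longleftrightarrow> x = 0"
  proof transfer
    fix x :: "nat \<Rightarrow> 'a" assume x: "x \<in> hilb"
    show "hnorm x = 0 \<longleftrightarrow> x = 0"
    proof
      assume h: "hnorm x = 0"
      have "x k = 0" for k using norm_component_le[OF x, of k] h by simp
      then show "x = 0" by (simp add: fun_eq_iff)
    qed (simp add: hnorm_def ip_def)
  qed
  show "norm (x + y) \<le> norm x + norm y" by transfer (rule hnorm_triangle)
  show "norm (a *\<^sub>R x) = \<bar>a\<bar> * norm x"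
  proof transfer
    fix a :: real and x :: "nat \<Rightarrow> 'a" assume x: "x \<in> hilb"
    have "ip (\<lambda>k. a *\<^sub>R x k) (\<lambda>k. a *\<^sub>R x k) = a\<^sup>2 *\<^sub>R ip x x"
      unfolding ip_def using hilb_summable_ip[OF x x]
      by (simp add: star_scaleR power2_eq_square flip: suminf_scaleR_right)
    then show "hnorm (\<lambda>k. a *\<^sub>R x k) = \<bar>a\<bar> * hnorm x"
      by (simp add: hnorm_def real_sqrt_mult)
  qed
qed

end

instance hm :: (unital_cstar_algebra) banach
proof
  fix X :: "nat \<Rightarrow> 'a hm" assume X: "Cauchy X"
  have "convergent (\<lambda>n. coord (X n) k)" for k
  proof -
    have le: "norm (coord x k - coord y k) \<le> norm (x - y)" for x y :: "'a hm"
      using norm_component_le[OF coord_hilb, of "x - y" k] by (simp add: norm_hm.rep_eq minus_hm.rep_eq)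
    have "Cauchy (\<lambda>n. coord (X n) k)"
    proof (rule CauchyI)
      fix e :: real assume "e > 0"
      then obtain M where "\<forall>m\<ge>M. \<forall>n\<ge>M. norm (X m - X n) < e" using CauchyD[OF X] by blast
      then show "\<exists>M. \<forall>m\<ge>M. \<forall>n\<ge>M. norm (coord (X m) k - coord (X n) k) < e"
        using le by (meson le_less_trans)
    qed
    then show ?thesis by (simp add: Cauchy_convergent_iff)
  qed
  then obtain z where z: "\<And>k. (\<lambda>n. coord (X n) k) \<longlonglongrightarrow> z k"
    unfolding convergent_def by metis
  \<comment> \<open>Uniformity over all finite sections makes this one estimate serve twice: for
    \<open>z \<in> hilb\<close> and for convergence in norm.\<close>
  have near: "\<exists>N. \<forall>n\<ge>N. \<forall>F. finite F \<longrightarrow> fnorm F (coord (X n) - z) \<le> e" if e: "e > 0" for e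
  proof -
    obtain N where N: "\<And>m n. m \<ge> N \<Longrightarrow> n \<ge> N \<Longrightarrow> norm (X m - X n) < e"
      using CauchyD[OF X e] by blast
    have "fnorm F (coord (X n) - z) \<le> e" if n: "n \<ge> N" and F: "finite F" for n F
    proof (rule tendsto_upperbound)
      show "(\<lambda>m. fnorm F (coord (X n) - coord (X m))) \<longlonglongrightarrow> fnorm F (coord (X n) - z)"
        unfolding fnorm_def fip_def minus_apply
        by (intro tendsto_intros z bounded_linear.tendsto[OF bounded_linear_star])
      have "fnorm F (coord (X n) - coord (X m)) \<le> e" if "m \<ge> N" for m
        using N[OF n that] fnorm_le_hnorm[OF coord_hilb F, of "X n - X m"]
        by (simp add: norm_hm.rep_eq minus_hm.rep_eq)
      then show "\<forall>\<^sub>F m in sequentially. fnorm F (coord (X n) - coord (X m)) \<le> e"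
        by (auto simp: eventually_sequentially)
    qed simp
    then show ?thesis by blast
  qed
  have zh: "z \<in> hilb"
    unfolding hilb_def mem_Collect_eq summable_Cauchy
  proof (intro allI impI)
    fix e :: real assume e: "e > 0"
    \<comment> \<open>\<open>fnorm\<close> is a square root: two pieces of size
      \<open>sqrt e / 2\<close> bound the section of \<open>z\<close> by \<open>sqrt e\<close>,
      hence its square by \<open>e\<close>.\<close>
    let ?d = "sqrt e / 2"
    have d: "?d > 0" using e by simp
    obtain N where N: "\<And>F. finite F \<Longrightarrow> fnorm F (coord (X N) - z) \<le> ?d" using near[OF d] by blast
    have "summable (\<lambda>k. star (coord (X N) k) * coord (X N) k)" by (simp add: hilb_summable_ip)
    moreover have "?d\<^sup>2 > 0" using d by simp
    ultimately obtain M where M: "\<And>m n. m \<ge> M \<Longrightarrow> norm (fip {m..<n} (coord (X N)) (coord (X N))) < ?d\<^sup>2"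
      unfolding summable_Cauchy fip_def by blast
    show "\<exists>M. \<forall>m\<ge>M. \<forall>n. norm (\<Sum>k=m..<n. star (z k) * z k) < e"
    proof (intro exI allI impI)
      fix m n assume m: "m \<ge> M"
      have sym: "fnorm F (- x) = fnorm F x" for F and x :: "nat \<Rightarrow> 'a"
        by (simp add: fnorm_def fip_def star_minus)
      have "fnorm {m..<n} z \<le> fnorm {m..<n} (coord (X N)) + fnorm {m..<n} (- (coord (X N) - z))"
        using fnorm_triangle[of "{m..<n}" "coord (X N)" "- (coord (X N) - z)"] by simp
      also have "\<dots> < ?d + ?d"
      proof (rule add_less_le_mono)
        show "fnorm {m..<n} (coord (X N)) < ?d"
          using real_sqrt_less_mono[OF M[OF m, of n]] d by (simp add: fnorm_def)
        show "fnorm {m..<n} (- (coord (X N) - z)) \<le> ?d" unfolding sym by (rule N) simp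
      qed
      finally have "fnorm {m..<n} z < sqrt e" by simp
      then show "norm (\<Sum>k=m..<n. star (z k) * z k) < e" by (simp add: fnorm_def fip_def)
    qed
  qed
  have "X \<longlonglongrightarrow> hm_of z"
  proof (rule LIMSEQ_I)
    fix r :: real assume "r > 0"
    then have "r / 2 > 0" by simp
    from near[OF this] obtain N where
      N: "\<And>n F. n \<ge> N \<Longrightarrow> finite F \<Longrightarrow> fnorm F (coord (X n) - z) \<le> r / 2" by blast
    have "norm (X n - hm_of z) < r" if n: "n \<ge> N" for n
    proof -
      have "hnorm (coord (X n) - z) \<le> r / 2"
        by (rule tendsto_upperbound[OF fnorm_LIMSEQ])
          (use N[OF n] in \<open>auto simp del: le_divide_eq_numeral1 intro: hilb_diff zh\<close>)
      then show ?thesis using \<open>r > 0\<close> by (simp add: norm_hm.rep_eq minus_hm.rep_eq zh)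
    qed
    then show "\<exists>N. \<forall>n\<ge>N. norm (X n - hm_of z) < r" by blast
  qed
  then show "convergent X" by (auto simp: convergent_def)
qed

section \<open>Inner product, right action and standard basis of the module\<close>

lift_definition hip :: "'b::unital_cstar_algebra hm \<Rightarrow> 'b hm \<Rightarrow> 'b" is ip .

lift_definition hmul :: "'b::unital_cstar_algebra hm \<Rightarrow> 'b \<Rightarrow> 'b hm" is "\<lambda>x b k. x k * b"
  by (rule hilb_mult_right)

lift_definition hbasis :: "nat \<Rightarrow> 'b::unital_cstar_algebra hm" is "\<lambda>j k. if k = j then 1 else 0"
  by (rule hilb_finite_support[of "{j}" for j]) auto

lemma hip_sums: "(\<lambda>k. star (coord x k) * coord y k) sums hip x y"
  by transfer (rule hilb_sums_ip)

lemma star_hip: "star (hip x y) = hip y x"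
  by (rule sums_unique2[OF _ hip_sums])
    (use bounded_linear.sums[OF bounded_linear_star hip_sums[of x y]] in
      \<open>simp add: star_mult star_star\<close>)

lemma hip_add_right: "hip x (y + z) = hip x y + hip x z"
  by (rule sums_unique2[OF hip_sums]) (use sums_add[OF hip_sums hip_sums] in \<open>simp add: plus_hm.rep_eq distrib_left\<close>)

lemma hip_mul_right: "hip x (hmul y b) = hip x y * b"
  by (rule sums_unique2[OF hip_sums])
    (use sums_mult2[OF hip_sums, of x y b] in \<open>simp add: hmul.rep_eq mult.assoc\<close>)

lemma hip_scaleR_right: "hip x (r *\<^sub>R y) = r *\<^sub>R hip x y"
  by (rule sums_unique2[OF hip_sums])
    (use sums_scaleR_right[OF hip_sums, of r x y] in \<open>simp add: scaleR_hm.rep_eq\<close>)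

lemma hip_add_left: "hip (x + y) z = hip x z + hip y z"
  by (metis hip_add_right star_add star_hip)

lemma hip_mul_left: "hip (hmul x b) y = star b * hip x y"
  by (metis hip_mul_right star_mult star_hip)

lemma hip_scaleR_left: "hip (r *\<^sub>R x) y = r *\<^sub>R hip x y"
  by (metis hip_scaleR_right star_scaleR star_hip)

lemma hip_zero_right [simp]: "hip x 0 = 0"
  using hip_add_right[of x 0 0] by simp

lemma hip_zero_left [simp]: "hip 0 x = 0"
  using hip_add_left[of 0 0 x] by simp

lemma hip_minus_right: "hip x (- y) = - hip x y"
  using hip_scaleR_right[of x "-1" y] by simp

lemma hip_minus_left: "hip (- x) y = - hip x y"
  using hip_scaleR_left[of "-1" x y] by simp

lemma hip_diff_right: "hip x (y - z) = hip x y - hip x z"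
  using hip_add_right[of x y "- z"] by (simp add: hip_minus_right)

lemma hip_diff_left: "hip (x - y) z = hip x z - hip y z"
  using hip_add_left[of x "- y" z] by (simp add: hip_minus_left)

lemma hip_sum_right: "hip x (\<Sum>i\<in>I. f i) = (\<Sum>i\<in>I. hip x (f i))"
  by (induction I rule: infinite_finite_induct) (auto simp: hip_add_right)

lemma cpos_hip [simp, intro]: "cpos (hip x x)"
  by transfer (rule cpos_ip)

lemma norm_hm_eq: "norm x = sqrt (norm (hip x x))"
  by transfer (simp add: hnorm_def)

lemma norm_hip_self: "norm (hip x x) = (norm x)\<^sup>2"
  by (simp add: norm_hm_eq)

lemma norm_hip_le: "norm (hip x y) \<le> norm x * norm y"
  by transfer (rule norm_ip_le)

lemma bounded_bilinear_hip: "bounded_bilinear hip"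
  by (rule bounded_bilinear.intro)
    (auto simp: hip_add_left hip_add_right hip_scaleR_left hip_scaleR_right
      intro!: exI[of _ 1] norm_hip_le)

lemma hip_self_eq_0: "hip x x = 0 \<Longrightarrow> x = 0"
  using norm_hip_self[of x] by simp

lemma hip_right_eqI:
  assumes "\<And>z. hip z x = hip z y"
  shows "x = y"
  using hip_self_eq_0[of "x - y"] assms by (simp add: hip_diff_right)

lemma hip_left_eqI:
  assumes "\<And>z. hip x z = hip y z"
  shows "x = y"
  using hip_self_eq_0[of "x - y"] assms by (simp add: hip_diff_left)

lemma norm_hmul_le: "norm (hmul x b) \<le> norm x * norm b"
proof (rule power2_le_imp_le)
  have "(norm (hmul x b))\<^sup>2 = norm (star b * (hip x x * b))"
    by (simp add: hip_mul_right hip_mul_left mult.assoc flip: norm_hip_self)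
  also have "\<dots> \<le> norm (star b) * (norm (hip x x) * norm b)"
    by (rule order_trans[OF norm_mult_ineq mult_left_mono[OF norm_mult_ineq]]) simp
  finally show "(norm (hmul x b))\<^sup>2 \<le> (norm x * norm b)\<^sup>2"
    by (simp add: norm_hip_self power2_eq_square mult_ac)
qed simp

lemma coord_hmul: "coord (hmul x b) k = coord x k * b"
  by (simp add: hmul.rep_eq)

lemma hip_hbasis_left: "hip (hbasis j) x = coord x j"
proof -
  have "(\<lambda>k. star (coord (hbasis j) k) * coord x k) = (\<lambda>k. if k = j then coord x k else 0)"
    by (auto simp: hbasis.rep_eq fun_eq_iff)
  then have "(\<lambda>k. star (coord (hbasis j) k) * coord x k) sums coord x j"
    using sums_single[of j "coord x"] by simp
  then show ?thesis by (rule sums_unique2[OF hip_sums])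
qed

lemma hip_hbasis_right: "hip x (hbasis j) = star (coord x j)"
  using hip_hbasis_left[of j x] by (metis star_hip)

lemma hip_hbasis: "hip (hbasis i) (hbasis j) = (if i = j then 1 else 0)"
  by (simp add: hip_hbasis_left hbasis.rep_eq)

lemma norm_hbasis [simp]: "norm (hbasis j) = 1"
  by (simp add: norm_hm_eq hip_hbasis)

section \<open>The C*-algebra of adjointable operators\<close>

definition adjoint_pair ::
  "('b::unital_cstar_algebra hm \<Rightarrow> 'b hm) \<Rightarrow> ('b hm \<Rightarrow> 'b hm) \<Rightarrow> bool" where
  "adjoint_pair T S \<longleftrightarrow> (\<forall>x y. hip x (T y) = hip (S x) y)"

lemma adjoint_pairD: "adjoint_pair T S \<Longrightarrow> hip x (T y) = hip (S x) y"
  by (simp add: adjoint_pair_def)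

lemma adjoint_pair_sym: "adjoint_pair T S \<Longrightarrow> adjoint_pair S T"
  unfolding adjoint_pair_def by (metis star_hip)

lemma adjoint_pair_add:
  assumes "adjoint_pair T S"
  shows "T (x + y) = T x + T y"
  by (rule hip_right_eqI) (simp add: adjoint_pairD[OF assms] hip_add_right)

lemma adjoint_pair_scaleR:
  assumes "adjoint_pair T S"
  shows "T (r *\<^sub>R x) = r *\<^sub>R T x"
  by (rule hip_right_eqI) (simp add: adjoint_pairD[OF assms] hip_scaleR_right)

text \<open>Uniform boundedness by Baire's theorem: the sets \<open>V n\<close> are closed, since
  the adjoint expresses \<open>T\<close> through the continuous maps \<open>hip (S x)\<close>, and
  they cover the space, so one of them contains a ball.\<close>

lemma adjoint_pair_bounded:
  assumes TS: "adjoint_pair T S"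
  shows "bounded_linear T"
proof -
  define V where "V n = {y. norm (T y) \<le> real n}" for n :: nat
  have V_eq: "V n = (\<Inter>x\<in>{x. norm x \<le> 1}. {y. norm (hip (S x) y) \<le> real n})" for n
  proof (intro set_eqI iffI)
    fix y assume "y \<in> V n"
    then have "norm (hip x (T y)) \<le> real n" if "norm x \<le> 1" for x
      using norm_hip_le[of x "T y"] mult_mono[OF that, of "norm (T y)" "real n"]
      by (simp add: V_def)
    then show "y \<in> (\<Inter>x\<in>{x. norm x \<le> 1}. {y. norm (hip (S x) y) \<le> real n})"
      by (simp add: adjoint_pairD[OF TS])
  next
    fix y assume y: "y \<in> (\<Inter>x\<in>{x. norm x \<le> 1}. {y. norm (hip (S x) y) \<le> real n})"
    show "y \<in> V n"
    proof (cases "T y = 0")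
      case False
      \<comment> \<open>Testing against the normalised vector \<open>T y\<close> recovers
        \<open>norm (T y)\<close>.\<close>
      let ?x = "(1 / norm (T y)) *\<^sub>R T y"
      have "norm ?x \<le> 1" using False by simp
      then have "norm (hip ?x (T y)) \<le> real n"
        using y unfolding adjoint_pairD[OF TS] by blast
      then show ?thesis
        using False by (simp add: V_def hip_scaleR_left norm_hip_self power2_eq_square)
    qed (simp add: V_def)
  qed
  have cl: "closed (V n)" for n
    unfolding V_eq
  proof (intro closed_INT ballI closed_Collect_le continuous_on_norm continuous_on_const)
    fix x show "continuous_on UNIV (\<lambda>y. hip (S x) y)"
      by (rule linear_continuous_on[OF bounded_bilinear.bounded_linear_right[OF bounded_bilinear_hip]])
  qed
  have "\<Union>(range V) = UNIV"
    by (auto simp: V_def intro: real_arch_simple)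
  then have "euclidean interior_of \<Union>(range V) \<noteq> {}" by simp
  then have "\<exists>n. interior (V n) \<noteq> {}"
    using Met_TC.metric_Baire_category_alt[of "range V"] cl
    by (auto simp: complete_UNIV)
  then obtain n y r where r: "r > 0" "ball y r \<subseteq> V n"
    by (metis ex_in_conv mem_interior)
  have half: "norm (T z) \<le> 2 * real n" if "norm z < r" for z
  proof -
    have "norm (T (y + z)) \<le> real n" "norm (T y) \<le> real n"
      using r that by (auto simp: V_def subset_eq dist_norm)
    moreover have "T z = T (y + z) - T y" by (simp add: adjoint_pair_add[OF TS])
    ultimately show ?thesis using norm_triangle_ineq4[of "T (y + z)" "T y"] by simp
  qed
  show ?thesis
  proof (rule bounded_linear_intro[of _ "4 * real n / r"])
    fix x :: "'a hm" and c :: real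
    show "T (c *\<^sub>R x) = c *\<^sub>R T x" by (rule adjoint_pair_scaleR[OF TS])
    show "norm (T x) \<le> norm x * (4 * real n / r)"
    proof (cases "x = 0")
      case True
      then show ?thesis using adjoint_pair_scaleR[OF TS, of 0 x] by simp
    next
      case False
      \<comment> \<open>Rescaling to norm \<open>r / 2\<close> stays inside the open ball; this
        factor turns \<open>2 * real n\<close> into \<open>4 * real n / r\<close>.\<close>
      let ?c = "r / (2 * norm x)"
      have "norm (?c *\<^sub>R x) < r" using False r(1) by simp
      from half[OF this] have "\<bar>?c\<bar> * norm (T x) \<le> 2 * real n"
        by (simp add: adjoint_pair_scaleR[OF TS])
      then show ?thesis using False r(1) by (simp add: field_simps)
    qed
  qed (rule adjoint_pair_add[OF TS])
qed

typedef (overloaded) 'b aop = "{T :: 'b::unital_cstar_algebra hm \<Rightarrow> 'b hm. \<exists>S. adjoint_pair T S}"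
  morphisms app aop_of
  by (rule exI[of _ id]) (auto simp: adjoint_pair_def)

setup_lifting type_definition_aop

lemma app_bounded_linear: "bounded_linear (app A)"
  using app[of A] by (auto intro: adjoint_pair_bounded)

lemma aop_eqI: "(\<And>x. app A x = app B x) \<Longrightarrow> A = B"
  by (metis app_inverse ext)

lemma app_aop_of: "adjoint_pair T S \<Longrightarrow> app (aop_of T) = T"
  by (rule aop_of_inverse) auto

lemma app_add_right: "app A (x + y) = app A x + app A y"
  by (rule linear_add[OF bounded_linear.linear[OF app_bounded_linear]])

lemma app_scaleR_right: "app A (r *\<^sub>R x) = r *\<^sub>R app A x"
  by (rule linear_scale[OF bounded_linear.linear[OF app_bounded_linear]])

lemma app_zero_right [simp]: "app A 0 = 0"
  by (rule linear_0[OF bounded_linear.linear[OF app_bounded_linear]])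

instantiation aop :: (unital_cstar_algebra) real_normed_algebra_1
begin

lift_definition zero_aop :: "'a aop" is "\<lambda>_. 0"
  by (auto simp: adjoint_pair_def intro!: exI[of _ "\<lambda>_. 0"])

lift_definition one_aop :: "'a aop" is "\<lambda>x. x"
  by (auto simp: adjoint_pair_def intro!: exI[of _ id])

lift_definition plus_aop :: "'a aop \<Rightarrow> 'a aop \<Rightarrow> 'a aop" is "\<lambda>A B x. A x + B x"
proof -
  fix A B :: "'a hm \<Rightarrow> 'a hm"
  assume "\<exists>S. adjoint_pair A S" "\<exists>S. adjoint_pair B S"
  then obtain C D where "adjoint_pair A C" "adjoint_pair B D" by blast
  then have "adjoint_pair (\<lambda>x. A x + B x) (\<lambda>x. C x + D x)"
    by (simp add: adjoint_pair_def hip_add_left hip_add_right)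
  then show "\<exists>S. adjoint_pair (\<lambda>x. A x + B x) S" by blast
qed

lift_definition minus_aop :: "'a aop \<Rightarrow> 'a aop \<Rightarrow> 'a aop" is "\<lambda>A B x. A x - B x"
proof -
  fix A B :: "'a hm \<Rightarrow> 'a hm"
  assume "\<exists>S. adjoint_pair A S" "\<exists>S. adjoint_pair B S"
  then obtain C D where "adjoint_pair A C" "adjoint_pair B D" by blast
  then have "adjoint_pair (\<lambda>x. A x - B x) (\<lambda>x. C x - D x)"
    by (simp add: adjoint_pair_def hip_diff_left hip_diff_right)
  then show "\<exists>S. adjoint_pair (\<lambda>x. A x - B x) S" by blast
qed

lift_definition uminus_aop :: "'a aop \<Rightarrow> 'a aop" is "\<lambda>A x. - A x"
proof -
  fix A :: "'a hm \<Rightarrow> 'a hm"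
  assume "\<exists>S. adjoint_pair A S"
  then obtain C where "adjoint_pair A C" by blast
  then have "adjoint_pair (\<lambda>x. - A x) (\<lambda>x. - C x)"
    by (simp add: adjoint_pair_def hip_minus_left hip_minus_right)
  then show "\<exists>S. adjoint_pair (\<lambda>x. - A x) S" by blast
qed

lift_definition scaleR_aop :: "real \<Rightarrow> 'a aop \<Rightarrow> 'a aop" is "\<lambda>r A x. r *\<^sub>R A x"
proof -
  fix r and A :: "'a hm \<Rightarrow> 'a hm"
  assume "\<exists>S. adjoint_pair A S"
  then obtain C where "adjoint_pair A C" by blast
  then have "adjoint_pair (\<lambda>x. r *\<^sub>R A x) (\<lambda>x. r *\<^sub>R C x)"
    by (simp add: adjoint_pair_def hip_scaleR_left hip_scaleR_right)
  then show "\<exists>S. adjoint_pair (\<lambda>x. r *\<^sub>R A x) S" by blast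
qed

lift_definition times_aop :: "'a aop \<Rightarrow> 'a aop \<Rightarrow> 'a aop" is "\<lambda>A B x. A (B x)"
proof -
  fix A B :: "'a hm \<Rightarrow> 'a hm"
  assume "\<exists>S. adjoint_pair A S" "\<exists>S. adjoint_pair B S"
  then obtain C D where "adjoint_pair A C" "adjoint_pair B D" by blast
  then have "adjoint_pair (\<lambda>x. A (B x)) (\<lambda>x. D (C x))"
    by (simp add: adjoint_pair_def)
  then show "\<exists>S. adjoint_pair (\<lambda>x. A (B x)) S" by blast
qed

definition norm_aop :: "'a aop \<Rightarrow> real" where "norm_aop A = onorm (app A)"
definition dist_aop :: "'a aop \<Rightarrow> 'a aop \<Rightarrow> real" where "dist_aop x y = norm (x - y)"
definition sgn_aop :: "'a aop \<Rightarrow> 'a aop" where "sgn_aop x = scaleR (inverse (norm x)) x"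
definition uniformity_aop :: "('a aop \<times> 'a aop) filter" where
  "uniformity_aop = (INF e\<in>{0<..}. principal {(x, y). dist x y < e})"
definition open_aop :: "'a aop set \<Rightarrow> bool" where
  "open_aop U \<longleftrightarrow> (\<forall>x\<in>U. eventually (\<lambda>(x', y). x' = x \<longrightarrow> y \<in> U) uniformity)"

lemmas app_simps = zero_aop.rep_eq one_aop.rep_eq plus_aop.rep_eq minus_aop.rep_eq
  uminus_aop.rep_eq scaleR_aop.rep_eq times_aop.rep_eq

instance
proof
  fix x y z :: "'a aop" and a b :: real
  show "x + y + z = x + (y + z)" by (rule aop_eqI) (simp add: app_simps add.assoc)
  show "x + y = y + x" by (rule aop_eqI) (simp add: app_simps add.commute)
  show "0 + x = x" by (rule aop_eqI) (simp add: app_simps)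
  show "- x + x = 0" by (rule aop_eqI) (simp add: app_simps)
  show "x - y = x + - y" by (rule aop_eqI) (simp add: app_simps)
  show "a *\<^sub>R (x + y) = a *\<^sub>R x + a *\<^sub>R y"
    by (rule aop_eqI) (simp add: app_simps scaleR_add_right)
  show "(a + b) *\<^sub>R x = a *\<^sub>R x + b *\<^sub>R x"
    by (rule aop_eqI) (simp add: app_simps scaleR_add_left)
  show "a *\<^sub>R b *\<^sub>R x = (a * b) *\<^sub>R x" by (rule aop_eqI) (simp add: app_simps)
  show "1 *\<^sub>R x = x" by (rule aop_eqI) (simp add: app_simps)
  show "x * y * z = x * (y * z)" by (rule aop_eqI) (simp add: app_simps)
  show "(x + y) * z = x * z + y * z" by (rule aop_eqI) (simp add: app_simps)
  show "x * (y + z) = x * y + x * z" by (rule aop_eqI) (simp add: app_simps app_add_right)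
  show "a *\<^sub>R x * y = a *\<^sub>R (x * y)" by (rule aop_eqI) (simp add: app_simps)
  show "x * a *\<^sub>R y = a *\<^sub>R (x * y)" by (rule aop_eqI) (simp add: app_simps app_scaleR_right)
  show "1 * x = x" by (rule aop_eqI) (simp add: app_simps)
  show "x * 1 = x" by (rule aop_eqI) (simp add: app_simps)
  show "(0::'a aop) \<noteq> 1"
  proof
    assume "(0::'a aop) = 1"
    then have "app 0 (hbasis 0 :: 'a hm) = app 1 (hbasis 0)" by simp
    then have "norm (hbasis 0 :: 'a hm) = 0" by (simp add: app_simps)
    then show False by simp
  qed
  show "dist x y = norm (x - y)" by (rule dist_aop_def)
  show "sgn x = inverse (norm x) *\<^sub>R x" by (rule sgn_aop_def)
  show "uniformity = (INF e\<in>{0<..}. principal {(x::'a aop, y). dist x y < e})" by (rule uniformity_aop_def)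
  show "open U \<longleftrightarrow> (\<forall>x\<in>U. \<forall>\<^sub>F (x', y) in uniformity. x' = x \<longrightarrow> y \<in> U)" for U :: "'a aop set"
    by (rule open_aop_def)
  show "norm x = 0 \<longleftrightarrow> x = 0"
    unfolding norm_aop_def onorm_eq_0[OF app_bounded_linear]
    by (metis aop_eqI zero_aop.rep_eq)
  show "norm (x + y) \<le> norm x + norm y"
    unfolding norm_aop_def plus_aop.rep_eq
    by (rule onorm_triangle) (rule app_bounded_linear)+
  show "norm (a *\<^sub>R x) = \<bar>a\<bar> * norm x"
    unfolding norm_aop_def scaleR_aop.rep_eq by (rule onorm_scaleR) (rule app_bounded_linear)
  show "norm (x * y) \<le> norm x * norm y"
    unfolding norm_aop_def times_aop.rep_eq
    using onorm_compose[OF app_bounded_linear app_bounded_linear, of x y] by (simp add: o_def)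
  show "norm (1::'a aop) = 1"
  proof (rule antisym)
    show "norm (1::'a aop) \<le> 1"
      unfolding norm_aop_def by (rule onorm_bound) (auto simp: app_simps)
    show "1 \<le> norm (1::'a aop)"
      unfolding norm_aop_def
      using onorm[OF app_bounded_linear, of "1::'a aop" "hbasis 0"] by (simp add: app_simps)
  qed
qed

end

lemma norm_app_le: "norm (app A x) \<le> norm A * norm x"
  unfolding norm_aop_def by (rule onorm[OF app_bounded_linear])

lemma norm_aop_le: "0 \<le> c \<Longrightarrow> (\<And>x. norm (app A x) \<le> c * norm x) \<Longrightarrow> norm A \<le> c"
  unfolding norm_aop_def by (rule onorm_bound)

definition adjoint_of :: "('b::unital_cstar_algebra hm \<Rightarrow> 'b hm) \<Rightarrow> ('b hm \<Rightarrow> 'b hm)" where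
  "adjoint_of T = (SOME S. adjoint_pair T S)"

lemma adjoint_pair_adjoint_of: "adjoint_pair T S \<Longrightarrow> adjoint_pair T (adjoint_of T)"
  unfolding adjoint_of_def by (rule someI[of "adjoint_pair T"])

lemma hmul_one [simp]: "hmul x 1 = x"
  by transfer simp

lemma hmul_hmul: "hmul (hmul x a) b = hmul x (a * b)"
  by transfer (simp add: mult.assoc)

lemma hmul_add_left: "hmul (x + y) a = hmul x a + hmul y a"
  by transfer (simp add: fun_eq_iff distrib_right)

lemma hmul_add_right: "hmul x (a + b) = hmul x a + hmul x b"
  by transfer (simp add: fun_eq_iff distrib_left)

lemma hmul_of_real: "hmul x (r *\<^sub>R 1) = r *\<^sub>R x"
  by transfer simp

lemma adjoint_pair_hmul:
  assumes "adjoint_pair T S"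
  shows "T (hmul x a) = hmul (T x) a"
  by (rule hip_right_eqI) (simp add: adjoint_pairD[OF assms] hip_mul_right)

lemma app_hmul: "app A (hmul x a) = hmul (app A x) a"
  using app[of A] by (auto intro: adjoint_pair_hmul)

lemma scaleC_one_commute: "scaleC c 1 * a = a * scaleC c (1::'a::unital_cstar_algebra)"
  by (simp add: scaleC_mult_left scaleC_mult_right)

text \<open>\<open>hm\<close> carries real scalars only; complex scalars act on it as right
  multiplication by the central element \<open>scaleC c 1\<close>.\<close>

lemma adjoint_pair_hmul_scaleC:
  assumes "adjoint_pair A C"
  shows "adjoint_pair (\<lambda>x. hmul (A x) (scaleC c 1)) (\<lambda>x. hmul (C x) (scaleC (cnj c) 1))"
  using assms by (simp add: adjoint_pair_def hip_mul_left hip_mul_right star_scaleC scaleC_one_commute)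

text \<open>Completeness needs a limit that is again adjointable, so the adjoints are followed along
  with the operators: both sequences converge pointwise, and the adjoint relation passes to the
  limits.\<close>

instance aop :: (unital_cstar_algebra) banach
proof
  fix X :: "nat \<Rightarrow> 'a aop" assume X: "Cauchy X"
  define Y where "Y n = adjoint_of (app (X n))" for n
  have Y: "adjoint_pair (app (X n)) (Y n)" for n
    using app[of "X n"] adjoint_pair_adjoint_of unfolding Y_def by blast
  have cauchy: "Cauchy (\<lambda>n. F n x)"
    if "\<And>m n. norm (F m x - F n x) \<le> norm (X m - X n) * norm x" for F :: "nat \<Rightarrow> 'a hm \<Rightarrow> 'a hm" and x
  proof (rule CauchyI)
    fix e :: real assume "e > 0"
    then have "e / (norm x + 1) > 0" by (simp add: add_nonneg_pos)
    then obtain M where M: "\<And>m n. m \<ge> M \<Longrightarrow> n \<ge> M \<Longrightarrow> norm (X m - X n) < e / (norm x + 1)"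
      using CauchyD[OF X] by blast
    have "norm (F m x - F n x) < e" if mn: "m \<ge> M" "n \<ge> M" for m n
    proof -
      have "norm (F m x - F n x) \<le> norm (X m - X n) * norm x" by fact
      also have "\<dots> \<le> norm (X m - X n) * (norm x + 1)" by (intro mult_left_mono) auto
      also have "\<dots> < e / (norm x + 1) * (norm x + 1)"
        by (intro mult_strict_right_mono M mn) (simp add: add_nonneg_pos)
      also have "\<dots> = e"
        using add_nonneg_pos[of "norm x" 1] by (simp add: less_imp_neq[symmetric])
      finally show ?thesis .
    qed
    then show "\<exists>M. \<forall>m\<ge>M. \<forall>n\<ge>M. norm (F m x - F n x) < e" by blast
  qed
  have dX: "norm (app (X m) x - app (X n) x) \<le> norm (X m - X n) * norm x" for m n x
    using norm_app_le[of "X m - X n" x] by (simp add: app_simps)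
  \<comment> \<open>Pairing the difference with itself transfers the estimate from
    \<open>X m - X n\<close> to the adjoints, before \<open>star\<close> is available on
    operators.\<close>
  have dY: "norm (Y m x - Y n x) \<le> norm (X m - X n) * norm x" for m n x
  proof -
    let ?d = "Y m x - Y n x"
    have "hip ?d ?d = hip x (app (X m - X n) ?d)"
      by (simp add: app_simps hip_diff_left hip_diff_right adjoint_pairD[OF Y])
    then have "(norm ?d)\<^sup>2 \<le> norm x * (norm (X m - X n) * norm ?d)"
      unfolding norm_hip_self[symmetric]
      using norm_hip_le[of x "app (X m - X n) ?d"] norm_app_le[of "X m - X n" ?d]
      by (metis (no_types) mult_left_mono norm_ge_zero order_trans)
    then show ?thesis
      by (cases "norm ?d = 0") (auto simp: power2_eq_square mult_ac)
  qed
  have "\<exists>l. (\<lambda>n. app (X n) x) \<longlonglongrightarrow> l" "\<exists>l. (\<lambda>n. Y n x) \<longlonglongrightarrow> l" for x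
    using cauchy[of "\<lambda>n. app (X n)", OF dX] cauchy[of Y, OF dY]
    by (auto simp: Cauchy_convergent_iff convergent_def)
  then obtain T S where T: "\<And>x. (\<lambda>n. app (X n) x) \<longlonglongrightarrow> T x" and S: "\<And>x. (\<lambda>n. Y n x) \<longlonglongrightarrow> S x"
    by metis
  have TS: "adjoint_pair T S"
    unfolding adjoint_pair_def
  proof (intro allI)
    fix x y
    have "(\<lambda>n. hip x (app (X n) y)) \<longlonglongrightarrow> hip x (T y)"
      by (intro bounded_bilinear.tendsto[OF bounded_bilinear_hip] T tendsto_const)
    moreover have "(\<lambda>n. hip x (app (X n) y)) \<longlonglongrightarrow> hip (S x) y"
      unfolding adjoint_pairD[OF Y]
      by (intro bounded_bilinear.tendsto[OF bounded_bilinear_hip] S tendsto_const)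
    ultimately show "hip x (T y) = hip (S x) y" by (rule LIMSEQ_unique)
  qed
  have "X \<longlonglongrightarrow> aop_of T"
  proof (rule LIMSEQ_I)
    fix e :: real assume "e > 0"
    then have e2: "e / 2 > 0" by simp
    obtain N where N: "\<And>m n. m \<ge> N \<Longrightarrow> n \<ge> N \<Longrightarrow> norm (X m - X n) < e / 2"
      using CauchyD[OF X e2] by blast
    have "norm (X n - aop_of T) < e" if n: "n \<ge> N" for n
    proof -
      have "norm (app (X n - aop_of T) x) \<le> e / 2 * norm x" for x
      proof -
        have lim: "(\<lambda>m. norm (app (X n) x - app (X m) x)) \<longlonglongrightarrow> norm (app (X n) x - T x)"
          by (intro tendsto_intros T)
        have "norm (app (X n) x - app (X m) x) \<le> e / 2 * norm x" if "m \<ge> N" for m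
          using dX[of n x m] mult_right_mono[OF less_imp_le[OF N[OF n that]], of "norm x"] by simp
        then have "norm (app (X n) x - T x) \<le> e / 2 * norm x"
          by (intro LIMSEQ_le_const2[OF lim]) blast
        then show ?thesis by (simp add: app_simps app_aop_of[OF TS])
      qed
      then have "norm (X n - aop_of T) \<le> e / 2" using e2 by (intro norm_aop_le) auto
      then show ?thesis using \<open>e > 0\<close> by simp
    qed
    then show "\<exists>N. \<forall>n\<ge>N. norm (X n - aop_of T) < e" by blast
  qed
  then show "convergent X" by (auto simp: convergent_def)
qed

instantiation aop :: (unital_cstar_algebra) unital_cstar_algebra
begin

lift_definition scaleC_aop :: "complex \<Rightarrow> 'a aop \<Rightarrow> 'a aop" is "\<lambda>c A x. hmul (A x) (scaleC c 1)"
  using adjoint_pair_hmul_scaleC by blast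

lift_definition star_aop :: "'a aop \<Rightarrow> 'a aop" is adjoint_of
  using adjoint_pair_adjoint_of adjoint_pair_sym by blast

lemma adjoint_pair_star: "adjoint_pair (app A) (app (star A))"
  unfolding star_aop.rep_eq using app[of A] adjoint_pair_adjoint_of by blast

lemma hip_app_right: "hip x (app A y) = hip (app (star A) x) y"
  by (rule adjoint_pairD[OF adjoint_pair_star])

lemma hip_app_left: "hip (app A x) y = hip x (app (star A) y)"
  by (metis hip_app_right star_hip)

lemma star_aop_eqI:
  assumes "\<And>x y. hip x (app A y) = hip (app B x) y"
  shows "star A = B"
  by (rule aop_eqI, rule hip_left_eqI) (simp add: assms flip: hip_app_right)

lemma norm_star_aop_le: "norm (star A) \<le> norm (A :: 'a aop)"
proof (rule norm_aop_le)
  fix x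
  let ?d = "app (star A) x"
  have "hip x (app A ?d) = hip ?d ?d" by (rule hip_app_right)
  then have "(norm ?d)\<^sup>2 = norm (hip x (app A ?d))" by (simp add: norm_hip_self)
  also have "\<dots> \<le> norm x * (norm A * norm ?d)"
    by (rule order_trans[OF norm_hip_le mult_left_mono[OF norm_app_le]]) simp
  finally show "norm ?d \<le> norm A * norm x"
    by (cases "norm ?d = 0") (auto simp: power2_eq_square mult_ac)
qed simp

instance
proof
  fix a b :: "'a aop" and c d :: complex and r :: real
  show "scaleC (complex_of_real r) a = r *\<^sub>R a"
    by (rule aop_eqI) (simp add: scaleC_aop.rep_eq app_simps scaleC_of_real hmul_of_real)
  show "scaleC c (a + b) = scaleC c a + scaleC c b"
    by (rule aop_eqI) (simp add: scaleC_aop.rep_eq app_simps hmul_add_left)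
  show "scaleC (c + d) a = scaleC c a + scaleC d a"
    by (rule aop_eqI) (simp add: scaleC_aop.rep_eq app_simps hmul_add_right scaleC_add_left)
  show "scaleC c (scaleC d a) = scaleC (c * d) a"
    by (rule aop_eqI)
      (simp add: scaleC_aop.rep_eq hmul_hmul scaleC_mult_left scaleC_scaleC mult.commute)
  show "scaleC c a * b = scaleC c (a * b)"
    by (rule aop_eqI) (simp add: scaleC_aop.rep_eq app_simps)
  show "a * scaleC c b = scaleC c (a * b)"
    by (rule aop_eqI) (simp add: scaleC_aop.rep_eq app_simps app_hmul)
  show "norm (scaleC c a) = cmod c * norm a"
  proof (rule antisym)
    have le: "norm (scaleC c a) \<le> cmod c * norm a" for c and a :: "'a aop"
    proof (rule norm_aop_le)
      fix x
      have "norm (app (scaleC c a) x) \<le> norm (app a x) * norm (scaleC c (1::'a))"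
        unfolding scaleC_aop.rep_eq by (rule norm_hmul_le)
      also have "\<dots> \<le> norm a * norm x * cmod c"
        by (simp add: norm_scaleC mult_right_mono norm_app_le)
      finally show "norm (app (scaleC c a) x) \<le> cmod c * norm a * norm x" by (simp add: mult_ac)
    qed simp
    show "norm (scaleC c a) \<le> cmod c * norm a" by (rule le)
    show "cmod c * norm a \<le> norm (scaleC c a)"
    proof (cases "c = 0")
      case False
      have "scaleC (inverse c) (scaleC c a) = a"
        using False
        by (intro aop_eqI)
          (simp add: scaleC_aop.rep_eq hmul_hmul scaleC_mult_left scaleC_scaleC)
      then have "norm a \<le> cmod (inverse c) * norm (scaleC c a)" using le by metis
      then show ?thesis using False by (simp add: norm_divide field_simps)
    qed simp
  qed
  show "star (a + b) = star a + star b"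
    by (rule star_aop_eqI) (simp add: app_simps hip_add_left hip_add_right hip_app_right)
  show "star (scaleC c a) = scaleC (cnj c) (star a)"
    by (rule star_aop_eqI)
      (use adjoint_pairD[OF adjoint_pair_hmul_scaleC[OF adjoint_pair_star]] in
        \<open>simp add: scaleC_aop.rep_eq\<close>)
  show "star (a * b) = star b * star a"
    by (rule star_aop_eqI) (simp add: app_simps hip_app_right)
  show "star (star a) = a"
    by (rule star_aop_eqI) (simp add: hip_app_left)
  show "norm (star a * a) = (norm a)\<^sup>2"
  proof (rule antisym)
    show "norm (star a * a) \<le> (norm a)\<^sup>2"
      using norm_mult_ineq[of "star a" a] mult_right_mono[OF norm_star_aop_le[of a], of "norm a"]
      by (simp add: power2_eq_square)
    have "norm a \<le> sqrt (norm (star a * a))"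
    proof (rule norm_aop_le)
      fix x
      have "(norm (app a x))\<^sup>2 = norm (hip x (app (star a * a) x))"
        by (simp add: app_simps flip: hip_app_left norm_hip_self)
      also have "\<dots> \<le> norm x * (norm (star a * a) * norm x)"
        by (rule order_trans[OF norm_hip_le mult_left_mono[OF norm_app_le]]) simp
      also have "\<dots> = (sqrt (norm (star a * a)) * norm x)\<^sup>2"
        by (simp add: power2_eq_square mult_ac)
      finally show "norm (app a x) \<le> sqrt (norm (star a * a)) * norm x"
        by (rule power2_le_imp_le) simp
    qed simp
    then have "(norm a)\<^sup>2 \<le> (sqrt (norm (star a * a)))\<^sup>2" by (intro power_mono) auto
    then show "(norm a)\<^sup>2 \<le> norm (star a * a)" by simp
  qed
qed

end

lemma app_sum: "app (\<Sum>i\<in>I. f i) x = (\<Sum>i\<in>I. app (f i) x)"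
  by (induction I rule: infinite_finite_induct) (auto simp: app_simps)

lemma cpos_hip_app: "cpos A \<Longrightarrow> cpos (hip x (app A x))"
proof -
  assume "cpos A"
  then obtain B where "A = star B * B" by (auto simp: cpos_def)
  then have "hip x (app A x) = hip (app B x) (app B x)" by (simp add: app_simps hip_app_left)
  then show ?thesis by simp
qed

text \<open>This identifies \<open>aop\<close> with \<open>adjointable\<close>, the operators extended by \<open>0\<close> outside \<open>hilb\<close>.\<close>

definition op_of :: "'b::unital_cstar_algebra aop \<Rightarrow> 'b oper" where
  "op_of A x = (if x \<in> hilb then coord (app A (hm_of x)) else 0)"

lemma op_of_hilb_maps: "op_of A \<in> hilb_maps"
  by (simp add: hilb_maps_def op_of_def)

lemma op_of_coord [simp]: "op_of A (coord x) = coord (app A x)"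
  by (simp add: op_of_def)

lemma op_of_inject: "op_of A = op_of B \<longleftrightarrow> A = B"
  by (metis aop_eqI coord_inject op_of_coord)

lemma ip_coord: "ip (coord x) (coord y) = hip x y"
  by (simp add: hip.rep_eq)

lemma hilb_cases:
  assumes "x \<in> hilb" obtains z where "x = coord z"
  using assms coord_hm_of by metis

lemma is_adjoint_op_of: "is_adjoint (op_of A) (op_of (star A))"
  unfolding is_adjoint_def
  by (auto simp: op_of_hilb_maps ip_coord hip_app_right elim!: hilb_cases)

lemma is_adjoint_unique:
  assumes "is_adjoint T S" "is_adjoint T S'"
  shows "S = S'"
proof
  fix x
  show "S x = S' x"
  proof (cases "x \<in> hilb")
    case True
    have h: "S x \<in> hilb" "S' x \<in> hilb" using assms True by (auto simp: is_adjoint_def hilb_maps_def)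
    have "hip (hm_of (S x)) y = hip (hm_of (S' x)) y" for y
      using assms True h by (simp add: is_adjoint_def hip.rep_eq)
    then have "hm_of (S x) = hm_of (S' x)" by (rule hip_left_eqI)
    then show ?thesis using h by (metis coord_hm_of)
  qed (use assms in \<open>auto simp: is_adjoint_def hilb_maps_def\<close>)
qed

lemma adj_op_of [simp]: "adj (op_of A) = op_of (star A)"
  unfolding adj_def using is_adjoint_op_of is_adjoint_unique by blast

lemma op_of_adjointable [simp, intro]: "op_of A \<in> adjointable"
  unfolding adjointable_def using is_adjoint_op_of op_of_hilb_maps by blast

lemma adjointable_cases:
  assumes "T \<in> adjointable" obtains A where "T = op_of A"
proof -
  obtain S where S: "is_adjoint T S" and T: "T \<in> hilb_maps"
    using assms by (auto simp: adjointable_def)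
  let ?f = "\<lambda>x. hm_of (T (coord x))"
  have h: "T (coord x) \<in> hilb" "S (coord x) \<in> hilb" for x
    using S T by (auto simp: is_adjoint_def hilb_maps_def)
  have "adjoint_pair ?f (\<lambda>x. hm_of (S (coord x)))"
    using S h by (auto simp: adjoint_pair_def hip.rep_eq is_adjoint_def)
  then have "app (aop_of ?f) = ?f" by (rule app_aop_of)
  then have "T = op_of (aop_of ?f)"
    using T h by (auto simp: fun_eq_iff op_of_def hilb_maps_def)
  then show thesis by (rule that)
qed

lemma op_of_add: "op_of (A + B) = op_of A + op_of B"
  by (auto simp: fun_eq_iff op_of_def app_simps plus_hm.rep_eq)

lemma op_of_diff: "op_of (A - B) = op_of A - op_of B"
  by (auto simp: fun_eq_iff op_of_def app_simps minus_hm.rep_eq)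

lemma op_of_zero: "op_of 0 = 0"
  by (auto simp: fun_eq_iff op_of_def app_simps zero_hm.rep_eq)

lemma op_of_sum: "op_of (\<Sum>i\<in>I. f i) = (\<Sum>i\<in>I. op_of (f i))"
  by (induction I rule: infinite_finite_induct) (auto simp: op_of_zero op_of_add)

lemma op_of_one: "op_of 1 = idop"
  by (auto simp: fun_eq_iff op_of_def app_simps idop_def)

lemma op_of_zero_right [simp]: "op_of A 0 = 0"
  using op_of_coord[of A 0] by (simp add: zero_hm.rep_eq)

lemma op_of_mult: "op_of (A * B) = op_of A \<circ> op_of B"
proof
  fix x
  show "op_of (A * B) x = (op_of A \<circ> op_of B) x"
  proof (cases "x \<in> hilb")
    case False
    then have "op_of (A * B) x = 0" "op_of B x = 0" by (simp_all add: op_of_def)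
    then show ?thesis by simp
  qed (simp add: op_of_def app_simps)
qed

lemma op_of_scaleC: "op_of (scaleC c A) = opscale c (op_of A)"
  by (auto simp: fun_eq_iff op_of_def opscale_def scaleC_aop.rep_eq coord_hmul scaleC_mult_right)

text \<open>The iterate with exponent \<open>0\<close> is \<open>id\<close>, which differs from
  \<open>idop\<close> outside \<open>hilb\<close>; this is where the restriction on \<open>n\<close>
  comes from.\<close>

lemma op_of_power: "n \<ge> 1 \<Longrightarrow> op_of (A ^ n) = op_of A ^^ n"
proof (induction n rule: dec_induct)
  case (step n)
  then show ?case by (simp add: op_of_mult)
qed simp

lemma opnorm_op_of: "opnorm (op_of A) = norm A"
proof -
  have hn: "hnorm (coord x) = norm x" for x :: "'a hm" by (simp add: norm_hm.rep_eq)
  have le: "hnorm (op_of A x) \<le> norm A" if x: "x \<in> {x \<in> hilb. hnorm x \<le> 1}" for x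
  proof -
    obtain z where z: "x = coord z" using x by (auto elim: hilb_cases)
    then have "norm z \<le> 1" using x hn by auto
    then have "norm (app A z) \<le> norm A"
      using norm_app_le[of A z] mult_left_mono[of "norm z" 1 "norm A"] by simp
    then show ?thesis by (simp add: z hn)
  qed
  have ge: "hnorm (op_of A x) \<le> opnorm (op_of A)" if x: "x \<in> {x \<in> hilb. hnorm x \<le> 1}" for x
    unfolding opnorm_def using x le by (intro cSUP_upper bdd_aboveI2) auto
  show ?thesis
  proof (rule antisym)
    have "0 \<in> {x \<in> hilb. hnorm (x :: nat \<Rightarrow> 'a) \<le> 1}" by (simp add: hnorm_def ip_def)
    then show "opnorm (op_of A) \<le> norm A"
      unfolding opnorm_def using le by (intro cSUP_least) blast+
    show "norm A \<le> opnorm (op_of A)"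
    proof (rule norm_aop_le)
      show "0 \<le> opnorm (op_of A)"
        using ge[of 0] \<open>0 \<in> {x \<in> hilb. hnorm (x :: nat \<Rightarrow> 'a) \<le> 1}\<close>
        by (metis (no_types, lifting) hnorm_def norm_ge_zero order_trans real_sqrt_ge_0_iff)
      fix x
      show "norm (app A x) \<le> opnorm (op_of A) * norm x"
      proof (cases "x = 0")
        case False
        let ?z = "(1 / norm x) *\<^sub>R x"
        have "hnorm (op_of A (coord ?z)) \<le> opnorm (op_of A)"
          by (rule ge) (use False in \<open>simp add: hn\<close>)
        then have "(1 / norm x) * norm (app A x) \<le> opnorm (op_of A)"
          by (simp add: hn app_scaleR_right)
        then show ?thesis using False by (simp add: field_simps)
      qed simp
    qed
  qed
qed

section \<open>Rank one operators, positivity and projections under \<open>op_of\<close>\<close>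

lift_definition theta :: "'b::unital_cstar_algebra hm \<Rightarrow> 'b hm \<Rightarrow> 'b aop" is
  "\<lambda>x y z. hmul x (hip y z)"
proof -
  fix x y :: "'b hm"
  have "adjoint_pair (\<lambda>z. hmul x (hip y z)) (\<lambda>z. hmul y (hip x z))"
    by (simp add: adjoint_pair_def hip_mul_left hip_mul_right star_hip)
  then show "\<exists>S. adjoint_pair (\<lambda>z. hmul x (hip y z)) S" by blast
qed

lemma op_of_theta: "op_of (theta x y) = rank_one (coord x) (coord y)"
  by (auto simp: fun_eq_iff op_of_def rank_one_def theta.rep_eq coord_hmul hip.rep_eq)

lemma star_theta: "star (theta x y) = theta y x"
  by (rule star_aop_eqI) (simp add: theta.rep_eq hip_mul_left hip_mul_right star_hip)

lemma mult_theta: "A * theta x y = theta (app A x) y"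
  by (rule aop_eqI) (simp add: app_simps theta.rep_eq app_hmul)

lemma theta_mult: "theta x y * A = theta x (app (star A) y)"
  by (rule aop_eqI) (simp add: app_simps theta.rep_eq hip_app_right)

lemma norm_theta_le: "norm (theta x y) \<le> norm x * norm y"
proof (rule norm_aop_le)
  fix z
  have "norm (app (theta x y) z) \<le> norm x * norm (hip y z)"
    unfolding theta.rep_eq by (rule norm_hmul_le)
  also have "\<dots> \<le> norm x * (norm y * norm z)" by (intro mult_left_mono norm_hip_le) simp
  finally show "norm (app (theta x y) z) \<le> norm x * norm y * norm z" by (simp add: mult.assoc)
qed simp

lemma op_positive_op_of: "op_positive (op_of A) \<longleftrightarrow> cpos A"
proof
  assume "op_positive (op_of A)"
  then obtain S where "S \<in> adjointable" "op_of A = adj S \<circ> S" by (auto simp: op_positive_def)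
  then show "cpos A" by (metis adj_op_of adjointable_cases cpos_star_mult op_of_inject op_of_mult)
next
  assume "cpos A"
  then obtain B where "A = star B * B" by (auto simp: cpos_def)
  then have "op_of A = adj (op_of B) \<circ> op_of B" by (simp add: op_of_mult)
  then show "op_positive (op_of A)" unfolding op_positive_def by blast
qed

lemma op_positive_cases:
  assumes "op_positive T" obtains A where "T = op_of A" "cpos A"
proof -
  obtain S where "S \<in> adjointable" "T = adj S \<circ> S" using assms by (auto simp: op_positive_def)
  then have "\<exists>A. T = op_of A" by (metis adj_op_of adjointable_cases op_of_mult)
  then show thesis using that assms op_positive_op_of by blast
qed

lemma projection_op_of: "projection (op_of P) \<longleftrightarrow> P * P = P \<and> star P = P"
  by (simp add: projection_def op_of_inject flip: op_of_mult)

section \<open>Compact operators\<close>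

definition finite_rank_aop :: "'b::unital_cstar_algebra aop set" where
  "finite_rank_aop = {A. op_of A \<in> finite_rank}"

text \<open>Pulled back along \<open>op_of\<close>, so that hypotheses on \<open>compact_ops\<close>
  transfer directly; \<open>compact_aop_iff\<close> gives the usable form.\<close>

definition compact_aop :: "'b::unital_cstar_algebra aop set" where
  "compact_aop = {A. op_of A \<in> compact_ops}"

lemma scaleC_theta: "scaleC c (theta x y) = theta (hmul x (scaleC c 1)) y"
  by (rule aop_eqI) (simp add: scaleC_aop.rep_eq theta.rep_eq hmul_hmul scaleC_one_commute)

lemma finite_rank_cases:
  assumes "T \<in> finite_rank" obtains A where "T = op_of A"
proof -
  have "\<exists>A. T = op_of A"
    using assms unfolding finite_rank_def
  proof (induction rule: oper.span_induct_alt)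
    case base
    show ?case by (metis op_of_zero)
  next
    case (step c R S)
    then obtain u v A where uv: "R = rank_one u v" "u \<in> hilb" "v \<in> hilb" and "S = op_of A"
      by blast
    moreover obtain x where "u = coord x" using uv(2) by (rule hilb_cases)
    moreover obtain y where "v = coord y" using uv(3) by (rule hilb_cases)
    ultimately show ?case by (metis op_of_theta op_of_scaleC op_of_add)
  qed
  then show thesis using that by blast
qed

lemma theta_finite_rank_aop [simp]: "theta x y \<in> finite_rank_aop"
  unfolding finite_rank_aop_def finite_rank_def mem_Collect_eq op_of_theta
  by (rule oper.span_base) (use coord_hilb in blast)

lemma finite_rank_aop_zero [simp]: "0 \<in> finite_rank_aop"
  by (simp add: finite_rank_aop_def finite_rank_def op_of_zero oper.span_zero)

lemma finite_rank_aop_add: "A \<in> finite_rank_aop \<Longrightarrow> B \<in> finite_rank_aop \<Longrightarrow> A + B \<in> finite_rank_aop"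
  by (simp add: finite_rank_aop_def finite_rank_def op_of_add oper.span_add)

lemma finite_rank_aop_sum: "(\<And>i. i \<in> I \<Longrightarrow> f i \<in> finite_rank_aop) \<Longrightarrow> (\<Sum>i\<in>I. f i) \<in> finite_rank_aop"
  by (induction I rule: infinite_finite_induct) (auto intro: finite_rank_aop_add)

text \<open>\<open>scaleC_theta\<close> absorbs the complex coefficient of a linear combination into
  the first vector, so the induction step adds a single \<open>theta\<close>.\<close>

lemma finite_rank_aop_induct [consumes 1, case_names zero add]:
  assumes "A \<in> finite_rank_aop" "P 0" "\<And>x y A. A \<in> finite_rank_aop \<Longrightarrow> P A \<Longrightarrow> P (theta x y + A)"
  shows "P A"
proof -
  have "op_of A \<in> oper.span {rank_one x y | x y. x \<in> hilb \<and> y \<in> hilb}"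
    using assms(1) by (simp add: finite_rank_aop_def finite_rank_def)
  then have "\<exists>B. op_of A = op_of B \<and> B \<in> finite_rank_aop \<and> P B"
  proof (induction rule: oper.span_induct_alt)
    case base
    show ?case by (rule exI[of _ 0]) (simp add: op_of_zero assms(2))
  next
    case (step c R S)
    then obtain u v where uv: "R = rank_one u v" "u \<in> hilb" "v \<in> hilb" by blast
    obtain x where "u = coord x" using uv(2) by (rule hilb_cases)
    moreover obtain y where "v = coord y" using uv(3) by (rule hilb_cases)
    ultimately have R: "R = rank_one (coord x) (coord y)" using uv(1) by simp
    obtain B where B: "S = op_of B" "B \<in> finite_rank_aop" "P B"
      using step by blast
    let ?t = "theta (hmul x (scaleC c 1)) y"
    have "opscale c R + S = op_of (?t + B)"
      by (simp add: R B op_of_add op_of_theta op_of_scaleC flip: scaleC_theta)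
    moreover have "?t + B \<in> finite_rank_aop" by (simp add: finite_rank_aop_add B)
    moreover have "P (?t + B)" by (rule assms(3)[OF B(2,3)])
    ultimately show ?case by blast
  qed
  then show ?thesis by (auto simp: op_of_inject)
qed

lemma finite_rank_aop_mult_left: "A \<in> finite_rank_aop \<Longrightarrow> B * A \<in> finite_rank_aop"
  by (induction rule: finite_rank_aop_induct) (auto simp: distrib_left mult_theta intro: finite_rank_aop_add)

lemma finite_rank_aop_mult_right: "A \<in> finite_rank_aop \<Longrightarrow> A * B \<in> finite_rank_aop"
  by (induction rule: finite_rank_aop_induct) (auto simp: distrib_right theta_mult intro: finite_rank_aop_add)

lemma finite_rank_aop_star: "A \<in> finite_rank_aop \<Longrightarrow> star A \<in> finite_rank_aop"
  by (induction rule: finite_rank_aop_induct) (auto simp: star_add star_theta intro: finite_rank_aop_add)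

lemma compact_aop_iff: "A \<in> compact_aop \<longleftrightarrow> (\<forall>e>0. \<exists>F\<in>finite_rank_aop. norm (A - F) < e)"
proof
  assume A: "A \<in> compact_aop"
  show "\<forall>e>0. \<exists>F\<in>finite_rank_aop. norm (A - F) < e"
  proof (intro allI impI)
    fix e :: real assume "e > 0"
    then obtain T where T: "T \<in> finite_rank" "opnorm (op_of A - T) < e"
      using A by (auto simp: compact_aop_def compact_ops_def)
    then obtain F where "T = op_of F" by (auto elim: finite_rank_cases)
    then show "\<exists>F\<in>finite_rank_aop. norm (A - F) < e"
      using T by (auto simp: finite_rank_aop_def opnorm_op_of simp flip: op_of_diff)
  qed
next
  assume A: "\<forall>e>0. \<exists>F\<in>finite_rank_aop. norm (A - F) < e"
  have "\<exists>T\<in>finite_rank. opnorm (op_of A - T) < e" if e: "e > 0" for e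
  proof -
    obtain F where "F \<in> finite_rank_aop" "norm (A - F) < e" using A e by blast
    then show ?thesis by (intro bexI[of _ "op_of F"]) (auto simp: finite_rank_aop_def opnorm_op_of simp flip: op_of_diff)
  qed
  then show "A \<in> compact_aop" by (simp add: compact_aop_def compact_ops_def)
qed

lemma kopD: "A \<in> compact_aop \<Longrightarrow> e > 0 \<Longrightarrow> \<exists>F\<in>finite_rank_aop. norm (A - F) < e"
  by (simp add: compact_aop_iff)

lemma compact_ops_cases:
  assumes "T \<in> compact_ops" obtains A where "T = op_of A" "A \<in> compact_aop"
proof -
  have "T \<in> adjointable" using assms by (simp add: compact_ops_def)
  then obtain A where "T = op_of A" by (rule adjointable_cases)
  then show thesis using that assms by (simp add: compact_aop_def)
qed

lemma op_of_compact [simp]: "op_of A \<in> compact_ops \<longleftrightarrow> A \<in> compact_aop"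
  by (simp add: compact_aop_def)

lemma finite_rank_aop_compact_aop: "A \<in> finite_rank_aop \<Longrightarrow> A \<in> compact_aop"
  unfolding compact_aop_iff by (intro allI impI bexI[of _ A]) auto

lemma compact_aop_add:
  assumes "A \<in> compact_aop" "B \<in> compact_aop"
  shows "A + B \<in> compact_aop"
  unfolding compact_aop_iff
proof (intro allI impI)
  fix e :: real assume "e > 0"
  then have e: "e / 2 > 0" by simp
  obtain F G where "F \<in> finite_rank_aop" "norm (A - F) < e / 2" "G \<in> finite_rank_aop" "norm (B - G) < e / 2"
    using kopD[OF assms(1) e] kopD[OF assms(2) e] by blast
  then have "F + G \<in> finite_rank_aop" "norm ((A + B) - (F + G)) < e"
    using norm_triangle_ineq[of "A - F" "B - G"] by (auto simp: finite_rank_aop_add algebra_simps)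
  then show "\<exists>F\<in>finite_rank_aop. norm (A + B - F) < e" by blast
qed

lemma compact_aop_mult_left:
  assumes "A \<in> compact_aop"
  shows "B * A \<in> compact_aop"
  unfolding compact_aop_iff
proof (intro allI impI)
  fix e :: real assume e: "e > 0"
  have B: "norm B + 1 > 0" by (simp add: add_nonneg_pos)
  then have "e / (norm B + 1) > 0" using e by simp
  then obtain F where F: "F \<in> finite_rank_aop" "norm (A - F) < e / (norm B + 1)"
    using kopD[OF assms] by blast
  have "norm (B * A - B * F) \<le> norm B * norm (A - F)"
    using norm_mult_ineq[of B "A - F"] by (simp add: algebra_simps)
  also have "\<dots> \<le> (norm B + 1) * norm (A - F)" by (intro mult_right_mono) auto
  also have "\<dots> < e" using F(2) B by (simp add: field_simps)
  finally show "\<exists>F\<in>finite_rank_aop. norm (B * A - F) < e" using finite_rank_aop_mult_left[OF F(1)] by blast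
qed

lemma compact_aop_star:
  assumes "A \<in> compact_aop"
  shows "star A \<in> compact_aop"
  unfolding compact_aop_iff
proof (intro allI impI)
  fix e :: real assume "e > 0"
  then obtain F where F: "F \<in> finite_rank_aop" "norm (A - F) < e" using kopD[OF assms] by blast
  have "norm (star A - star F) < e" using F(2) by (simp flip: star_diff)
  then show "\<exists>F\<in>finite_rank_aop. norm (star A - F) < e" using finite_rank_aop_star[OF F(1)] by blast
qed

lemma compact_aop_mult_right: "A \<in> compact_aop \<Longrightarrow> A * B \<in> compact_aop"
  using compact_aop_star[OF compact_aop_mult_left[OF compact_aop_star, of A "star B"]] by (simp add: star_mult star_star)

lemma compact_aop_zero [simp]: "0 \<in> compact_aop"
  by (simp add: finite_rank_aop_compact_aop)

lemma compact_aop_minus: "A \<in> compact_aop \<Longrightarrow> - A \<in> compact_aop"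
  using compact_aop_mult_left[of A "-1"] by simp

lemma compact_aop_diff: "A \<in> compact_aop \<Longrightarrow> B \<in> compact_aop \<Longrightarrow> A - B \<in> compact_aop"
  using compact_aop_add[OF _ compact_aop_minus, of A B] by simp

lemma compact_aop_scaleR: "A \<in> compact_aop \<Longrightarrow> r *\<^sub>R A \<in> compact_aop"
  using compact_aop_mult_left[of A "of_real r"] by (simp add: of_real_def)

lemma compact_aop_closed:
  assumes "\<And>e. e > 0 \<Longrightarrow> \<exists>K\<in>compact_aop. norm (A - K) < e"
  shows "A \<in> compact_aop"
  unfolding compact_aop_iff
proof (intro allI impI)
  fix e :: real assume "e > 0"
  then have e: "e / 2 > 0" by simp
  obtain K where K: "K \<in> compact_aop" "norm (A - K) < e / 2" using assms[OF e] by blast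
  obtain F where F: "F \<in> finite_rank_aop" "norm (K - F) < e / 2" using kopD[OF K(1) e] by blast
  have "norm (A - F) < e" using K(2) F(2) norm_triangle_ineq[of "A - K" "K - F"] by simp
  then show "\<exists>F\<in>finite_rank_aop. norm (A - F) < e" using F(1) by blast
qed

text \<open>For \<open>0 \<le> x \<le> 1\<close> and \<open>y = 1 - x\<close> one has \<open>(k + 1) x y\<^sup>k \<le> 1 - y\<^sup>k\<^sup>+\<^sup>1\<close>, so \<open>c (1 - c\<^sup>2)\<^sup>m\<close> tends to \<open>0\<close> while
  \<open>c - c (1 - c\<^sup>2)\<^sup>m\<close> is a multiple of \<open>c\<^sup>2\<close>.\<close>

lemma norm_mult_power_one_minus_square_le:
  fixes c :: "'a::unital_cstar_algebra"
  assumes c: "star c = c" and n: "norm c \<le> 1"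
  shows "norm (c * (1 - c * c) ^ m) ^ 2 \<le> 2 / (2 * real m + 1)"
proof -
  define x where "x = c * c"
  define y where "y = 1 - x"
  have y1: "norm y \<le> 1" unfolding y_def x_def by (rule norm_one_minus_square_le[OF c n])
  have sx: "star x = x" by (simp add: x_def star_mult c)
  have sy: "star y = y" by (simp add: y_def star_diff sx)
  have px: "cpos x" unfolding x_def using cpos_star_mult[of c] c by simp
  have "norm x \<le> 1" using norm_self_adjoint_square[OF c] n by (simp add: x_def power_le_one)
  then have "cpos ((of_real (norm x) - x) + (1 - norm x) *\<^sub>R 1)"
    by (intro cpos_add cpos_norm_minus cpos_scaleR sx) auto
  then have py: "cpos y" by (simp add: y_def of_real_def scaleR_diff_left)
  have xy: "x * y = y * x" by (simp add: y_def algebra_simps)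
  have xyk: "x * y ^ k = y ^ k * x" for k using xy by (metis power_commuting_commutes)
  have pxx: "cpos (x * x)" using cpos_star_mult[of x] sx by simp
  have pk: "cpos (x * x * y ^ k)" for k
  proof -
    have "x * x * y ^ k = y ^ k * (x * x)" by (metis xyk mult.assoc)
    then show ?thesis
      using pxx norm_positive_power py unfolding cpos_iff_norm_positive by (metis norm_positive_mult)
  qed
  have p: "cpos (1 - y ^ Suc k - real (Suc k) *\<^sub>R (x * y ^ k))" for k
  proof (induction k)
    case 0
    show ?case by (simp add: y_def)
  next
    case (Suc k)
    have yy: "y ^ Suc i = y ^ i - x * y ^ i" for i by (simp add: y_def algebra_simps)
    have eq: "1 - y ^ Suc (Suc k) - real (Suc (Suc k)) *\<^sub>R (x * y ^ Suc k)
        = (1 - y ^ Suc k - real (Suc k) *\<^sub>R (x * y ^ k)) + real (Suc k) *\<^sub>R (x * x * y ^ k)"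
      unfolding yy[of "Suc k"] unfolding yy[of k] by (simp add: algebra_simps scaleR_2)
    show ?case unfolding eq by (intro cpos_add Suc cpos_scaleR pk) simp
  qed
  have ps: "cpos (x * y ^ k)" for k
    using px py unfolding cpos_iff_norm_positive
    by (intro norm_positive_mult norm_positive_power xyk)
  have b: "real (Suc k) * norm (x * y ^ k) \<le> 2" for k
  proof -
    have "norm (real (Suc k) *\<^sub>R (x * y ^ k)) \<le> norm (1 - y ^ Suc k)"
      by (rule cpos_norm_mono[OF cpos_scaleR[OF ps] p]) simp
    also have "\<dots> \<le> 1 + norm (y ^ Suc k)" using norm_triangle_ineq4[of 1 "y ^ Suc k"] by simp
    also have "norm (y ^ Suc k) \<le> 1"
      using norm_power_ineq[of y "Suc k"] power_le_one[OF norm_ge_zero y1, of "Suc k"] by linarith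
    finally show ?thesis by (simp del: power_Suc)
  qed
  \<comment> \<open>By \<open>cstar_identity\<close> the square of the norm is the norm of
    \<open>x * y ^ (m + m)\<close>; the bound \<open>b\<close> at \<open>k = m + m\<close> produces
    the denominator.\<close>
  have "norm (c * y ^ m) ^ 2 = norm (star (c * y ^ m) * (c * y ^ m))" by (simp add: cstar_identity)
  also have "star (c * y ^ m) * (c * y ^ m) = y ^ m * (x * y ^ m)"
    by (simp add: star_mult star_power sy c x_def mult.assoc)
  also have "\<dots> = x * y ^ (m + m)" by (metis xyk mult.assoc power_add)
  finally have "norm (c * y ^ m) ^ 2 = norm (x * y ^ (m + m))" .
  then show ?thesis
    using b[of "m + m"] by (simp add: x_def[symmetric] y_def[symmetric] field_simps)
qed

lemma compact_aop_of_square: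
  assumes c: "star c = c" and k: "c * c \<in> compact_aop"
  shows "c \<in> compact_aop"
proof -
  have *: "c \<in> compact_aop" if c: "star c = c" and n: "norm c \<le> 1" and k: "c * c \<in> compact_aop" for c :: "'a aop"
  proof (rule compact_aop_closed)
    fix e :: real assume "e > 0"
    then have "e\<^sup>2 > 0" by simp
    then obtain m where m: "2 / e\<^sup>2 < real m" using reals_Archimedean2 by blast
    have "norm (c * (1 - c * c) ^ m) ^ 2 \<le> 2 / (2 * real m + 1)"
      by (rule norm_mult_power_one_minus_square_le[OF c n])
    also have "\<dots> < e\<^sup>2"
    proof -
      have "2 < e\<^sup>2 * real m" using m \<open>e\<^sup>2 > 0\<close> by (simp add: field_simps)
      also have "\<dots> \<le> e\<^sup>2 * (2 * real m + 1)" by (intro mult_left_mono) auto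
      finally show ?thesis by (simp add: divide_less_eq)
    qed
    finally have "norm (c * (1 - c * c) ^ m) < e" using \<open>e > 0\<close> by (simp add: power2_less_imp_less)
    moreover have "c * (1 - c * c) ^ m = c - c * (1 - (1 - c * c) ^ m)" by (simp add: algebra_simps)
    \<comment> \<open>The geometric sum exhibits the factor \<open>c * c\<close>.\<close>
    moreover have "1 - (1 - c * c) ^ m \<in> compact_aop"
      using compact_aop_mult_right[OF k, of "\<Sum>i<m. (1 - c * c) ^ i"]
        one_minus_mult_geometric_sum[of "1 - c * c" m] by simp
    then have "c * (1 - (1 - c * c) ^ m) \<in> compact_aop" by (rule compact_aop_mult_left)
    ultimately show "\<exists>K\<in>compact_aop. norm (c - K) < e" by auto
  qed
  show ?thesis
  proof (cases "c = 0")
    case False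
    let ?d = "(1 / norm c) *\<^sub>R c"
    have "?d \<in> compact_aop"
      by (rule *) (use False c k in \<open>auto simp: star_scaleR intro: compact_aop_scaleR\<close>)
    then have "norm c *\<^sub>R ?d \<in> compact_aop" by (rule compact_aop_scaleR)
    then show ?thesis using False by simp
  qed simp
qed

text \<open>Descent on the exponent: with \<open>?m\<close> half of \<open>n\<close> rounded up,
  \<open>a ^ ?m * a ^ ?m\<close> is a multiple of \<open>a ^ n\<close>, and
  \<open>compact_aop_of_square\<close> takes the root. Rounding up still leaves
  \<open>?m < n\<close> as long as \<open>n > 1\<close>.\<close>

lemma compact_aop_of_power:
  assumes a: "star a = a"
  shows "a ^ n \<in> compact_aop \<Longrightarrow> n \<ge> 1 \<Longrightarrow> a \<in> compact_aop"
proof (induction n rule: less_induct)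
  case (less n)
  show ?case
  proof (cases "n = 1")
    case False
    let ?m = "(n + 1) div 2"
    have m: "?m < n" "?m \<ge> 1" "?m + ?m = n + (?m + ?m - n)" using less.prems(2) False by auto
    have "a ^ ?m * a ^ ?m = a ^ n * a ^ (?m + ?m - n)" by (metis m(3) power_add)
    then have "a ^ ?m * a ^ ?m \<in> compact_aop" using compact_aop_mult_right[OF less.prems(1)] by simp
    then have "a ^ ?m \<in> compact_aop" by (rule compact_aop_of_square[rotated]) (simp add: star_power a)
    then show ?thesis by (rule less.IH[OF m(1) _ m(2)])
  next
    case True
    then show ?thesis using less.prems(1) by simp
  qed
qed

text \<open>Since \<open>h\<close> lies between \<open>0\<close> and \<open>norm h\<close>, dividing
  \<open>h + 1\<close> by \<open>norm h + 1\<close> gives \<open>1 - y\<close> with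
  \<open>norm y\<close> at most \<open>norm h / (norm h + 1)\<close>, which is below one; the
  Neumann series does the rest.\<close>

lemma one_plus_cpos_right_inverse:
  fixes h :: "'a::unital_cstar_algebra"
  assumes h: "cpos h"
  obtains z where "(h + 1) * z = 1"
proof -
  let ?M = "norm h"
  have M0: "?M + 1 > 0" by (simp add: add_nonneg_pos)
  have "cpos (of_real ?M - h)" by (rule cpos_norm_minus[OF cpos_self_adjoint[OF h]])
  then have "norm (of_real ?M - h) \<le> norm (of_real ?M :: 'a)"
    by (rule cpos_norm_mono) (simp add: h)
  then have le: "norm (of_real ?M - h) \<le> ?M" by simp
  let ?y = "(1 / (?M + 1)) *\<^sub>R (of_real ?M - h)"
  have "norm ?y \<le> ?M / (?M + 1)" using le M0 by (simp add: divide_right_mono)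
  also have "\<dots> < 1" using M0 by simp
  finally obtain w where w: "(1 - ?y) * w = 1" by (metis one_minus_invertible)
  have "(?M + 1) *\<^sub>R (1 - ?y) = (?M + 1) *\<^sub>R 1 - (of_real ?M - h)"
    using M0 by (simp add: scaleR_diff_right)
  also have "\<dots> = h + 1" by (simp add: of_real_def scaleR_add_left)
  finally have e: "h + 1 = (?M + 1) *\<^sub>R (1 - ?y)" ..
  show thesis
  proof (rule that)
    show "(h + 1) * ((1 / (?M + 1)) *\<^sub>R w) = 1" unfolding e using w M0 by simp
  qed
qed

text \<open>Factor \<open>h * h - 1\<close> as \<open>(h - 1) * (h + 1)\<close> and cancel the
  invertible second factor. This is how compactness passes from a square such as
  \<open>star G * G\<close> to its positive root.\<close>

lemma compact_aop_of_square_minus_one: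
  assumes h: "cpos h" and k: "h * h - 1 \<in> compact_aop"
  shows "h - 1 \<in> compact_aop"
proof -
  obtain z where z: "(h + 1) * z = 1" using one_plus_cpos_right_inverse[OF h] .
  have "h - 1 = (h - 1) * ((h + 1) * z)" by (simp add: z)
  also have "\<dots> = (h * h - 1) * z" by (simp add: algebra_simps)
  finally show ?thesis using compact_aop_mult_right[OF k] by simp
qed

section \<open>Projections onto the first coordinates as approximate units\<close>

definition trunc :: "nat \<Rightarrow> 'b::unital_cstar_algebra aop" where
  "trunc m = (\<Sum>k<m. theta (hbasis k) (hbasis k))"

lemma trunc_finite_rank_aop [simp]: "trunc m \<in> finite_rank_aop"
  unfolding trunc_def by (rule finite_rank_aop_sum) simp

lemma star_trunc [simp]: "star (trunc m) = trunc m"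
  by (simp add: trunc_def star_sum star_theta)

lemma app_trunc: "app (trunc m) x = (\<Sum>k<m. hmul (hbasis k) (coord x k))"
  by (simp add: trunc_def app_sum theta.rep_eq hip_hbasis_left)

lemma hmul_zero [simp]: "hmul x 0 = 0"
  by transfer (simp add: fun_eq_iff)

lemma app_trunc_hbasis: "app (trunc m) (hbasis j) = (if j < m then hbasis j else 0)"
proof -
  have "app (trunc m) (hbasis j) = (\<Sum>k<m. if k = j then hbasis j else 0)"
    unfolding app_trunc by (intro sum.cong) (auto simp: hbasis.rep_eq)
  then show ?thesis by simp
qed

lemma trunc_idem [simp]: "trunc m * trunc m = trunc m"
proof -
  have "trunc m * trunc m = (\<Sum>k<m. trunc m * theta (hbasis k) (hbasis k))"
    by (subst (2) trunc_def) (simp add: sum_distrib_left)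
  also have "\<dots> = (\<Sum>k<m. theta (hbasis k) (hbasis k))"
    by (intro sum.cong) (auto simp: mult_theta app_trunc_hbasis)
  finally show ?thesis by (simp add: trunc_def)
qed

lemma norm_projection_le:
  fixes p :: "'a::unital_cstar_algebra"
  assumes "p * p = p" "star p = p"
  shows "norm p \<le> 1"
  using cstar_identity[of p] assms by (cases "norm p = 0") (auto simp: power2_eq_square)

lemma norm_one_minus_trunc_le: "norm (1 - trunc m) \<le> 1"
  by (rule norm_projection_le) (simp_all add: algebra_simps star_diff)

lemma trunc_LIMSEQ: "(\<lambda>m. app (1 - trunc m) y) \<longlonglongrightarrow> 0"
proof -
  have n: "norm (app (1 - trunc m) y) = sqrt (norm (hip y y - (\<Sum>k<m. star (coord y k) * coord y k)))" for m
  proof -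
    let ?q = "1 - trunc m :: 'a aop"
    have "hip (app ?q y) (app ?q y) = hip y (app (?q * ?q) y)"
      by (simp add: hip_app_left star_diff app_simps(7))
    also have "?q * ?q = ?q" by (simp add: algebra_simps)
    also have "hip y (app ?q y) = hip y y - (\<Sum>k<m. star (coord y k) * coord y k)"
      by (simp add: app_simps app_trunc hip_diff_right hip_sum_right hip_mul_right hip_hbasis_right)
    finally show ?thesis by (simp add: norm_hm_eq)
  qed
  have "(\<lambda>m. \<Sum>k<m. star (coord y k) * coord y k) \<longlonglongrightarrow> hip y y"
    using hip_sums[of y y] by (simp add: sums_def)
  then have "(\<lambda>m. sqrt (norm (hip y y - (\<Sum>k<m. star (coord y k) * coord y k)))) \<longlonglongrightarrow> sqrt (norm (hip y y - hip y y))"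
    by (intro tendsto_intros)
  then show ?thesis by (simp add: tendsto_norm_zero_iff[symmetric, of "\<lambda>m. app (1 - trunc m) y"] n)
qed

text \<open>Truncations converge to the identity pointwise but not in norm. Next to a rank one
  operator the error falls on one fixed vector, since \<open>theta x y * (1 - trunc m)\<close> moves
  \<open>1 - trunc m\<close> onto \<open>y\<close>, and norm convergence results.\<close>

lemma finite_rank_aop_trunc_LIMSEQ: "A \<in> finite_rank_aop \<Longrightarrow> (\<lambda>m. A * (1 - trunc m)) \<longlonglongrightarrow> 0"
proof (induction rule: finite_rank_aop_induct)
  case (add x y A)
  have "(\<lambda>m. norm x * norm (app (1 - trunc m) y)) \<longlonglongrightarrow> norm x * norm (0 :: 'a hm)"
    by (intro tendsto_intros trunc_LIMSEQ)
  then have "(\<lambda>m. norm x * norm (app (1 - trunc m) y)) \<longlonglongrightarrow> 0" by simp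
  then have "(\<lambda>m. theta x y * (1 - trunc m)) \<longlonglongrightarrow> 0"
    by (rule Lim_null_comparison[rotated])
      (auto simp: theta_mult star_diff intro!: always_eventually norm_theta_le)
  from tendsto_add[OF this add.IH] show ?case by (simp add: distrib_right)
qed simp

lemma compact_aop_trunc:
  assumes "K \<in> compact_aop" "e > 0"
  obtains m where "norm (K * (1 - trunc m)) < e"
proof -
  have e: "e / 2 > 0" using assms by simp
  obtain F where F: "F \<in> finite_rank_aop" "norm (K - F) < e / 2" using kopD[OF assms(1) e] by blast
  obtain m where m: "norm (F * (1 - trunc m)) < e / 2"
    using LIMSEQ_D[OF finite_rank_aop_trunc_LIMSEQ[OF F(1)] e] by auto
  have "norm ((K - F) * (1 - trunc m)) \<le> norm (K - F) * 1"
    by (rule order_trans[OF norm_mult_ineq]) (intro mult_left_mono norm_one_minus_trunc_le, simp)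
  then have "norm ((K - F) * (1 - trunc m) + F * (1 - trunc m)) < e"
    using m F(2) norm_triangle_ineq[of "(K - F) * (1 - trunc m)" "F * (1 - trunc m)"] by linarith
  also have "(K - F) * (1 - trunc m) + F * (1 - trunc m) = K * (1 - trunc m)"
    by (simp add: left_diff_distrib)
  finally show thesis by (rule that)
qed

section \<open>The trace\<close>

lemma ennreal_suminf_swap:
  fixes f :: "nat \<Rightarrow> nat \<Rightarrow> ennreal"
  shows "(\<Sum>i. \<Sum>j. f i j) = (\<Sum>j. \<Sum>i. f i j)"
  using nn_integral_suminf[of "\<lambda>j i. f i j" "count_space UNIV"]
  by (simp add: nn_integral_count_space_nat)

text \<open>The same four elements, with the same coefficients, occur in both identities, so
  \<open>tr (star X * X) = tr (X * star X)\<close> for each of them yields the trace property for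
  \<open>star A\<close> and \<open>B\<close>.\<close>

lemma polarization:
  fixes A B :: "'a::unital_cstar_algebra"
  shows "scaleC 4 (star A * B) = star (A + B) * (A + B) - star (A - B) * (A - B)
    + scaleC (- \<i>) (star (A + scaleC \<i> B) * (A + scaleC \<i> B))
    + scaleC \<i> (star (A + scaleC (- \<i>) B) * (A + scaleC (- \<i>) B))"
    (is ?P)
    and "scaleC 4 (B * star A) = (A + B) * star (A + B) - (A - B) * star (A - B)
    + scaleC (- \<i>) ((A + scaleC \<i> B) * star (A + scaleC \<i> B))
    + scaleC \<i> ((A + scaleC (- \<i>) B) * star (A + scaleC (- \<i>) B))"
    (is ?Q)
proof -
  have four: "scaleC 4 x = x + x + x + x" for x :: 'a
    using scaleC_of_real[of 4 x] scaleR_add_left[of 2 2 x] by (simp add: scaleR_2)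
  show ?P
    by (simp add: four star_add star_diff star_scaleC algebra_simps scaleC_mult_left
      scaleC_mult_right scaleC_scaleC scaleC_minus_left scaleC_minus_right scaleC_add_right
      scaleC_diff_right)
  show ?Q
    by (simp add: four star_add star_diff star_scaleC algebra_simps scaleC_mult_left
      scaleC_mult_right scaleC_scaleC scaleC_minus_left scaleC_minus_right scaleC_add_right
      scaleC_diff_right)
qed

section \<open>The trace as a sum over the standard basis\<close>

locale tracial =
  fixes \<tau> :: "'b::unital_cstar_algebra \<Rightarrow> complex"
  assumes tracial: "tracial_state \<tau>"
begin

lemma tau_bounded_linear: "bounded_linear \<tau>"
  using tracial by (simp add: tracial_state_def)

lemma tau_add: "\<tau> (a + b) = \<tau> a + \<tau> b"
  by (rule linear_add[OF bounded_linear.linear[OF tau_bounded_linear]])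

lemma tau_diff: "\<tau> (a - b) = \<tau> a - \<tau> b"
  by (rule linear_diff[OF bounded_linear.linear[OF tau_bounded_linear]])

lemma tau_zero [simp]: "\<tau> 0 = 0"
  by (rule linear_0[OF bounded_linear.linear[OF tau_bounded_linear]])

lemma tau_sum: "\<tau> (\<Sum>i\<in>I. f i) = (\<Sum>i\<in>I. \<tau> (f i))"
  by (rule linear_sum[OF bounded_linear.linear[OF tau_bounded_linear]])

lemma tau_scaleC: "\<tau> (scaleC c a) = c * \<tau> a"
  using tracial by (simp add: tracial_state_def)

lemma tau_commute: "\<tau> (a * b) = \<tau> (b * a)"
  using tracial by (simp add: tracial_state_def)

lemma tau_cpos: "cpos a \<Longrightarrow> 0 \<le> Re (\<tau> a)" "cpos a \<Longrightarrow> Im (\<tau> a) = 0"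
  using tracial by (auto simp: tracial_state_def cpos_def complex_is_Real_iff)

definition diag :: "'b aop \<Rightarrow> nat \<Rightarrow> complex" where
  "diag A k = \<tau> (hip (hbasis k) (app A (hbasis k)))"

lemma diag_add: "diag (A + B) k = diag A k + diag B k"
  by (simp add: diag_def app_simps hip_add_right tau_add)

lemma diag_diff: "diag (A - B) k = diag A k - diag B k"
  by (simp add: diag_def app_simps hip_diff_right tau_diff)

lemma diag_zero [simp]: "diag 0 k = 0"
  by (simp add: diag_def app_simps)

lemma diag_scaleC: "diag (scaleC c A) k = c * diag A k"
  by (simp add: diag_def scaleC_aop.rep_eq hip_mul_right tau_scaleC scaleC_mult_right)

lemma diag_cpos: "cpos A \<Longrightarrow> 0 \<le> Re (diag A k)" "cpos A \<Longrightarrow> Im (diag A k) = 0"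
  by (simp_all add: diag_def tau_cpos cpos_hip_app)

text \<open>A sum, hence visibly additive on positive operators, unlike the supremum
  \<open>pos_trace\<close>, with which it agrees by \<open>pos_trace_op_of\<close>.\<close>

definition pos_tr :: "'b aop \<Rightarrow> ennreal" where
  "pos_tr A = (\<Sum>k. ennreal (Re (diag A k)))"

lemma pos_tr_add: "cpos A \<Longrightarrow> cpos B \<Longrightarrow> pos_tr (A + B) = pos_tr A + pos_tr B"
  unfolding pos_tr_def
  by (subst suminf_add[OF summableI summableI])
    (simp add: diag_add ennreal_plus diag_cpos)

lemma pos_tr_mono: "cpos A \<Longrightarrow> cpos (B - A) \<Longrightarrow> pos_tr A \<le> pos_tr B"
  using pos_tr_add[of A "B - A"] by simp

lemma pos_tr_scaleC:
  assumes "cpos A" "0 \<le> r"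
  shows "pos_tr (scaleC (complex_of_real r) A) = ennreal r * pos_tr A"
  unfolding pos_tr_def
  by (simp add: diag_scaleC ennreal_mult diag_cpos assms)

lemma pos_tr_scaleR: "cpos A \<Longrightarrow> 0 \<le> r \<Longrightarrow> pos_tr (r *\<^sub>R A) = ennreal r * pos_tr A"
  using pos_tr_scaleC[of A r] by (simp add: scaleC_of_real)

lemma Re_tau_hip_self_sums: "(\<lambda>j. Re (\<tau> (star (coord x j) * coord x j))) sums Re (\<tau> (hip x x))"
  by (intro sums_Re bounded_linear.sums[OF tau_bounded_linear] hip_sums)

lemma ennreal_tau_hip_self:
  "ennreal (Re (\<tau> (hip x x))) = (\<Sum>j. ennreal (Re (\<tau> (star (coord x j) * coord x j))))"
  by (rule suminf_ennreal_eq[symmetric, OF _ Re_tau_hip_self_sums]) (simp add: tau_cpos)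

lemma coord_app_hbasis: "coord (app A (hbasis k)) j = star (coord (app (star A) (hbasis j)) k)"
  by (metis hip_app_left hip_hbasis_left hip_hbasis_right star_star)

lemma pos_tr_star_mult_eq: "pos_tr (star A * A) =
    (\<Sum>k. \<Sum>j. ennreal (Re (\<tau> (star (coord (app A (hbasis k)) j) * coord (app A (hbasis k)) j))))"
proof -
  have "diag (star A * A) k = \<tau> (hip (app A (hbasis k)) (app A (hbasis k)))" for k
    by (simp add: diag_def app_simps hip_app_left)
  then show ?thesis unfolding pos_tr_def by (simp add: ennreal_tau_hip_self)
qed

text \<open>Parseval turns both sides into double series in the matrix entries of \<open>A\<close>.
  All terms are nonnegative, so the sums may be exchanged, and \<open>\<tau>\<close> does not
  distinguish \<open>star a * a\<close> from \<open>a * star a\<close> for a single entry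
  \<open>a\<close>.\<close>

lemma pos_tr_star_mult_commute: "pos_tr (star A * A) = pos_tr (A * star A)"
proof -
  let ?a = "\<lambda>k j. coord (app A (hbasis k)) j"
  have "pos_tr (star A * A) = (\<Sum>j. \<Sum>k. ennreal (Re (\<tau> (star (?a k j) * ?a k j))))"
    unfolding pos_tr_star_mult_eq by (rule ennreal_suminf_swap)
  also have "\<dots> = (\<Sum>j. \<Sum>k. ennreal (Re (\<tau> (star (coord (app (star A) (hbasis j)) k)
      * coord (app (star A) (hbasis j)) k))))"
    unfolding coord_app_hbasis[of A] star_star by (subst tau_commute) simp
  also have "\<dots> = pos_tr (A * star A)"
    using pos_tr_star_mult_eq[of "star A"] by (simp add: star_star)
  finally show ?thesis .
qed

text \<open>Expand the square of each \<open>app S x\<close> in the basis and exchange the sums. For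
  the \<open>j\<close>-th basis vector and \<open>?z = app (star S) (hbasis j)\<close>, the
  domination of the sum of the \<open>theta x x\<close> by \<open>1\<close> bounds the inner sum by
  the trace of \<open>hip ?z ?z\<close>. This produces the trace of \<open>S * star S\<close>, which
  is flipped at the end.\<close>

lemma pos_trace_le_pos_tr:
  assumes I: "finite I" "(1 - (\<Sum>x\<in>I. theta x x)) = star Q * Q"
  shows "ennreal (\<Sum>x\<in>I. Re (\<tau> (hip x (app (star S * S) x)))) \<le> pos_tr (star S * S)"
proof -
  let ?f = "\<lambda>x j. Re (\<tau> (star (coord (app S x) j) * coord (app S x) j))"
  have sums: "(\<lambda>j. \<Sum>x\<in>I. ?f x j) sums (\<Sum>x\<in>I. Re (\<tau> (hip x (app (star S * S) x))))"
    unfolding app_simps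
    by (intro sums_sum) (use Re_tau_hip_self_sums in \<open>simp flip: hip_app_left\<close>)
  have "ennreal (\<Sum>x\<in>I. Re (\<tau> (hip x (app (star S * S) x)))) = (\<Sum>j. ennreal (\<Sum>x\<in>I. ?f x j))"
    by (rule suminf_ennreal_eq[symmetric, OF _ sums]) (simp add: tau_cpos sum_nonneg)
  also have "\<dots> \<le> (\<Sum>j. ennreal (Re (diag (S * star S) j)))"
  proof (intro suminf_le summableI ennreal_leI)
    fix j
    let ?z = "app (star S) (hbasis j)"
    have e: "coord (app S x) j = hip ?z x" for x
      by (metis hip_app_right hip_hbasis_left)
    have "(\<Sum>x\<in>I. ?f x j) = Re (\<tau> (\<Sum>x\<in>I. hip ?z x * hip x ?z))"
      unfolding e by (subst tau_commute) (simp add: tau_sum star_hip)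
    also have "(\<Sum>x\<in>I. hip ?z x * hip x ?z) = hip ?z (app (\<Sum>x\<in>I. theta x x) ?z)"
      by (simp add: app_sum hip_sum_right theta.rep_eq hip_mul_right)
    also have "(\<Sum>x\<in>I. theta x x) = 1 - star Q * Q" using I(2) by (simp add: algebra_simps)
    also have "hip ?z (app (1 - star Q * Q) ?z) = hip ?z ?z - hip (app Q ?z) (app Q ?z)"
      by (simp add: app_simps hip_diff_right hip_app_left)
    also have "Re (\<tau> \<dots>) \<le> Re (\<tau> (hip ?z ?z))" by (simp add: tau_diff tau_cpos)
    also have "hip ?z ?z = hip (hbasis j) (app (S * star S) (hbasis j))"
      by (simp add: app_simps hip_app_left star_star)
    finally show "(\<Sum>x\<in>I. ?f x j) \<le> Re (diag (S * star S) j)" by (simp add: diag_def)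
  qed
  also have "\<dots> = pos_tr (star S * S)" by (simp add: pos_tr_star_mult_commute flip: pos_tr_def)
  finally show ?thesis .
qed

text \<open>Every admissible family obeys the upper bound \<open>pos_trace_le_pos_tr\<close>; the
  first \<open>n\<close> basis vectors form an admissible family, with sum \<open>trunc n\<close>,
  and attain the partial sums.\<close>

lemma pos_trace_op_of:
  assumes A: "cpos A"
  shows "pos_trace \<tau> (op_of A) = pos_tr A"
proof (rule antisym)
  obtain S where S: "A = star S * S" using A by (auto simp: cpos_def)
  show "pos_trace \<tau> (op_of A) \<le> pos_tr A"
    unfolding pos_trace_def
  proof (rule SUP_least)
    fix I assume "I \<in> {I. finite I \<and> I \<subseteq> hilb \<and> op_le (\<Sum>x\<in>I. rank_one x x) (idop :: 'b oper)}"
    then have I: "finite I" "I \<subseteq> hilb" "op_le (\<Sum>x\<in>I. rank_one x x) (idop :: 'b oper)" by auto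
    let ?J = "hm_of ` I"
    have inj: "inj_on hm_of I" using I(2) by (metis coord_hm_of inj_onI subsetD)
    have "op_of (1 - (\<Sum>x\<in>?J. theta x x)) = idop - (\<Sum>x\<in>I. rank_one x x)"
    proof -
      have "(\<Sum>x\<in>I. rank_one x x) = (\<Sum>x\<in>I. op_of (theta (hm_of x) (hm_of x)))"
        using I(2) by (intro sum.cong) (auto simp: op_of_theta)
      then show ?thesis
        by (simp add: op_of_diff op_of_one op_of_sum sum.reindex[OF inj])
    qed
    then have "cpos (1 - (\<Sum>x\<in>?J. theta x x))"
      using I(3) by (simp add: op_le_def flip: op_positive_op_of)
    then obtain Q where Q: "1 - (\<Sum>x\<in>?J. theta x x) = star Q * Q" by (auto simp: cpos_def)
    have "(\<Sum>x\<in>I. Re (\<tau> (ip x (op_of A x)))) = (\<Sum>x\<in>?J. Re (\<tau> (hip x (app A x))))"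
      unfolding sum.reindex[OF inj] using I(2)
      by (intro sum.cong) (auto simp: op_of_def hip.rep_eq)
    then show "ennreal (\<Sum>x\<in>I. Re (\<tau> (ip x (op_of A x)))) \<le> pos_tr A"
      using pos_trace_le_pos_tr[OF _ Q, of S] I(1) by (simp add: S)
  qed
  show "pos_tr A \<le> pos_trace \<tau> (op_of A)"
    unfolding pos_tr_def suminf_eq_SUP
  proof (rule SUP_least)
    fix n
    let ?I = "(\<lambda>k. coord (hbasis k :: 'b hm)) ` {..<n}"
    have inj: "inj_on (\<lambda>k. coord (hbasis k :: 'b hm)) {..<n}"
    proof (rule inj_onI)
      fix i j assume "coord (hbasis i :: 'b hm) = coord (hbasis j)"
      then have "coord (hbasis i :: 'b hm) i = coord (hbasis j) i" by simp
      then show "i = j" by (simp add: hbasis.rep_eq split: if_splits)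
    qed
    have "(\<Sum>x\<in>?I. rank_one x x) = op_of (trunc n)"
      by (simp add: sum.reindex[OF inj] trunc_def op_of_sum op_of_theta)
    moreover have "cpos (1 - trunc n :: 'b aop)"
    proof -
      have "1 - trunc n = star (1 - trunc n) * (1 - trunc n :: 'b aop)"
        by (simp add: star_diff algebra_simps)
      then show ?thesis by (metis cpos_star_mult)
    qed
    ultimately have "op_le (\<Sum>x\<in>?I. rank_one x x) idop"
      by (simp add: op_le_def op_positive_op_of flip: op_of_one op_of_diff)
    then have I: "?I \<in> {I. finite I \<and> I \<subseteq> hilb \<and> op_le (\<Sum>x\<in>I. rank_one x x) (idop :: 'b oper)}"
      by auto
    have "(\<Sum>k<n. ennreal (Re (diag A k))) = ennreal (\<Sum>x\<in>?I. Re (\<tau> (ip x (op_of A x))))"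
      by (simp add: sum.reindex[OF inj] diag_def hip.rep_eq sum_ennreal tau_cpos cpos_hip_app A
          flip: hip.rep_eq)
    also have "\<dots> \<le> pos_trace \<tau> (op_of A)"
      unfolding pos_trace_def by (rule SUP_upper[OF I])
    finally show "(\<Sum>k<n. ennreal (Re (diag A k))) \<le> pos_trace \<tau> (op_of A)" .
  qed
qed

lemma pos_trace_class_cases:
  assumes "T \<in> pos_trace_class \<tau>" obtains A where "T = op_of A" "cpos A" "pos_tr A < \<infinity>"
proof -
  have "op_positive T" using assms by (simp add: pos_trace_class_def)
  then obtain A where "T = op_of A" "cpos A" by (rule op_positive_cases)
  then show thesis using that assms by (simp add: pos_trace_class_def pos_trace_op_of)
qed

lemma op_of_pos_trace_class: "cpos A \<Longrightarrow> pos_tr A < \<infinity> \<Longrightarrow> op_of A \<in> pos_trace_class \<tau>"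
  by (simp add: pos_trace_class_def pos_trace_op_of op_positive_op_of)

section \<open>Trace class operators and the linear trace\<close>

definition trace_class_aop :: "'b aop set" where
  "trace_class_aop = {A. op_of A \<in> trace_class \<tau>}"

text \<open>Free of any decomposition into positive operators, so linearity can be read off termwise
  wherever the series converges, in particular on \<open>trace_class_aop\<close>.\<close>

definition tr :: "'b aop \<Rightarrow> complex" where
  "tr A = (\<Sum>k. diag A k)"

lemma trace_class_aop_zero [simp]: "0 \<in> trace_class_aop"
  by (simp add: trace_class_aop_def trace_class_def op_of_zero oper.span_zero)

lemma trace_class_aop_add: "A \<in> trace_class_aop \<Longrightarrow> B \<in> trace_class_aop \<Longrightarrow> A + B \<in> trace_class_aop"
  by (simp add: trace_class_aop_def trace_class_def op_of_add oper.span_add)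

lemma trace_class_aop_diff: "A \<in> trace_class_aop \<Longrightarrow> B \<in> trace_class_aop \<Longrightarrow> A - B \<in> trace_class_aop"
  by (simp add: trace_class_aop_def trace_class_def op_of_diff oper.span_diff)

lemma trace_class_aop_scaleC: "A \<in> trace_class_aop \<Longrightarrow> scaleC c A \<in> trace_class_aop"
  by (simp add: trace_class_aop_def trace_class_def op_of_scaleC oper.span_scale)

lemma trace_class_aop_cpos: "cpos A \<Longrightarrow> pos_tr A < \<infinity> \<Longrightarrow> A \<in> trace_class_aop"
  by (simp add: trace_class_aop_def trace_class_def oper.span_base op_of_pos_trace_class)

lemma trace_class_aop_induct [consumes 1, case_names zero add]:
  assumes "A \<in> trace_class_aop" "P 0"
    "\<And>c B A. cpos B \<Longrightarrow> pos_tr B < \<infinity> \<Longrightarrow> A \<in> trace_class_aop \<Longrightarrow> P A \<Longrightarrow> P (scaleC c B + A)"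
  shows "P A"
proof -
  have "op_of A \<in> oper.span (pos_trace_class \<tau>)"
    using assms(1) by (simp add: trace_class_aop_def trace_class_def)
  then have "\<exists>B. op_of A = op_of B \<and> B \<in> trace_class_aop \<and> P B"
  proof (induction rule: oper.span_induct_alt)
    case base
    show ?case by (rule exI[of _ 0]) (simp add: op_of_zero assms(2))
  next
    case (step c R S)
    obtain B where B: "R = op_of B" "cpos B" "pos_tr B < \<infinity>" using step(1) by (rule pos_trace_class_cases)
    obtain C where C: "S = op_of C" "C \<in> trace_class_aop" "P C" using step by blast
    have "opscale c R + S = op_of (scaleC c B + C)" by (simp add: B C op_of_add op_of_scaleC)
    moreover have "scaleC c B + C \<in> trace_class_aop" by (intro trace_class_aop_add trace_class_aop_scaleC trace_class_aop_cpos B C)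
    moreover have "P (scaleC c B + C)" by (rule assms(3)[OF B(2,3) C(2,3)])
    ultimately show ?case by blast
  qed
  then show ?thesis by (auto simp: op_of_inject)
qed

lemma diag_sums_cpos:
  assumes "cpos A" "pos_tr A < \<infinity>"
  shows "diag A sums complex_of_real (enn2real (pos_tr A))"
proof -
  have s: "summable (\<lambda>k. Re (diag A k))"
    using assms diag_cpos(1) by (intro summable_suminf_not_top) (auto simp: pos_tr_def)
  have "pos_tr A = ennreal (\<Sum>k. Re (diag A k))"
    unfolding pos_tr_def using s by (intro suminf_ennreal_eq summable_sums) (simp_all add: diag_cpos assms)
  then have "enn2real (pos_tr A) = (\<Sum>k. Re (diag A k))"
    by (simp add: suminf_nonneg[OF s] diag_cpos assms)
  then have "(\<lambda>k. Re (diag A k)) sums enn2real (pos_tr A)" using s by (simp add: summable_sums)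
  then have "(\<lambda>k. complex_of_real (Re (diag A k))) sums complex_of_real (enn2real (pos_tr A))"
    by (rule sums_of_real)
  moreover have "(\<lambda>k. complex_of_real (Re (diag A k))) = diag A"
    by (simp add: fun_eq_iff complex_eq_iff diag_cpos assms)
  ultimately show ?thesis by simp
qed

lemma trace_class_aop_summable: "A \<in> trace_class_aop \<Longrightarrow> summable (diag A)"
proof (induction rule: trace_class_aop_induct)
  case zero
  show ?case using summable_zero by (simp add: diag_def app_simps)
next
  case (add c B A)
  have "summable (\<lambda>k. c * diag B k + diag A k)"
    by (intro summable_add summable_mult add sums_summable[OF diag_sums_cpos])
  moreover have "diag (scaleC c B + A) = (\<lambda>k. c * diag B k + diag A k)"
    by (simp add: fun_eq_iff diag_add diag_scaleC)
  ultimately show ?case by simp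
qed

lemma tr_add: "A \<in> trace_class_aop \<Longrightarrow> B \<in> trace_class_aop \<Longrightarrow> tr (A + B) = tr A + tr B"
  by (simp add: tr_def diag_add suminf_add trace_class_aop_summable)

lemma tr_diff: "A \<in> trace_class_aop \<Longrightarrow> B \<in> trace_class_aop \<Longrightarrow> tr (A - B) = tr A - tr B"
  by (simp add: tr_def diag_diff suminf_diff trace_class_aop_summable)

lemma tr_scaleC: "A \<in> trace_class_aop \<Longrightarrow> tr (scaleC c A) = c * tr A"
  by (simp add: tr_def diag_scaleC suminf_mult trace_class_aop_summable)

lemma tr_zero [simp]: "tr 0 = 0"
  by (simp add: tr_def)

lemma tr_sum: "(\<And>i. i \<in> I \<Longrightarrow> f i \<in> trace_class_aop) \<Longrightarrow> (\<Sum>i\<in>I. f i) \<in> trace_class_aop \<and> tr (\<Sum>i\<in>I. f i) = (\<Sum>i\<in>I. tr (f i))"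
  by (induction I rule: infinite_finite_induct) (auto simp: tr_add trace_class_aop_add)

lemma tr_cpos: "cpos A \<Longrightarrow> pos_tr A < \<infinity> \<Longrightarrow> tr A = complex_of_real (enn2real (pos_tr A))"
  unfolding tr_def by (rule sums_unique[symmetric, OF diag_sums_cpos])

text \<open>By linearity of \<open>tr\<close>, every representation as a combination of positive
  trace class operators evaluates to the diagonal series, so the definite description has exactly
  one candidate.\<close>

lemma op_trace_op_of:
  assumes A: "A \<in> trace_class_aop"
  shows "op_trace \<tau> (op_of A) = tr A"
  unfolding op_trace_def
proof (rule the_equality)
  have "op_of A \<in> oper.span (pos_trace_class \<tau>)" using A by (simp add: trace_class_aop_def trace_class_def)
  then obtain F c where F: "finite F" "F \<subseteq> pos_trace_class \<tau>" "op_of A = (\<Sum>B\<in>F. opscale (c B) B)"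
    unfolding oper.span_explicit by blast
  have *: "(\<Sum>B\<in>F. c B * complex_of_real (enn2real (pos_trace \<tau> B))) = tr A"
    if F: "finite F" "F \<subseteq> pos_trace_class \<tau>" "op_of A = (\<Sum>B\<in>F. opscale (c B) B)" for F c
  proof -
    have "\<exists>g. \<forall>B\<in>F. B = op_of (g B) \<and> cpos (g B) \<and> pos_tr (g B) < \<infinity>"
      using F(2) by (intro bchoice) (metis pos_trace_class_cases subsetD)
    then obtain g where g: "\<And>B. B \<in> F \<Longrightarrow> B = op_of (g B)" "\<And>B. B \<in> F \<Longrightarrow> cpos (g B)"
      "\<And>B. B \<in> F \<Longrightarrow> pos_tr (g B) < \<infinity>" by blast
    have "op_of A = (\<Sum>B\<in>F. op_of (scaleC (c B) (g B)))"
      unfolding F(3) by (intro sum.cong refl) (metis g(1) op_of_scaleC)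
    then have A': "A = (\<Sum>B\<in>F. scaleC (c B) (g B))" by (simp add: op_of_inject flip: op_of_sum)
    have "tr A = (\<Sum>B\<in>F. tr (scaleC (c B) (g B)))"
      unfolding A' using g by (intro conjunct2[OF tr_sum] trace_class_aop_scaleC trace_class_aop_cpos) auto
    also have "\<dots> = (\<Sum>B\<in>F. c B * complex_of_real (enn2real (pos_trace \<tau> B)))"
    proof (intro sum.cong refl)
      fix B assume B: "B \<in> F"
      have "pos_trace \<tau> B = pos_tr (g B)" using g[OF B] by (metis pos_trace_op_of)
      then show "tr (scaleC (c B) (g B)) = c B * complex_of_real (enn2real (pos_trace \<tau> B))"
        using g[OF B] by (simp add: tr_scaleC trace_class_aop_cpos tr_cpos)
    qed
    finally show ?thesis ..
  qed
  show "\<exists>F c. finite F \<and> F \<subseteq> pos_trace_class \<tau> \<and> op_of A = (\<Sum>A\<in>F. opscale (c A) A) \<and>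
      tr A = (\<Sum>A\<in>F. c A * complex_of_real (enn2real (pos_trace \<tau> A)))"
    by (intro exI[of _ F] exI[of _ c] conjI F *[OF F, symmetric])
  show "t = tr A" if t: "\<exists>F c. finite F \<and> F \<subseteq> pos_trace_class \<tau> \<and> op_of A = (\<Sum>A\<in>F. opscale (c A) A) \<and>
      t = (\<Sum>A\<in>F. c A * complex_of_real (enn2real (pos_trace \<tau> A)))" for t
  proof -
    obtain G d where "finite G" "G \<subseteq> pos_trace_class \<tau>" "op_of A = (\<Sum>A\<in>G. opscale (d A) A)"
      "t = (\<Sum>A\<in>G. d A * complex_of_real (enn2real (pos_trace \<tau> A)))"
      using t by blast
    then show ?thesis using *[of G d] by simp
  qed
qed

section \<open>Hilbert-Schmidt operators and cyclicity of the trace\<close>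

definition hilbert_schmidt :: "'b aop set" where
  "hilbert_schmidt = {A. pos_tr (star A * A) < \<infinity>}"

lemma hilbert_schmidt_star: "A \<in> hilbert_schmidt \<Longrightarrow> star A \<in> hilbert_schmidt"
  by (simp add: hilbert_schmidt_def star_star pos_tr_star_mult_commute)

text \<open>Conjugating the inequality between \<open>star B * B\<close> and the scalar
  \<open>(norm B)\<^sup>2\<close> by \<open>A\<close> bounds the new trace by a multiple of the old
  one.\<close>

lemma hilbert_schmidt_mult_left:
  assumes "A \<in> hilbert_schmidt"
  shows "B * A \<in> hilbert_schmidt"
proof -
  let ?m = "(norm B)\<^sup>2"
  have "cpos (of_real ?m - star B * B)"
    using cpos_norm_minus[of "star B * B"] by (simp add: star_mult star_star cstar_identity)
  from cpos_conjugate[OF this, of A]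
  have "cpos (?m *\<^sub>R (star A * A) - star (B * A) * (B * A))"
    by (simp add: star_mult algebra_simps of_real_def flip: mult.assoc)
  then have "pos_tr (star (B * A) * (B * A)) \<le> pos_tr (?m *\<^sub>R (star A * A))"
    by (intro pos_tr_mono) auto
  also have "\<dots> = ennreal ?m * pos_tr (star A * A)" by (rule pos_tr_scaleR) auto
  also have "\<dots> < \<infinity>" using assms by (simp add: hilbert_schmidt_def ennreal_mult_less_top)
  finally show ?thesis by (simp add: hilbert_schmidt_def)
qed

lemma hilbert_schmidt_mult_right: "A \<in> hilbert_schmidt \<Longrightarrow> A * B \<in> hilbert_schmidt"
  using hilbert_schmidt_star[OF hilbert_schmidt_mult_left[OF hilbert_schmidt_star, of A "star B"]] by (simp add: star_mult star_star)

lemma hilbert_schmidt_scaleC: "A \<in> hilbert_schmidt \<Longrightarrow> scaleC c A \<in> hilbert_schmidt"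
  using hilbert_schmidt_mult_left[of A "scaleC c 1"] by (simp add: scaleC_mult_left)

text \<open>Parallelogram law: the squares of \<open>A + B\<close> and \<open>A - B\<close> add up
  to twice those of \<open>A\<close> and \<open>B\<close>, and the square of \<open>A - B\<close> is
  positive.\<close>

lemma hilbert_schmidt_add:
  assumes "A \<in> hilbert_schmidt" "B \<in> hilbert_schmidt"
  shows "A + B \<in> hilbert_schmidt"
proof -
  have "(2 *\<^sub>R (star A * A) + 2 *\<^sub>R (star B * B)) - star (A + B) * (A + B) = star (A - B) * (A - B)"
    by (simp add: star_add star_diff algebra_simps scaleR_2)
  then have "pos_tr (star (A + B) * (A + B)) \<le> pos_tr (2 *\<^sub>R (star A * A) + 2 *\<^sub>R (star B * B))"
    by (intro pos_tr_mono) auto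
  also have "\<dots> = ennreal 2 * pos_tr (star A * A) + ennreal 2 * pos_tr (star B * B)"
    by (simp only: pos_tr_add pos_tr_scaleR cpos_scaleR cpos_star_mult zero_le_numeral)
  also have "\<dots> < \<infinity>" using assms by (simp add: hilbert_schmidt_def ennreal_mult_less_top)
  finally show ?thesis by (simp add: hilbert_schmidt_def)
qed

lemma hilbert_schmidt_diff: "A \<in> hilbert_schmidt \<Longrightarrow> B \<in> hilbert_schmidt \<Longrightarrow> A - B \<in> hilbert_schmidt"
  using hilbert_schmidt_add[OF _ hilbert_schmidt_scaleC, of A B "-1"] by (simp add: scaleC_minus_left)

lemma hilbert_schmidt_trace_class_aop: "A \<in> hilbert_schmidt \<Longrightarrow> star A * A \<in> trace_class_aop" "A \<in> hilbert_schmidt \<Longrightarrow> A * star A \<in> trace_class_aop"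
  by (auto simp: hilbert_schmidt_def intro!: trace_class_aop_cpos) (simp flip: pos_tr_star_mult_commute)

lemma hilbert_schmidt_tr: "A \<in> hilbert_schmidt \<Longrightarrow> tr (star A * A) = tr (A * star A)"
  by (simp add: hilbert_schmidt_def tr_cpos flip: pos_tr_star_mult_commute)

lemma trace_class_aop_of_scaleC_4: "scaleC 4 A \<in> trace_class_aop \<Longrightarrow> A \<in> trace_class_aop"
  using trace_class_aop_scaleC[of "scaleC 4 A" "1/4"] by (simp add: scaleC_scaleC)

lemma hilbert_schmidt_mult:
  assumes A: "A \<in> hilbert_schmidt" and B: "B \<in> hilbert_schmidt"
  shows "star A * B \<in> trace_class_aop" "B * star A \<in> trace_class_aop" "tr (star A * B) = tr (B * star A)"
proof -
  note h = hilbert_schmidt_add[OF A B] hilbert_schmidt_diff[OF A B] hilbert_schmidt_add[OF A hilbert_schmidt_scaleC[OF B, of \<i>]]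
    hilbert_schmidt_add[OF A hilbert_schmidt_scaleC[OF B, of "- \<i>"]]
  note t = hilbert_schmidt_trace_class_aop[OF h(1)] hilbert_schmidt_trace_class_aop[OF h(2)] hilbert_schmidt_trace_class_aop[OF h(3)] hilbert_schmidt_trace_class_aop[OF h(4)]
  have p4: "scaleC 4 (star A * B) \<in> trace_class_aop" and q4: "scaleC 4 (B * star A) \<in> trace_class_aop"
    unfolding polarization by (intro trace_class_aop_add trace_class_aop_diff trace_class_aop_scaleC t)+
  then show p: "star A * B \<in> trace_class_aop" and q: "B * star A \<in> trace_class_aop" by (auto intro: trace_class_aop_of_scaleC_4)
  have "tr (scaleC 4 (star A * B)) = tr (scaleC 4 (B * star A))"
    unfolding polarization
    by (simp only: tr_add tr_diff tr_scaleC trace_class_aop_add trace_class_aop_diff trace_class_aop_scaleC t hilbert_schmidt_tr[OF h(1)] hilbert_schmidt_tr[OF h(2)]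
        hilbert_schmidt_tr[OF h(3)] hilbert_schmidt_tr[OF h(4)])
  then show "tr (star A * B) = tr (B * star A)" using p q by (simp add: tr_scaleC)
qed

text \<open>Write \<open>A\<close> as \<open>R * R\<close> with \<open>R\<close> self-adjoint and
  Hilbert-Schmidt; both traces then equal that of \<open>R * B * R\<close>.\<close>

lemma trace_class_aop_cpos_mult:
  assumes A: "cpos A" "pos_tr A < \<infinity>"
  shows "B * A \<in> trace_class_aop" "A * B \<in> trace_class_aop" "tr (A * B) = tr (B * A)"
proof -
  obtain R where R: "cpos R" "R * R = A" using cpos_sqrt[OF A(1)] by metis
  have sR: "star R = R" by (rule cpos_self_adjoint[OF R(1)])
  have Rh: "R \<in> hilbert_schmidt" using A by (simp add: hilbert_schmidt_def sR R)
  note m = hilbert_schmidt_mult[OF hilbert_schmidt_star[OF hilbert_schmidt_mult_left[OF Rh, of B]] Rh]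
    and n = hilbert_schmidt_mult[OF Rh hilbert_schmidt_mult_right[OF Rh, of B]]
  have "B * R * R = B * A" "R * (R * B) = A * B" by (simp_all add: R(2)[symmetric] mult.assoc)
  then show "B * A \<in> trace_class_aop" "A * B \<in> trace_class_aop" "tr (A * B) = tr (B * A)"
    using m n by (simp_all add: star_star sR mult.assoc)
qed

lemma trace_class_aop_mult:
  assumes "A \<in> trace_class_aop"
  shows "B * A \<in> trace_class_aop \<and> A * B \<in> trace_class_aop \<and> tr (A * B) = tr (B * A)"
  using assms
proof (induction rule: trace_class_aop_induct)
  case (add c C A)
  note m = trace_class_aop_cpos_mult[OF add(1,2), of B]
  show ?case
    using m add(4)
    by (simp add: distrib_left distrib_right scaleC_mult_left scaleC_mult_right trace_class_aop_add trace_class_aop_scaleC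
        tr_add tr_scaleC)
qed simp

lemma trace_class_aop_mult_left: "A \<in> trace_class_aop \<Longrightarrow> B * A \<in> trace_class_aop"
  and trace_class_aop_mult_right: "A \<in> trace_class_aop \<Longrightarrow> A * B \<in> trace_class_aop"
  and tr_commute: "A \<in> trace_class_aop \<Longrightarrow> tr (A * B) = tr (B * A)"
  using trace_class_aop_mult by blast+

text \<open>The square of this operator has at most one nonzero diagonal entry. The auxiliary vector
  \<open>hbasis 0\<close> serves to factor an arbitrary \<open>theta x y\<close> as
  \<open>theta x (hbasis 0) * star (theta y (hbasis 0))\<close>.\<close>

lemma theta_hilbert_schmidt: "theta x (hbasis 0) \<in> hilbert_schmidt"
proof -
  have "star (theta x (hbasis 0)) * theta x (hbasis 0) = theta (hmul (hbasis 0) (hip x x)) (hbasis 0)"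
    by (simp add: star_theta mult_theta theta.rep_eq)
  then have "diag (star (theta x (hbasis 0)) * theta x (hbasis 0)) k = 0" if "k \<noteq> 0" for k
    using that by (simp add: diag_def theta.rep_eq hip_hbasis)
  then have "pos_tr (star (theta x (hbasis 0)) * theta x (hbasis 0))
      = (\<Sum>k\<in>{0}. ennreal (Re (diag (star (theta x (hbasis 0)) * theta x (hbasis 0)) k)))"
    unfolding pos_tr_def by (intro suminf_finite) auto
  then show ?thesis by (simp add: hilbert_schmidt_def)
qed

lemma finite_rank_aop_trace_class_aop: "A \<in> finite_rank_aop \<Longrightarrow> A \<in> trace_class_aop"
proof (induction rule: finite_rank_aop_induct)
  case (add x y A)
  have "theta x (hbasis 0) * star (theta y (hbasis 0)) \<in> trace_class_aop"
    by (rule hilbert_schmidt_mult(2)[OF theta_hilbert_schmidt theta_hilbert_schmidt])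
  also have "theta x (hbasis 0) * star (theta y (hbasis 0)) = theta x y"
    by (simp add: star_theta mult_theta theta.rep_eq hip_hbasis)
  finally show ?case using add by (simp add: trace_class_aop_add)
qed simp

text \<open>A finite rank \<open>F\<close> at distance below one from \<open>P\<close> makes
  \<open>1 - P * (P - F) * P\<close> invertible; multiplied by \<open>P\<close> this element gives
  \<open>P * F * P\<close>, so \<open>P\<close> is a multiple of a finite rank operator.\<close>

lemma compact_aop_projection_trace_class_aop:
  assumes P: "P \<in> compact_aop" "P * P = P" "star P = P"
  shows "P \<in> trace_class_aop"
proof -
  obtain F where F: "F \<in> finite_rank_aop" "norm (P - F) < 1" using kopD[OF P(1), of 1] by auto
  let ?x = "P * (P - F) * P"
  have "norm ?x \<le> norm (P * (P - F)) * norm P" by (rule norm_mult_ineq)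
  also have "\<dots> \<le> norm (P * (P - F)) * 1"
    by (intro mult_left_mono norm_projection_le P) simp
  also have "\<dots> \<le> norm P * norm (P - F)" using norm_mult_ineq[of P "P - F"] by simp
  also have "\<dots> \<le> 1 * norm (P - F)" by (intro mult_right_mono norm_projection_le P) simp
  also have "\<dots> < 1" using F(2) by simp
  finally obtain z where z: "z * (1 - ?x) = 1" by (metis one_minus_invertible)
  have "(1 - ?x) * P = P * F * P" using P(2) by (simp add: algebra_simps)
  then have "P = z * (P * F * P)" by (metis z mult.assoc mult_1)
  moreover have "z * (P * F * P) \<in> trace_class_aop"
    by (intro trace_class_aop_mult_left finite_rank_aop_trace_class_aop finite_rank_aop_mult_left finite_rank_aop_mult_right F)
  ultimately show ?thesis by simp
qed

end

section \<open>The trace of the index\<close>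

context tracial
begin

definition parametrix :: "'b aop \<Rightarrow> 'b aop \<Rightarrow> bool" where
  "parametrix T S \<longleftrightarrow> 1 - S * T \<in> trace_class_aop \<and> 1 - T * S \<in> trace_class_aop"

text \<open>Calderon's index formula; formally the trace of \<open>T * S - S * T\<close>, although
  the two products need not be trace class separately.\<close>

definition trace_index :: "'b aop \<Rightarrow> 'b aop \<Rightarrow> complex" where
  "trace_index T S = tr (1 - S * T) - tr (1 - T * S)"

text \<open>The difference \<open>?D\<close> of two parametrices is trace class, being
  \<open>S * (1 - T * S') - (1 - S * T) * S'\<close>; replacing one by the other changes the two
  remainders by \<open>?D * T\<close> and \<open>T * ?D\<close>, whose traces agree.\<close>

lemma trace_index_unique:
  assumes "parametrix T S" "parametrix T S'"
  shows "trace_index T S = trace_index T S'"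
proof -
  let ?D = "S - S'"
  have "?D = S * (1 - T * S') - (1 - S * T) * S'" by (simp add: algebra_simps)
  then have D: "?D \<in> trace_class_aop"
    using assms by (simp add: parametrix_def trace_class_aop_diff trace_class_aop_mult_left trace_class_aop_mult_right)
  have "1 - S' * T = (1 - S * T) + ?D * T" "1 - T * S' = (1 - T * S) + T * ?D"
    by (simp_all add: algebra_simps)
  then have "tr (1 - S' * T) = tr (1 - S * T) + tr (?D * T)"
    "tr (1 - T * S') = tr (1 - T * S) + tr (T * ?D)"
    using assms D by (simp_all only: tr_add trace_class_aop_mult_left trace_class_aop_mult_right parametrix_def)
  then show ?thesis by (simp add: trace_index_def tr_commute[OF D, of T])
qed

text \<open>The parametrix can be kept: the remainders change by \<open>S * k\<close> and
  \<open>k * S\<close>, which have equal trace.\<close>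

lemma parametrix_trace_class_perturbation:
  assumes TS: "parametrix T S" and k: "k \<in> trace_class_aop"
  shows "parametrix (T + k) S" "trace_index (T + k) S = trace_index T S"
proof -
  have e: "1 - S * (T + k) = (1 - S * T) - S * k" "1 - (T + k) * S = (1 - T * S) - k * S"
    by (simp_all add: algebra_simps)
  show "parametrix (T + k) S"
    using TS k unfolding parametrix_def e by (simp add: trace_class_aop_diff trace_class_aop_mult_left trace_class_aop_mult_right)
  show "trace_index (T + k) S = trace_index T S"
    using TS k unfolding parametrix_def trace_index_def e
    by (simp add: tr_diff trace_class_aop_mult_left trace_class_aop_mult_right tr_commute[OF k, of S])
qed

text \<open>Here \<open>S' = (1 + S k)\<^sup>-\<^sup>1 S = S (1 + k S)\<^sup>-\<^sup>1\<close>; the two remainders become \<open>u (1 - S T)\<close> and \<open>(1 - T S) v\<close>.\<close>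

lemma parametrix_small_perturbation:
  assumes TS: "parametrix T S" and k: "norm (S * k) < 1" "norm (k * S) < 1"
  obtains S' where "parametrix (T + k) S'" "trace_index (T + k) S' = trace_index T S"
proof -
  define r where "r = 1 - S * T"
  define q where "q = 1 - T * S"
  have r: "r \<in> trace_class_aop" and q: "q \<in> trace_class_aop" using TS by (simp_all add: parametrix_def r_def q_def)
  obtain u where u: "u * (1 + S * k) = 1" "(1 + S * k) * u = 1"
    using one_minus_invertible[of "- (S * k)"] k(1) by auto
  obtain v where v: "v * (1 + k * S) = 1" "(1 + k * S) * v = 1"
    using one_minus_invertible[of "- (k * S)"] k(2) by auto
  have uS: "u * S = S * v"
  proof -
    have "u * S = u * S * ((1 + k * S) * v)" by (simp add: v)
    also have "\<dots> = u * ((1 + S * k) * S) * v" by (simp add: algebra_simps)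
    also have "\<dots> = u * (1 + S * k) * S * v" by (simp add: mult.assoc)
    finally show ?thesis by (simp add: u)
  qed
  have rS: "r * S = S * q" by (simp add: r_def q_def algebra_simps)
  have u': "u = 1 - u * (S * k)" using u(1) by (simp add: algebra_simps)
  have v': "v = 1 - k * S * v" using v(2) by (simp add: algebra_simps)
  have vkS: "v * k * S = k * S * v" using v by (simp add: algebra_simps) (metis add_left_cancel)
  have e1: "1 - (u * S) * (T + k) = u * r"
  proof -
    have "u * r = u * (1 + S * k) - u * (S * T) - u * (S * k)"
      by (simp add: r_def algebra_simps)
    then show ?thesis by (simp add: u(1)) (simp add: algebra_simps)
  qed
  have e2: "1 - (T + k) * (u * S) = q * v"
  proof -
    have "q * v = (1 + k * S) * v - T * (S * v) - k * (S * v)"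
      by (simp add: q_def algebra_simps)
    then show ?thesis unfolding uS by (simp add: v(2)) (simp add: algebra_simps)
  qed
  have t: "u * r \<in> trace_class_aop" "q * v \<in> trace_class_aop" using r q by (auto intro: trace_class_aop_mult_left trace_class_aop_mult_right)
  \<comment> \<open>These are the corrections left after splitting off \<open>tr r\<close> and
    \<open>tr q\<close>. They agree because \<open>S\<close> can be moved around cyclically, using
    \<open>u * S = S * v\<close> and \<open>r * S = S * q\<close>.\<close>
  have "tr (u * (S * k) * r) = tr (q * (k * S * v))"
  proof -
    have "u * (S * k) * r = S * (v * k * r)" by (metis uS mult.assoc)
    then have "tr (u * (S * k) * r) = tr (v * k * r * S)"
      using tr_commute[OF trace_class_aop_mult_left[OF r], of "v * k" S] by simp
    also have "v * k * r * S = v * k * S * q" by (metis rS mult.assoc)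
    also have "tr \<dots> = tr (q * (v * k * S))" using tr_commute[OF q] by simp
    finally show ?thesis by (simp add: vkS)
  qed
  moreover have "tr (u * r) = tr r - tr (u * (S * k) * r)"
  proof -
    have "u * r = r - u * (S * k) * r" by (subst u') (simp add: algebra_simps)
    then show ?thesis using r by (metis tr_diff trace_class_aop_mult_left)
  qed
  moreover have "tr (q * v) = tr q - tr (q * (k * S * v))"
  proof -
    have "q * v = q - q * (k * S * v)" by (subst v') (simp add: algebra_simps)
    then show ?thesis using q by (metis tr_diff trace_class_aop_mult_right)
  qed
  ultimately have "trace_index (T + k) (u * S) = trace_index T S"
    unfolding trace_index_def e1 e2 by (simp add: r_def q_def)
  moreover have "parametrix (T + k) (u * S)" unfolding parametrix_def e1 e2 using t by simp
  ultimately show thesis by (intro that)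
qed

lemma parametrix_compact_perturbation:
  assumes TS: "parametrix T S" and k: "k \<in> compact_aop"
  obtains S' where "parametrix (T + k) S'" "trace_index (T + k) S' = trace_index T S"
proof -
  have S: "norm S + 1 > 0" by (simp add: add_nonneg_pos)
  \<comment> \<open>The tolerance makes both \<open>S * (k - F)\<close> and
    \<open>(k - F) * S\<close> have norm below one.\<close>
  then obtain F where F: "F \<in> finite_rank_aop" "norm (k - F) < 1 / (norm S + 1)"
    using kopD[OF k, of "1 / (norm S + 1)"] by auto
  have "norm S * norm (k - F) \<le> (norm S + 1) * norm (k - F)" by (intro mult_right_mono) auto
  also have "\<dots> < 1" using F(2) S by (simp add: field_simps)
  finally have n: "norm (S * (k - F)) < 1" "norm ((k - F) * S) < 1"
    using norm_mult_ineq[of S "k - F"] norm_mult_ineq[of "k - F" S] by (auto simp: mult.commute)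
  \<comment> \<open>The finite rank part goes first: it keeps the parametrix \<open>S\<close>, so
    the bounds \<open>n\<close>, taken relative to \<open>S\<close>, still fit the second
    perturbation.\<close>
  note F' = parametrix_trace_class_perturbation[OF TS finite_rank_aop_trace_class_aop[OF F(1)]]
  obtain S' where "parametrix (T + F + (k - F)) S'"
    "trace_index (T + F + (k - F)) S' = trace_index (T + F) S"
    using parametrix_small_perturbation[OF F'(1) n] .
  then show thesis using that F'(2) by simp
qed

lemma geometric_parametrix:
  fixes T :: "'b aop" and n :: nat
  defines "S \<equiv> star T * (\<Sum>j<n. (1 - T * star T) ^ j)"
  shows "1 - S * T = (1 - star T * T) ^ n" "1 - T * S = (1 - T * star T) ^ n"
proof -
  let ?a = "1 - star T * T" and ?b = "1 - T * star T"
  have "T * S = (1 - ?b) * (\<Sum>j<n. ?b ^ j)" by (simp add: S_def mult.assoc)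
  then have "T * S = 1 - ?b ^ n" by (simp only: one_minus_mult_geometric_sum)
  then show "1 - T * S = ?b ^ n" by simp
  \<comment> \<open>\<open>T\<close> intertwines the two defects, \<open>?b * T = T * ?a\<close>,
    which carries the sum of powers of \<open>?b\<close> to one of powers of
    \<open>?a\<close>.\<close>
  have c: "?b ^ j * T = T * ?a ^ j" for j
  proof (induction j)
    case (Suc j)
    have "?b ^ Suc j * T = ?b * (?b ^ j * T)" by (simp add: mult.assoc)
    also have "\<dots> = ?b * T * ?a ^ j" by (simp add: Suc mult.assoc)
    also have "?b * T = T * ?a" by (simp add: algebra_simps)
    finally show ?case by (simp add: mult.assoc)
  qed simp
  have "S * T = star T * (\<Sum>j<n. ?b ^ j * T)" by (simp add: S_def mult.assoc sum_distrib_right)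
  also have "\<dots> = (1 - ?a) * (\<Sum>j<n. ?a ^ j)" by (simp add: c mult.assoc sum_distrib_left)
  finally have "S * T = 1 - ?a ^ n" by (simp only: one_minus_mult_geometric_sum)
  then show "1 - S * T = ?a ^ n" by simp
qed

lemma trace_defect_eq:
  assumes a: "(1 - star T * T) ^ n \<in> trace_class_aop" and b: "(1 - T * star T) ^ n \<in> trace_class_aop"
    and W: "W - T \<in> compact_aop" "1 - star W * W \<in> trace_class_aop" "1 - W * star W \<in> trace_class_aop"
  shows "tr (1 - star W * W) - tr (1 - W * star W)
    = tr ((1 - star T * T) ^ n) - tr ((1 - T * star T) ^ n)"
proof -
  let ?S = "star T * (\<Sum>j<n. (1 - T * star T) ^ j)"
  note g = geometric_parametrix[of T n]
  have "parametrix T ?S" unfolding parametrix_def g using a b by simp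
  then obtain S' where S': "parametrix (T + (W - T)) S'"
      "trace_index (T + (W - T)) S' = trace_index T ?S"
    using parametrix_compact_perturbation W(1) by blast
  have "parametrix W (star W)" using W by (simp add: parametrix_def)
  then have "trace_index W (star W) = trace_index T ?S"
    using S' trace_index_unique[of W S' "star W"] by simp
  then show ?thesis unfolding trace_index_def g .
qed

end

section \<open>Polar decompositions modulo compact operators\<close>

lemma compact_aop_star_mult_cong:
  assumes "star T * T - 1 \<in> compact_aop" "W - T \<in> compact_aop"
  shows "star W * W - 1 \<in> compact_aop"
proof -
  have e: "star W * W - 1 = star W * (W - T) + star (W - T) * T + (star T * T - 1)"
    by (simp add: star_diff algebra_simps)
  show ?thesis
    unfolding e by (intro compact_aop_add compact_aop_mult_left compact_aop_mult_right compact_aop_star assms)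
qed

lemma compact_aop_mult_star_cong:
  assumes "T * star T - 1 \<in> compact_aop" "W - T \<in> compact_aop"
  shows "W * star W - 1 \<in> compact_aop"
  using compact_aop_star_mult_cong[of "star T" "star W"] assms compact_aop_star[OF assms(2)]
  by (simp add: star_star star_diff)

lemma compact_aop_minus_commute: "A - B \<in> compact_aop \<longleftrightarrow> B - A \<in> compact_aop"
  using compact_aop_minus[of "A - B"] compact_aop_minus[of "B - A"] by auto

text \<open>The defect \<open>?d = W - W * (star W * W)\<close> satisfies
  \<open>star ?d * ?d = 0\<close>.\<close>

lemma partial_isometry_initial:
  fixes W :: "'a::unital_cstar_algebra"
  assumes "(star W * W) * (star W * W) = star W * W"
  shows "W * (star W * W) = W"
proof -
  let ?d = "W - W * (star W * W)"
  have "star ?d * ?d = star W * W - (star W * W) * (star W * W) - (star W * W) * (star W * W)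
      + (star W * W) * ((star W * W) * (star W * W))"
    by (simp add: star_diff star_mult star_star algebra_simps)
  also have "\<dots> = 0" by (simp only: assms) simp
  finally have "?d = 0" by (rule star_mult_self_eq_0)
  then show ?thesis by simp
qed

lemma op_abs_op_of:
  assumes "cpos H" "H * H = star G * G"
  shows "op_abs (op_of G) = op_of H"
  unfolding op_abs_def
proof (rule the_equality)
  show "op_positive (op_of H) \<and> op_of H \<circ> op_of H = adj (op_of G) \<circ> op_of G"
    using assms by (simp add: op_positive_op_of flip: op_of_mult)
  fix A assume A: "op_positive A \<and> A \<circ> A = adj (op_of G) \<circ> op_of G"
  then obtain B where B: "A = op_of B" "cpos B" by (auto elim: op_positive_cases)
  then have "B * B = H * H" using A assms by (simp add: op_of_inject flip: op_of_mult)
  then show "A = op_of H" using cpos_sqrt_unique[OF B(2) assms(1)] B(1) by simp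
qed

lemma gen_fredholm_op_of:
  "star T * T - 1 \<in> compact_aop \<Longrightarrow> T * star T - 1 \<in> compact_aop \<Longrightarrow> gen_fredholm (op_of T)"
  unfolding gen_fredholm_def
  by (intro conjI op_of_adjointable bexI[of _ "op_of (star T)"])
    (simp_all flip: op_of_mult op_of_one op_of_diff)

text \<open>As \<open>G\<close> is a compact perturbation of \<open>T\<close>, the square of its
  absolute value \<open>H\<close> is \<open>1\<close> modulo compacts, and by
  \<open>compact_aop_of_square_minus_one\<close> so is \<open>H\<close>. Hence \<open>W * H\<close>
  and \<open>W\<close> agree modulo compacts.\<close>

lemma polar_decomposition_compact_perturbation:
  assumes T: "star T * T - 1 \<in> compact_aop" and G: "G - op_of T \<in> compact_ops"
    and pd: "fredholm_polar_decomposition G (op_of W)"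
  shows "W - T \<in> compact_aop"
proof -
  obtain G' where G': "G = op_of G'"
    using pd unfolding fredholm_polar_decomposition_def by (auto elim: adjointable_cases)
  have GT: "G' - T \<in> compact_aop" using G by (simp add: G' flip: op_of_diff)
  obtain H where H: "cpos H" "H * H = star G' * G'" using cpos_sqrt[OF cpos_star_mult[of G']] by metis
  have Hk: "H - 1 \<in> compact_aop"
    using compact_aop_of_square_minus_one[OF H(1)] compact_aop_star_mult_cong[OF T GT] by (simp add: H(2))
  have "G' = W * H"
    using pd unfolding fredholm_polar_decomposition_def G' op_abs_op_of[OF H]
    by (simp add: op_of_inject flip: op_of_mult)
  then have e: "W - T = (G' - T) - W * (H - 1)" by (simp add: algebra_simps)
  show ?thesis unfolding e by (intro compact_aop_diff compact_aop_mult_left GT Hk)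
qed

text \<open>For a large truncation \<open>p\<close>, the operator \<open>T\<^sup>*T\<close> is invertible on the range of \<open>1 - p\<close>, and
  \<open>T (1 - p)\<close> can be normalised there to a partial isometry with initial projection \<open>1 - p\<close>.\<close>

lemma exists_partial_isometry_perturbation:
  fixes T :: "'b::unital_cstar_algebra aop"
  assumes a: "1 - star T * T \<in> compact_aop"
  obtains W p where "W - T \<in> compact_aop" "star W * W = 1 - p" "p \<in> compact_aop" "p * p = p" "star p = p"
proof -
  define a where "a = 1 - star T * T"
  have ak: "a \<in> compact_aop" and sa: "star a = a"
    using assms by (simp_all add: a_def star_diff star_mult star_star)
  obtain m where m: "norm (a * (1 - trunc m)) < 1" using compact_aop_trunc[OF ak, of 1] by auto
  define p :: "'b aop" where "p = trunc m"
  define r where "r = 1 - p"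
  have p: "p \<in> compact_aop" "p * p = p" "star p = p" by (simp_all add: p_def finite_rank_aop_compact_aop)
  have r: "r * r = r" "star r = r" "p * r = 0" "r * p = 0"
    using p by (simp_all add: r_def star_diff algebra_simps)
  \<comment> \<open>Compression of the defect to the range of \<open>r\<close>. Since it vanishes on
    the range of \<open>p\<close>, the element \<open>1 - y\<close> can be inverted on the whole
    module and not just in the corner.\<close>
  define y where "y = r * (a * r)"
  have "norm y \<le> norm r * norm (a * r)" unfolding y_def by (rule norm_mult_ineq)
  also have "\<dots> \<le> 1 * norm (a * r)" by (intro mult_right_mono norm_projection_le r) simp
  also have "\<dots> < 1" using m by (simp add: r_def p_def)
  finally have y1: "norm y < 1" .
  have sy: "star y = y" by (simp add: y_def star_mult sa r mult.assoc)
  have py: "p * y = 0" "y * p = 0"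
    by (simp_all add: y_def r mult.assoc flip: mult.assoc[of p])
  obtain z where z: "z * (1 - y) = 1" "(1 - y) * z = 1" "\<And>x. x * y = y * x \<Longrightarrow> x * z = z * x"
    using one_minus_invertible[OF y1] by blast
  obtain q where q: "norm q \<le> 1" "(1 - q) * (1 - q) = 1 - y" "star q = q"
      "\<And>x. x * y = y * x \<Longrightarrow> x * q = q * x"
    using square_root_one_minus[OF less_imp_le[OF y1]] sy by metis
  define e where "e = 1 - q"
  have ee: "e * e = 1 - y" using q by (simp add: e_def)
  have se: "star e = e" using q by (simp add: e_def star_diff)
  have pe: "p * e = e * p" using q(4)[of p] py by (simp add: e_def algebra_simps)
  have pz: "p * z = z * p" using z(3)[of p] py by simp
  have ye: "e * y = y * e" using q(4)[of y] by (simp add: e_def algebra_simps)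
  have ez: "e * z = z * e" by (rule z(3)[OF ye])
  have sz: "star z = z"
  proof -
    have "star z * (1 - y) = star ((1 - y) * z)" by (simp add: star_mult star_diff sy)
    then have "star z * (1 - y) = 1" by (simp add: z)
    then have "star z * (1 - y) * z = z" by simp
    then show ?thesis by (simp add: mult.assoc z(2))
  qed
  have "cpos e"
    unfolding cpos_iff_norm_positive norm_positive_def using se q(1)
    by (intro conjI exI[of _ 1]) (simp_all add: e_def)
  have yk: "y \<in> compact_aop" unfolding y_def by (intro compact_aop_mult_left compact_aop_mult_right ak)
  have ek: "e - 1 \<in> compact_aop"
    by (rule compact_aop_of_square_minus_one[OF \<open>cpos e\<close>]) (simp add: ee compact_aop_minus yk)
  have "z - 1 = z - z * (1 - y)" by (simp add: z)
  also have "\<dots> = z * y" by (simp add: algebra_simps)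
  finally have zk: "z - 1 \<in> compact_aop" by (simp add: compact_aop_mult_left yk)
  \<comment> \<open>The inverse square root of \<open>1 - y\<close>, as \<open>e\<close> is the root
    and \<open>z\<close> the inverse.\<close>
  define d where "d = e * z"
  have d1: "d - 1 = (e - 1) * z + (z - 1)" by (simp add: d_def algebra_simps)
  have dk: "d - 1 \<in> compact_aop" unfolding d1 by (intro compact_aop_add compact_aop_mult_right ek zk)
  have sd: "star d = d" by (simp add: d_def star_mult se sz ez)
  have pd: "p * d = d * p" by (metis d_def pe pz mult.assoc)
  have dcd: "d * (1 - y) * d = 1"
    by (metis d_def ee ez mult.assoc mult_1 mult_1_right z(1) z(2))
  have dd: "d * d * (1 - y) = 1"
    by (metis d_def ee ez mult.assoc mult_1 mult_1_right z(1) z(2))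
  \<comment> \<open>On the range of \<open>p\<close> the element \<open>y\<close> is
    \<open>0\<close>, so \<open>d * d\<close> acts there as the identity.\<close>
  have dpd: "d * p * d = p"
  proof -
    have "d * p * d = d * d * p" by (metis pd mult.assoc)
    also have "\<dots> = d * d * ((1 - y) * p)" by (simp add: left_diff_distrib py)
    also have "\<dots> = d * d * (1 - y) * p" by (simp add: mult.assoc)
    finally show ?thesis by (simp add: dd)
  qed
  define W where "W = T * (r * d)"
  have "star W * W = d * (r * ((star T * T) * r)) * d"
    by (simp add: W_def star_mult sd r mult.assoc)
  also have "star T * T = 1 - a" by (simp add: a_def)
  \<comment> \<open>The compression is \<open>r - y\<close>; substituting \<open>r = 1 - p\<close>
    brings out the full \<open>1 - y\<close>, which \<open>d\<close> normalises by
    \<open>dcd\<close>.\<close>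
  also have "r * ((1 - a) * r) = (1 - y) - p"
    by (simp add: left_diff_distrib right_diff_distrib r flip: y_def) (simp add: r_def)
  also have "d * ((1 - y) - p) * d = d * (1 - y) * d - d * p * d"
    by (simp add: left_diff_distrib right_diff_distrib)
  finally have WW: "star W * W = 1 - p" by (simp add: dcd dpd)
  have WT: "W - T = T * ((d - 1) - p * d)" by (simp add: W_def r_def algebra_simps)
  have "W - T \<in> compact_aop" unfolding WT by (intro compact_aop_mult_left compact_aop_diff compact_aop_mult_right dk p)
  then show thesis using WW p by (rule that)
qed

text \<open>A partial isometry is its own polar decomposition, because
  \<open>star W * W = 1 - p\<close> is a projection and hence its own positive root. So the
  perturbation \<open>W\<close> constructed before serves as \<open>G\<close> too.\<close>

lemma exists_fredholm_polar_decomposition: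
  assumes "1 - star T * T \<in> compact_aop" "1 - T * star T \<in> compact_aop"
  shows "\<exists>G W. G - op_of T \<in> compact_ops \<and> fredholm_polar_decomposition G W"
proof -
  obtain W p where W: "W - T \<in> compact_aop" "star W * W = 1 - p" and p: "p \<in> compact_aop" "p * p = p" "star p = p"
    using exists_partial_isometry_perturbation[OF assms(1)] .
  have T: "star T * T - 1 \<in> compact_aop" "T * star T - 1 \<in> compact_aop"
    using assms compact_aop_minus_commute by blast+
  have pp: "(1 - p) * (1 - p) = 1 - p" using p by (simp add: algebra_simps)
  have sp: "star (1 - p) = 1 - p" by (simp add: star_diff p)
  have c: "cpos (1 - p)" using cpos_star_mult[of "1 - p"] by (simp add: sp pp)
  have abs: "op_abs (op_of W) = op_of (1 - p)" by (rule op_abs_op_of[OF c]) (simp add: pp W)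
  have "W * (1 - p) = W" using partial_isometry_initial[of W] by (simp add: W pp)
  then have "fredholm_polar_decomposition (op_of W) (op_of W)"
    unfolding fredholm_polar_decomposition_def partial_isometry_def abs
    using compact_aop_star_mult_cong[OF T(1) W(1)] compact_aop_mult_star_cong[OF T(2) W(1)]
    by (auto simp: gen_fredholm_op_of W pp sp projection_op_of mult.assoc simp flip: op_of_mult)
  then show ?thesis using W(1) by (metis op_of_compact op_of_diff)
qed

section \<open>Murray-von Neumann classes, orthogonal sums and \<open>K0\<close>\<close>

definition cproj :: "'b::unital_cstar_algebra aop \<Rightarrow> bool" where
  "cproj P \<longleftrightarrow> P \<in> compact_aop \<and> P * P = P \<and> star P = P"

lemma op_of_compact_projections [simp]: "op_of P \<in> compact_projections \<longleftrightarrow> cproj P"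
  by (auto simp: compact_projections_def cproj_def projection_op_of)

lemma compact_projections_cases:
  assumes "R \<in> compact_projections" obtains P where "R = op_of P" "cproj P"
proof -
  have "R \<in> compact_ops" using assms by (simp add: compact_projections_def)
  then obtain P where "R = op_of P" by (rule compact_ops_cases)
  then show thesis using that assms by simp
qed

lemma mvn_class_op_of:
  "op_of Q \<in> mvn_class (op_of P) \<longleftrightarrow> cproj Q \<and> (\<exists>V\<in>compact_aop. star V * V = P \<and> V * star V = Q)"
proof -
  have "(\<exists>V\<in>compact_ops. adj V \<circ> V = op_of P \<and> V \<circ> adj V = op_of Q)
      \<longleftrightarrow> (\<exists>V\<in>compact_aop. star V * V = P \<and> V * star V = Q)"
  proof
    assume "\<exists>V\<in>compact_ops. adj V \<circ> V = op_of P \<and> V \<circ> adj V = op_of Q"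
    then obtain V where "V \<in> compact_ops" and V: "adj V \<circ> V = op_of P" "V \<circ> adj V = op_of Q" by blast
    then obtain B where "V = op_of B" "B \<in> compact_aop" by (auto elim: compact_ops_cases)
    then show "\<exists>V\<in>compact_aop. star V * V = P \<and> V * star V = Q"
      using V by (auto simp: op_of_inject simp flip: op_of_mult)
  next
    assume "\<exists>V\<in>compact_aop. star V * V = P \<and> V * star V = Q"
    then obtain V where "V \<in> compact_aop" "star V * V = P" "V * star V = Q" by blast
    then show "\<exists>V\<in>compact_ops. adj V \<circ> V = op_of P \<and> V \<circ> adj V = op_of Q"
      by (intro bexI[of _ "op_of V"]) (auto simp flip: op_of_mult)
  qed
  then show ?thesis by (simp add: mvn_class_def)
qed

lemma mvn_class_cases:
  assumes "R \<in> mvn_class (op_of P)"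
  obtains Q V where "R = op_of Q" "cproj Q" "V \<in> compact_aop" "star V * V = P" "V * star V = Q"
proof -
  have "R \<in> compact_projections" using assms by (simp add: mvn_class_def)
  then obtain Q where "R = op_of Q" by (rule compact_projections_cases)
  then show thesis using that assms mvn_class_op_of by blast
qed

lemma hilb_reindex:
  assumes g: "strict_mono (g :: nat \<Rightarrow> nat)" and x: "x \<in> hilb"
  shows "(\<lambda>k. if k \<in> range g then x (inv g k) else 0) \<in> hilb" "x \<circ> g \<in> hilb"
proof -
  have i: "inv g (g k) = k" for k using g by (simp add: strict_mono_imp_inj_on)
  let ?y = "\<lambda>k. if k \<in> range g then x (inv g k) else 0"
  have "summable (\<lambda>k. star (?y (g k)) * ?y (g k))" using x by (simp add: hilb_def i)
  then show "?y \<in> hilb"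
    unfolding hilb_def mem_Collect_eq by (subst (asm) summable_mono_reindex[OF g]) auto
  let ?f = "\<lambda>k. if k \<in> range g then star (x k) * x k else 0"
  have "summable ?f"
    by (rule summable_cpos_comparison[of "\<lambda>k. star (x k) * x k"]) (use x in \<open>auto simp: hilb_def\<close>)
  then have "summable (\<lambda>k. ?f (g k))" by (subst summable_mono_reindex[OF g]) auto
  then show "x \<circ> g \<in> hilb" by (simp add: hilb_def)
qed

text \<open>For strictly increasing \<open>g\<close> this is the isometry that moves coordinate
  \<open>k\<close> to position \<open>g k\<close>.\<close>

definition shift :: "(nat \<Rightarrow> nat) \<Rightarrow> 'b::unital_cstar_algebra aop" where
  "shift g = aop_of (\<lambda>x. hm_of (\<lambda>k. if k \<in> range g then coord x (inv g k) else 0))"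

lemma adjoint_pair_shift:
  assumes g: "strict_mono g"
  shows "adjoint_pair (\<lambda>x. hm_of (\<lambda>k. if k \<in> range g then coord x (inv g k) else 0))
    (\<lambda>x. hm_of (coord x \<circ> g))"
  unfolding adjoint_pair_def
proof (intro allI)
  fix x y :: "'a hm"
  have i: "inv g (g k) = k" for k using g by (simp add: strict_mono_imp_inj_on)
  note h = hilb_reindex[OF g coord_hilb]
  let ?y = "\<lambda>k. if k \<in> range g then coord y (inv g k) else 0"
  have y: "coord (hm_of ?y) = ?y" by (rule coord_hm_of[OF h(1)])
  have "(\<lambda>k. star (coord x k) * ?y k) sums hip x (hm_of ?y)"
    using hip_sums[of x "hm_of ?y"] unfolding y .
  then have "(\<lambda>k. star (coord x (g k)) * ?y (g k)) sums hip x (hm_of ?y)"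
    by (subst sums_mono_reindex[OF g]) auto
  then have 1: "(\<lambda>k. star (coord x (g k)) * coord y k) sums hip x (hm_of ?y)" by (simp add: i)
  have "(\<lambda>k. star (coord x (g k)) * coord y k) sums hip (hm_of (coord x \<circ> g)) y"
    using hip_sums[of "hm_of (coord x \<circ> g)" y]
    unfolding coord_hm_of[OF h(2)] comp_apply .
  with 1 show "hip x (hm_of ?y) = hip (hm_of (coord x \<circ> g)) y" by (rule sums_unique2)
qed

lemma coord_app_shift:
  "strict_mono g \<Longrightarrow> coord (app (shift g) x) k = (if k \<in> range g then coord x (inv g k) else 0)"
  by (simp add: shift_def app_aop_of[OF adjoint_pair_shift] hilb_reindex(1))

lemma coord_app_star_shift:
  assumes g: "strict_mono g"
  shows "coord (app (star (shift g)) x) k = coord x (g k)"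
proof -
  have "app (star (shift g)) x = hm_of (coord x \<circ> g)"
  proof (rule hip_left_eqI)
    fix y
    have "hip (app (star (shift g)) x) y = hip x (app (shift g) y)" by (simp add: hip_app_right)
    also have "\<dots> = hip (hm_of (coord x \<circ> g)) y"
      unfolding shift_def app_aop_of[OF adjoint_pair_shift[OF g]]
      by (rule adjoint_pairD[OF adjoint_pair_shift[OF g]])
    finally show "hip (app (star (shift g)) x) y = hip (hm_of (coord x \<circ> g)) y" .
  qed
  then show ?thesis by (simp add: hilb_reindex(2)[OF g])
qed

lemma hm_eqI: "(\<And>k. coord x k = coord y k) \<Longrightarrow> x = y"
  by (metis coord_inject ext)

lemma star_shift_mult_shift:
  assumes g: "strict_mono g"
  shows "star (shift g) * shift g = 1"
  by (intro aop_eqI hm_eqI)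
    (simp add: app_simps coord_app_star_shift coord_app_shift g strict_mono_imp_inj_on)

lemma star_shift_mult_shift_disjoint:
  assumes "strict_mono g" "strict_mono h" "range g \<inter> range h = {}"
  shows "star (shift g) * shift h = 0"
proof (intro aop_eqI hm_eqI)
  fix x :: "'a hm" and k
  have "g k \<notin> range h" using assms(3) by blast
  then show "coord (app (star (shift g) * shift h) x) k = coord (app 0 x) k"
    using assms by (simp add: app_simps coord_app_star_shift coord_app_shift zero_hm.rep_eq)
qed

definition even_shift :: "'b::unital_cstar_algebra aop" where
  "even_shift = shift (\<lambda>k. 2 * k)"

definition odd_shift :: "'b::unital_cstar_algebra aop" where
  "odd_shift = shift (\<lambda>k. 2 * k + 1)"

lemma even_odd_shift:
  "star even_shift * even_shift = 1" "star odd_shift * odd_shift = 1"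
  "star even_shift * odd_shift = 0"
proof -
  have e: "strict_mono (\<lambda>k::nat. 2 * k)" and o: "strict_mono (\<lambda>k::nat. 2 * k + 1)"
    by (auto simp: strict_mono_def)
  have "range (\<lambda>k::nat. 2 * k) \<inter> range (\<lambda>k. 2 * k + 1) = {}" by auto presburger
  then show "star even_shift * even_shift = 1" "star odd_shift * odd_shift = 1"
    "star even_shift * odd_shift = 0"
    unfolding even_shift_def odd_shift_def
    using star_shift_mult_shift[OF e] star_shift_mult_shift[OF o]
      star_shift_mult_shift_disjoint[OF e o] by blast+
qed

text \<open>If \<open>V\<close> implements the equivalence of \<open>P\<close> and \<open>Q\<close>,
  then \<open>U * V\<close> implements that of \<open>P\<close> and the conjugated
  projection.\<close>

lemma mvn_class_conjugate:
  assumes "op_of Q \<in> mvn_class (op_of P)" "star U * U = 1"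
  shows "op_of (U * Q * star U) \<in> mvn_class (op_of P)"
proof -
  obtain V where V: "V \<in> compact_aop" "star V * V = P" "V * star V = Q" and Q: "cproj Q"
    using assms(1) by (auto simp: mvn_class_op_of)
  have "(U * Q * star U) * (U * Q * star U) = U * Q * (star U * U) * Q * star U" by (simp add: mult.assoc)
  also have "\<dots> = U * (Q * Q) * star U" by (simp add: assms mult.assoc)
  also have "Q * Q = Q" using Q by (simp add: cproj_def)
  finally have "cproj (U * Q * star U)"
    using Q by (simp add: cproj_def star_mult star_star mult.assoc compact_aop_mult_left compact_aop_mult_right)
  moreover have "star (U * V) * (U * V) = star V * (star U * U) * V" by (simp add: star_mult mult.assoc)
  then have "star (U * V) * (U * V) = P" by (simp add: assms V)
  moreover have "(U * V) * star (U * V) = U * (V * star V) * star U" by (simp add: star_mult mult.assoc)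
  then have "(U * V) * star (U * V) = U * Q * star U" by (simp add: V)
  ultimately show ?thesis unfolding mvn_class_op_of using compact_aop_mult_left[OF V(1), of U] by blast
qed

lemma mvn_class_refl: "cproj P \<Longrightarrow> op_of P \<in> mvn_class (op_of P)"
  unfolding mvn_class_op_of by (intro conjI bexI[of _ P]) (auto simp: cproj_def)

lemma cproj_add:
  assumes "cproj P" "cproj Q" "P * Q = 0"
  shows "cproj (P + Q)"
proof -
  have "star P = P" "star Q = Q" using assms by (simp_all add: cproj_def)
  then have "Q * P = star (P * Q)" by (simp add: star_mult)
  then have "Q * P = 0" by (simp add: assms)
  then show ?thesis using assms by (simp add: cproj_def star_add compact_aop_add algebra_simps)
qed

context tracial
begin

lemma cproj_trace_class_aop: "cproj P \<Longrightarrow> P \<in> trace_class_aop"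
  by (simp add: cproj_def compact_aop_projection_trace_class_aop)

text \<open>Cyclicity needs a trace class factor, which \<open>P\<close> provides: since
  \<open>V * P = V\<close>, the projection \<open>Q\<close> is
  \<open>V * (P * star V)\<close>.\<close>

lemma tr_mvn_class:
  assumes "op_of Q \<in> mvn_class (op_of P)" "cproj P"
  shows "tr Q = tr P"
proof -
  obtain V where V: "star V * V = P" "V * star V = Q" using assms(1) by (auto simp: mvn_class_op_of)
  have P: "P * P = P" "P \<in> trace_class_aop" using assms(2) cproj_trace_class_aop by (auto simp: cproj_def)
  have "V * P = V" using partial_isometry_initial[of V] by (simp add: V P)
  then have "V * (P * star V) = Q" by (metis V(2) mult.assoc)
  then have "tr Q = tr (P * star V * V)" using tr_commute[OF trace_class_aop_mult_right[OF P(2)], of "star V" V] by simp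
  also have "P * star V * V = P" by (simp add: mult.assoc V P)
  finally show ?thesis .
qed

text \<open>The two conjugations make it possible to choose orthogonal representatives in two classes,
  so that the sum of two such classes is nonempty.\<close>

definition trace_set :: "'b oper set \<Rightarrow> complex \<Rightarrow> bool" where
  "trace_set X t \<longleftrightarrow> X \<noteq> {} \<and> (\<forall>R\<in>X. \<exists>P. R = op_of P \<and> cproj P \<and> tr P = t \<and>
     op_of (even_shift * P * star even_shift) \<in> X \<and> op_of (odd_shift * P * star odd_shift) \<in> X)"

lemma trace_set_unique: "trace_set X s \<Longrightarrow> trace_set X t \<Longrightarrow> s = t"
  unfolding trace_set_def by (metis all_not_in_conv op_of_inject)

lemma trace_set_mvn_class:
  assumes P: "cproj P"
  shows "trace_set (mvn_class (op_of P)) (tr P)"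
  unfolding trace_set_def
proof (intro conjI ballI)
  show "mvn_class (op_of P) \<noteq> {}" using mvn_class_refl[OF P] by blast
  fix R assume R: "R \<in> mvn_class (op_of P)"
  then obtain Q where Q: "R = op_of Q" "cproj Q" by (auto elim: mvn_class_cases)
  show "\<exists>Q. R = op_of Q \<and> cproj Q \<and> tr Q = tr P \<and>
      op_of (even_shift * Q * star even_shift) \<in> mvn_class (op_of P) \<and>
      op_of (odd_shift * Q * star odd_shift) \<in> mvn_class (op_of P)"
    using R tr_mvn_class[OF _ P] mvn_class_conjugate even_odd_shift unfolding Q(1)
    by (intro exI[of _ Q]) (auto simp: Q)
qed

text \<open>Every member lies in the class of an orthogonal sum \<open>R + S\<close>, and that whole
  class is contained in \<open>mvn_add X Y\<close>, so \<open>trace_set_mvn_class\<close> supplies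
  the required properties.\<close>

lemma trace_set_mvn_add:
  assumes X: "trace_set X s" and Y: "trace_set Y t"
  shows "trace_set (mvn_add X Y) (s + t)"
proof -
  have sum: "trace_set (mvn_class (R + S)) (s + t)" if RS: "R \<in> X" "S \<in> Y" "R \<circ> S = 0" for R S
  proof -
    obtain P where P: "R = op_of P" "cproj P" "tr P = s" using X RS(1) by (auto simp: trace_set_def)
    obtain Q where Q: "S = op_of Q" "cproj Q" "tr Q = t" using Y RS(2) by (auto simp: trace_set_def)
    have "op_of (P * Q) = op_of 0" using RS(3) by (simp add: P Q op_of_mult op_of_zero)
    then have "cproj (P + Q)" using P Q by (intro cproj_add) (simp_all add: op_of_inject)
    from trace_set_mvn_class[OF this] show ?thesis
      using P Q by (simp add: tr_add cproj_trace_class_aop op_of_add)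
  qed
  obtain P where P: "op_of (even_shift * P * star even_shift) \<in> X"
    using X by (auto simp: trace_set_def)
  obtain Q where Q: "op_of (odd_shift * Q * star odd_shift) \<in> Y"
    using Y by (auto simp: trace_set_def)
  have "(even_shift * P * star even_shift) * (odd_shift * Q * star odd_shift)
      = even_shift * P * (star even_shift * odd_shift) * Q * star odd_shift" by (simp add: mult.assoc)
  then have o: "op_of (even_shift * P * star even_shift) \<circ> op_of (odd_shift * Q * star odd_shift) = 0"
    by (simp add: even_odd_shift op_of_zero flip: op_of_mult)
  have "mvn_add X Y \<noteq> {}"
    using sum[OF P Q o] P Q o unfolding mvn_add_def trace_set_def by blast
  moreover have "\<exists>P. R = op_of P \<and> cproj P \<and> tr P = s + t \<and>
     op_of (even_shift * P * star even_shift) \<in> mvn_add X Y \<and>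
     op_of (odd_shift * P * star odd_shift) \<in> mvn_add X Y" if R: "R \<in> mvn_add X Y" for R
  proof -
    obtain R1 R2 where 1: "R1 \<in> X" "R2 \<in> Y" "R1 \<circ> R2 = 0" "R \<in> mvn_class (R1 + R2)"
      using R by (auto simp: mvn_add_def)
    then have sub: "mvn_class (R1 + R2) \<subseteq> mvn_add X Y" by (auto simp: mvn_add_def)
    show ?thesis using sum[OF 1(1-3)] 1(4) sub unfolding trace_set_def by blast
  qed
  ultimately show ?thesis unfolding trace_set_def by blast
qed

text \<open>\<open>K0_diff\<close> contains its own defining pair, with stabiliser \<open>0\<close>,
  so equal sets give a stable identity between sums of classes. Both sides are the same
  \<open>trace_set\<close>, hence the traces agree, and that of the stabiliser \<open>S\<close>
  cancels.\<close>

lemma K0_diff_trace_eq: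
  assumes c: "cproj P" "cproj Q" "cproj P'" "cproj Q'"
    and eq: "K0_diff (op_of P) (op_of Q) = K0_diff (op_of P') (op_of Q')"
  shows "tr P - tr Q = tr P' - tr Q'"
proof -
  have "op_of (0 :: 'b aop) \<in> compact_projections" by (simp add: cproj_def)
  then have "(op_of P', op_of Q') \<in> K0_diff (op_of P') (op_of Q')"
    using c unfolding K0_diff_def mem_Collect_eq prod.case
    by (intro conjI bexI[of _ "op_of 0"] refl) simp_all
  then have "(op_of P', op_of Q') \<in> K0_diff (op_of P) (op_of Q)" by (simp add: eq)
  then obtain R where R: "R \<in> compact_projections"
    "mvn_add (mvn_add (mvn_class (op_of P)) (mvn_class (op_of Q'))) (mvn_class R) =
     mvn_add (mvn_add (mvn_class (op_of P')) (mvn_class (op_of Q))) (mvn_class R)"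
    by (auto simp: K0_diff_def)
  obtain S where S: "R = op_of S" "cproj S" using R(1) by (rule compact_projections_cases)
  have "trace_set (mvn_add (mvn_add (mvn_class (op_of A)) (mvn_class (op_of B))) (mvn_class R))
      (tr A + tr B + tr S)" if "cproj A" "cproj B" for A B
    unfolding S(1) using that S(2) by (intro trace_set_mvn_add trace_set_mvn_class)
  from this[OF c(1,4)] this[OF c(3,2)] have "tr P + tr Q' + tr S = tr P' + tr Q + tr S"
    unfolding R(2) by (rule trace_set_unique)
  then show ?thesis by (simp add: algebra_simps)
qed

lemma K0_trace_K0_diff:
  assumes c: "cproj P" "cproj Q"
  shows "K0_trace \<tau> (K0_diff (op_of P) (op_of Q)) = Re (tr P) - Re (tr Q)"
  unfolding K0_trace_def
proof (rule the_equality)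
  show "\<exists>P'\<in>compact_projections. \<exists>Q'\<in>compact_projections.
      K0_diff (op_of P) (op_of Q) = K0_diff P' Q' \<and>
      Re (tr P) - Re (tr Q) = Re (op_trace \<tau> P') - Re (op_trace \<tau> Q')"
    using c by (intro bexI[of _ "op_of P"] bexI[of _ "op_of Q"]) (auto simp: op_trace_op_of cproj_trace_class_aop)
  fix t assume "\<exists>P'\<in>compact_projections. \<exists>Q'\<in>compact_projections.
      K0_diff (op_of P) (op_of Q) = K0_diff P' Q' \<and> t = Re (op_trace \<tau> P') - Re (op_trace \<tau> Q')"
  then obtain P' Q' where P': "P' \<in> compact_projections" and Q': "Q' \<in> compact_projections"
    and eq: "K0_diff (op_of P) (op_of Q) = K0_diff P' Q'"
    and t: "t = Re (op_trace \<tau> P') - Re (op_trace \<tau> Q')" by blast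
  obtain A where A: "P' = op_of A" "cproj A" using P' by (rule compact_projections_cases)
  obtain B where B: "Q' = op_of B" "cproj B" using Q' by (rule compact_projections_cases)
  have "tr P - tr Q = tr A - tr B"
    using K0_diff_trace_eq[OF c A(2) B(2)] eq by (simp add: A B)
  then have "Re (tr P - tr Q) = Re (tr A - tr B)" by simp
  then show "t = Re (tr P) - Re (tr Q)" by (simp add: t A B op_trace_op_of cproj_trace_class_aop)
qed

section \<open>Evaluation of the index\<close>

lemma Im_tr_cproj: "cproj P \<Longrightarrow> Im (tr P) = 0"
proof -
  assume P: "cproj P"
  then have "cpos P" using cpos_star_mult[of P] by (simp add: cproj_def)
  then have "(\<lambda>k. Im (diag P k)) sums 0" by (simp add: diag_cpos)
  moreover have "(\<lambda>k. Im (diag P k)) sums Im (tr P)"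
    unfolding tr_def by (intro sums_Im summable_sums trace_class_aop_summable cproj_trace_class_aop P)
  ultimately show ?thesis by (metis sums_unique2)
qed

lemma trace_fredholm_index:
  assumes n: "n \<ge> 1" and a: "(1 - star T * T) ^ n \<in> trace_class_aop \<inter> compact_aop" and b: "(1 - T * star T) ^ n \<in> trace_class_aop \<inter> compact_aop"
  shows "gen_fredholm (op_of T)"
    and "complex_of_real (K0_trace \<tau> (fredholm_index (op_of T)))
      = tr ((1 - star T * T) ^ n) - tr ((1 - T * star T) ^ n)"
proof -
  have k: "1 - star T * T \<in> compact_aop" "1 - T * star T \<in> compact_aop"
    using compact_aop_of_power[OF _ _ n, of "1 - star T * T"] compact_aop_of_power[OF _ _ n, of "1 - T * star T"] a b
    by (simp_all add: star_diff star_mult star_star)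
  then have k': "star T * T - 1 \<in> compact_aop" "T * star T - 1 \<in> compact_aop"
    using compact_aop_minus_commute by blast+
  then show "gen_fredholm (op_of T)" by (rule gen_fredholm_op_of)
  have "\<exists>\<xi> G W. G - op_of T \<in> compact_ops \<and> fredholm_polar_decomposition G W \<and>
      \<xi> = K0_diff (idop - (adj W \<circ> W)) (idop - (W \<circ> adj W))"
    using exists_fredholm_polar_decomposition[OF k] by blast
  then have "\<exists>G W. G - op_of T \<in> compact_ops \<and> fredholm_polar_decomposition G W \<and>
      fredholm_index (op_of T) = K0_diff (idop - (adj W \<circ> W)) (idop - (W \<circ> adj W))"
    unfolding fredholm_index_def by (rule someI_ex)
  \<comment> \<open>The index is a choice, so nothing is known of this pair beyond its defining
    properties; the rest treats an arbitrary polar decomposition of an arbitrary compact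
    perturbation.\<close>
  then obtain G V where G: "G - op_of T \<in> compact_ops" and pd: "fredholm_polar_decomposition G V"
    and ind: "fredholm_index (op_of T) = K0_diff (idop - (adj V \<circ> V)) (idop - (V \<circ> adj V))"
    by blast
  have "V \<in> adjointable" "projection (adj V \<circ> V)"
    using pd by (simp_all add: fredholm_polar_decomposition_def partial_isometry_def)
  then obtain W where V: "V = op_of W" and W: "(star W * W) * (star W * W) = star W * W"
    by (metis adjointable_cases adj_op_of op_of_mult projection_op_of)
  have WT: "W - T \<in> compact_aop"
    by (rule polar_decomposition_compact_perturbation[OF k'(1) G pd[unfolded V]])
  have WW: "1 - star W * W \<in> compact_aop" "1 - W * star W \<in> compact_aop"
    using compact_aop_star_mult_cong[OF k'(1) WT] compact_aop_mult_star_cong[OF k'(2) WT] compact_aop_minus_commute by blast+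
  have "W * star W * (W * star W) = W * star W" using partial_isometry_initial[OF W] by (metis mult.assoc)
  then have P: "cproj (1 - star W * W)" and Q: "cproj (1 - W * star W)"
    using WW W by (simp_all add: cproj_def star_diff star_mult star_star left_diff_distrib right_diff_distrib)
  have "K0_trace \<tau> (fredholm_index (op_of T)) = Re (tr (1 - star W * W)) - Re (tr (1 - W * star W))"
    using K0_trace_K0_diff[OF P Q] by (simp add: ind V op_of_diff op_of_one op_of_mult)
  \<comment> \<open>\<open>K0_trace\<close> retains real parts only; traces of projections are real,
    so the equality lifts to complex numbers.\<close>
  then have "complex_of_real (K0_trace \<tau> (fredholm_index (op_of T)))
      = tr (1 - star W * W) - tr (1 - W * star W)"
    using Im_tr_cproj[OF P] Im_tr_cproj[OF Q] by (simp add: complex_eq_iff)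
  also have "\<dots> = tr ((1 - star T * T) ^ n) - tr ((1 - T * star T) ^ n)"
    using trace_defect_eq[OF _ _ WT cproj_trace_class_aop[OF P] cproj_trace_class_aop[OF Q]] a b by blast
  finally show "complex_of_real (K0_trace \<tau> (fredholm_index (op_of T)))
      = tr ((1 - star T * T) ^ n) - tr ((1 - T * star T) ^ n)" .
qed

end

theorem theorem6p26:
  fixes \<tau> :: "'b::unital_cstar_algebra \<Rightarrow> complex"
    and T :: "'b oper"
    and n :: nat
  assumes "tracial_state \<tau>"
    and "T \<in> adjointable"
    and "opnorm T \<le> 1"
    and "n \<ge> 1"
    and "(idop - (adj T \<circ> T)) ^^ n \<in> trace_class \<tau> \<inter> compact_ops"
    and "(idop - (T \<circ> adj T)) ^^ n \<in> trace_class \<tau> \<inter> compact_ops"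
  shows "gen_fredholm T \<and>
    complex_of_real (K0_trace \<tau> (fredholm_index T)) =
      op_trace \<tau> ((idop - (adj T \<circ> T)) ^^ n) - op_trace \<tau> ((idop - (T \<circ> adj T)) ^^ n)"
proof -
  interpret tracial \<tau> by standard (rule assms(1))
  obtain A where A: "T = op_of A" using assms(2) by (rule adjointable_cases)
  have e: "(idop - (adj T \<circ> T)) ^^ n = op_of ((1 - star A * A) ^ n)"
    "(idop - (T \<circ> adj T)) ^^ n = op_of ((1 - A * star A) ^ n)"
    by (simp_all add: A op_of_power[OF assms(4)] op_of_diff op_of_one op_of_mult)
  have t: "(1 - star A * A) ^ n \<in> trace_class_aop \<inter> compact_aop" "(1 - A * star A) ^ n \<in> trace_class_aop \<inter> compact_aop"
    using assms(5,6) unfolding e by (simp_all add: trace_class_aop_def)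
  then have "op_trace \<tau> (op_of ((1 - star A * A) ^ n)) = tr ((1 - star A * A) ^ n)"
    "op_trace \<tau> (op_of ((1 - A * star A) ^ n)) = tr ((1 - A * star A) ^ n)"
    by (simp_all add: op_trace_op_of)
  then show ?thesis
    using trace_fredholm_index[OF assms(4) t] by (simp add: e) (simp add: A)
qed

end
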